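(* For each $n\in\mathbb N\setminus\{0\}$, the space $\mathcal P\mathcal I^1_0$ of piecewise linear immersions (with respect to the uniform grid with $n$ intervals) with vanishing mean is a totally geodesic submanifold of dimension $(n-1)\times d$ in the manifold $\mathcal I^{1,\infty}_0$ endowed with the weak Riemannian metric $G$.
   Context: Let $d\ge 2$ be an integer and $S^1=\mathbb R/(2\pi\mathbb Z)$. All function spaces consist of functions $S^1\to\mathbb R^d$. $W^{1,\infty}$ is the Banach space of Lipschitz functions with norm $\|c\|_{L^\infty}+\|c_\theta\|_{L^\infty}$ (subscript $\theta$ denotes derivative), and $W^{0,\infty}=L^\infty$. Put $W^{1,\infty}_0=\{h\in W^{1,\infty}:\int_{S^1}h\,d\theta=0\}$ and let $\mathcal I^{1,\infty}_0=\{c\in W^{1,\infty}_0:\operatorname{ess\,inf}_\theta|c_\theta|>0\}$, an open subset of $W^{1,\infty}_0$; it represents Lipschitz immersions modulo translations. For $c\in\mathcal I^{1,\infty}_0$ write $ds=|c_\theta|\,d\theta$, $D_s=|c_\theta|^{-1}\partial_\theta$, $\ell_c=\int_{S^1}ds$. The weak Riemannian metric is $G_c(h,k)=\frac1{\ell_c}\int_{S^1}\langle D_sh,D_sk\rangle\,ds$. Geodesics of $G$ on $\mathcal I^{1,\infty}_0$ are the solutions of $$c_{tt}=G_c(c,c_t)c_t-\tfrac12G_c(c_t,c_t)c+D_s^{-1}\pi_0\big(\langle D_sc,D_sc_t\rangle D_sc_t-\tfrac12|D_sc_t|^2D_sc\big),$$ where $\pi_0$ is the $L^2(ds)$-orthogonal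 projection of $L^\infty$ onto $W^{0,\infty}_0=\{k\in L^\infty:\int_{S^1} k\,ds=0\}$ and $D_s^{-1}:W^{0,\infty}_0\to W^{1,\infty}_0$ is the inverse of the bijection $D_s:W^{1,\infty}_0\to W^{0,\infty}_0$. For $n\ge1$ fix the grid $0=\theta^1<\dots<\theta^{n+1}=2\pi$ with $\theta^{i+1}-\theta^i=2\pi/n$. $\mathcal P^1$ is the set of functions in $W^{1,\infty}$ which are (affine) linear on each $[\theta^i,\theta^{i+1}]$, $\mathcal P^1_0=\mathcal P^1\cap W^{1,\infty}_0$, and $\mathcal P\mathcal I^1_0=\mathcal P^1\cap\mathcal I^{1,\infty}_0$. A submanifold $N$ is totally geodesic if geodesics of the ambient space starting at a point of $N$ with initial velocity tangent to $N$ remain in $N$ (for times near the initial time). *)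

theory Defs
  imports "HOL-Probability.Essential_Supremum"
begin

subsection \<open>Lipschitz functions of one real variable are differentiable almost everywhere\<close>

text \<open>Needed below to see that \<open>W1inf_norm\<close> satisfies the triangle inequality.\<close>

lemma emeasure_UN_le_nn_integral:
  assumes I: "countable I" and X: "\<And>i. i \<in> I \<Longrightarrow> X i \<in> sets M"
  shows "emeasure M (\<Union>i\<in>I. X i) \<le> (\<integral>\<^sup>+i. emeasure M (X i) \<partial>count_space I)"
proof -
  define J where "J = to_nat_on I ` I"
  define Y where "Y n = (if n \<in> J then X (from_nat_into I n) else {})" for n
  have Y: "range Y \<subseteq> sets M" using I X by (auto simp: Y_def J_def)
  have "(\<Union>i\<in>I. X i) \<subseteq> (\<Union>n. Y n)"
  proof
    fix x assume "x \<in> (\<Union>i\<in>I. X i)"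
    then obtain i where i: "i \<in> I" "x \<in> X i" by auto
    then have "x \<in> Y (to_nat_on I i)" using I by (auto simp: Y_def J_def)
    then show "x \<in> (\<Union>n. Y n)" by blast
  qed
  then have "emeasure M (\<Union>i\<in>I. X i) \<le> emeasure M (\<Union>n. Y n)"
    using Y by (intro emeasure_mono) auto
  also have "\<dots> \<le> (\<Sum>n. emeasure M (Y n))"
    by (rule emeasure_subadditive_countably[OF Y])
  also have "\<dots> = (\<integral>\<^sup>+n. emeasure M (Y n) \<partial>count_space UNIV)"
    by (simp add: nn_integral_count_space_nat)
  also have "\<dots> = (\<integral>\<^sup>+n. emeasure M (X (from_nat_into I n)) \<partial>count_space J)"
    by (subst nn_integral_count_space_indicator[of J])
      (auto simp: Y_def indicator_def intro!: nn_integral_cong)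
  also have "\<dots> = (\<integral>\<^sup>+i. emeasure M (X (from_nat_into I (to_nat_on I i))) \<partial>count_space I)"
    unfolding J_def using I
    by (intro nn_integral_bij_count_space[symmetric]) (auto simp: bij_betw_def)
  also have "\<dots> = (\<integral>\<^sup>+i. emeasure M (X i) \<partial>count_space I)"
    using I by (intro nn_integral_cong) auto
  finally show ?thesis .
qed

lemma emeasure_Icc_le_imp_emeasure_le_lborel:
  fixes M :: "real measure"
  assumes sM: "sets M = sets borel" and K: "0 \<le> K"
    and M: "\<And>u v. u \<le> v \<Longrightarrow> emeasure M {u..v} \<le> ennreal K * ennreal (v - u)"
    and A: "A \<in> sets borel" "A \<subseteq> {-R..R}" "0 < R"
  shows "emeasure M A \<le> ennreal K * emeasure lborel A"
proof (rule ennreal_le_epsilon)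
  fix e :: real assume "0 < e"
  define d where "d = e / (K + 1)"
  have "0 < d" using \<open>0 < e\<close> K by (simp add: d_def)
  obtain U where U: "open U" "A \<subseteq> U" "emeasure lborel (U - A) < d"
    using outer_regular_lborel[OF A(1) \<open>0 < d\<close>] .
  have "\<exists>r>0. ball x r \<subseteq> U" if "x \<in> U" for x
    using U(1) that by (simp add: open_contains_ball)
  then obtain r where r: "\<And>x. x \<in> U \<Longrightarrow> 0 < r x \<and> ball x (r x) \<subseteq> U" by metis
  define g where "g x = (if x \<in> U then ball x (r x) else ball x 1)" for x
  have g: "gauge g" using r by (auto simp: gauge_def g_def)
  have "A \<subseteq> cbox (-R) R" "box (-R) R \<noteq> {}" using A by auto
  from covering_lemma[OF this g] obtain D where D: "countable D" 
    "\<And>K. K \<in> D \<Longrightarrow> interior K \<noteq> {} \<and> (\<exists>c d. K = cbox c d)"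
    "pairwise (\<lambda>A B. interior A \<inter> interior B = {}) D"
    "\<And>K. K \<in> D \<Longrightarrow> \<exists>x \<in> A \<inter> K. K \<subseteq> g x" "A \<subseteq> \<Union>D"
    by metis
  have DU: "k \<subseteq> U" if "k \<in> D" for k
    using D(4)[OF that] U(2) r unfolding g_def by (auto split: if_splits dest!: subsetD)
  have DI: "\<exists>c d. c < d \<and> k = {c..d} \<and> interior k = {c<..<d}" if k: "k \<in> D" for k
  proof -
    obtain c d where "k = cbox c d" using D(2)[OF k] by blast
    then show ?thesis using D(2)[OF k] by (intro exI[of _ c] exI[of _ d]) auto
  qed
  have Db: "k \<in> sets borel" if "k \<in> D" for k using DI[OF that] by auto
  have "emeasure M A \<le> emeasure M (\<Union>k\<in>D. k)"
    using D(1,5) Db sM by (intro emeasure_mono) (auto intro!: sets.countable_UN')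
  also have "\<dots> \<le> (\<integral>\<^sup>+k. emeasure M k \<partial>count_space D)"
    using D(1) Db sM by (intro emeasure_UN_le_nn_integral) auto
  also have "\<dots> \<le> (\<integral>\<^sup>+k. ennreal K * emeasure lborel (interior k) \<partial>count_space D)"
  proof (rule nn_integral_mono)
    fix k assume "k \<in> space (count_space D)"
    then obtain c d where "c < d" "k = {c..d}" "interior k = {c<..<d}" using DI[of k] by auto
    then show "emeasure M k \<le> ennreal K * emeasure lborel (interior k)"
      using M[of c d] by simp
  qed
  also have "\<dots> = ennreal K * (\<integral>\<^sup>+k. emeasure lborel (interior k) \<partial>count_space D)"
    by (rule nn_integral_cmult) auto
  also have "(\<integral>\<^sup>+k. emeasure lborel (interior k) \<partial>count_space D) = emeasure lborel (\<Union>k\<in>D. interior k)"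
    using D(1,3) by (intro emeasure_UN_countable[symmetric])
      (auto simp: disjoint_family_on_def pairwise_def)
  also have "\<dots> \<le> emeasure lborel U"
  proof (rule emeasure_mono)
    show "(\<Union>k\<in>D. interior k) \<subseteq> U" using DU interior_subset by blast
  qed (use U(1) in auto)
  also have "\<dots> = emeasure lborel (A \<union> (U - A))"
    using U(2) by (intro arg_cong2[where f=emeasure]) auto
  also have "\<dots> \<le> emeasure lborel A + emeasure lborel (U - A)"
    using A(1) U(1) by (intro emeasure_subadditive) auto
  also have "\<dots> \<le> emeasure lborel A + ennreal d"
    using U(3) by (intro add_left_mono) auto
  also have "ennreal K * (emeasure lborel A + ennreal d) = ennreal K * emeasure lborel A + ennreal (K * d)"
    using K \<open>0 < d\<close> by (simp add: distrib_left ennreal_mult)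
  also have "\<dots> \<le> ennreal K * emeasure lborel A + ennreal e"
  proof -
    have "K * d \<le> e" using K \<open>0 < e\<close> by (simp add: d_def field_simps)
    then show ?thesis by (intro add_left_mono ennreal_leI)
  qed
  finally show "emeasure M A \<le> ennreal K * emeasure lborel A + ennreal e"
    by (simp add: mult_left_mono)
qed

lemma vitali_compare:
  fixes M N :: "real measure"
  assumes sM: "sets M = sets borel" and sN: "sets N = sets borel" and K: "0 \<le> K"
    and M: "\<And>u v. u \<le> v \<Longrightarrow> emeasure M {u..v} \<le> ennreal K * ennreal (v - u)"
    and N: "\<And>u v. u \<le> v \<Longrightarrow> emeasure N {u..v} \<le> ennreal K * ennreal (v - u)"
    and E: "E \<in> sets borel" "E \<subseteq> {-R<..<R}" "0 < R"
    and c: "0 \<le> c"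
    and small: "\<And>x d. x \<in> E \<Longrightarrow> 0 < d \<Longrightarrow>
      \<exists>u v. u < x \<and> x < v \<and> v - u < d \<and> emeasure M {u<..<v} \<le> ennreal c * emeasure N {u<..<v}"
  shows "emeasure M E \<le> ennreal c * emeasure N E"
proof (rule ennreal_le_epsilon)
  fix e :: real assume "0 < e"
  define d where "d = e / (c * K + 1)"
  have "0 < c * K + 1" using K c by (simp add: add_nonneg_pos)
  then have "0 < d" using \<open>0 < e\<close> by (simp add: d_def)
  have sub: "E \<subseteq> {-R..R}" using E by force
  obtain U0 where U0: "open U0" "E \<subseteq> U0" "emeasure lborel (U0 - E) < d"
    using outer_regular_lborel[OF E(1) \<open>0 < d\<close>] .
  define U where "U = U0 \<inter> {-R<..<R}"
  have U: "open U" "E \<subseteq> U" "U \<subseteq> {-R..R}" using U0 E by (auto simp: U_def)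
  have "emeasure lborel (U - E) \<le> emeasure lborel (U0 - E)"
    using U0 E by (intro emeasure_mono) (auto simp: U_def)
  then have U3: "emeasure lborel (U - E) \<le> d" using U0(3) by auto
  define I where "I = {(u,v). u < v \<and> {u<..<v} \<subseteq> U \<and> emeasure M {u<..<v} \<le> ennreal c * emeasure N {u<..<v}}"
  have ball: "ball ((fst i + snd i)/2) ((snd i - fst i)/2) = {fst i<..<snd i}" for i :: "real \<times> real"
    by (auto simp: ball_def dist_real_def field_simps abs_if split: if_splits)
  have cov: "\<exists>i. i \<in> I \<and> x \<in> ball ((fst i + snd i)/2) ((snd i - fst i)/2) \<and> (snd i - fst i)/2 < d'"
    if x: "x \<in> E" "0 < d'" for x d'
  proof -
    from x U obtain r where r: "r > 0" "ball x r \<subseteq> U" by (meson openE subsetD)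
    obtain u v where uv: "u < x" "x < v" "v - u < min r d'" "emeasure M {u<..<v} \<le> ennreal c * emeasure N {u<..<v}"
      using small[OF x(1), of "min r d'"] r x by auto
    have "{u<..<v} \<subseteq> ball x r" using uv by (auto simp: ball_def dist_real_def)
    then have "(u,v) \<in> I" using uv r by (auto simp: I_def)
    then show ?thesis unfolding ball using uv by (intro exI[of _ "(u,v)"]) auto
  qed
  obtain C where C: "countable C" "C \<subseteq> I"
    "pairwise (\<lambda>i j. disjnt {fst i<..<snd i} {fst j<..<snd j}) C"
    "negligible (E - (\<Union>i\<in>C. {fst i<..<snd i}))"
    by (rule Vitali_covering_theorem_balls[of E I "\<lambda>i. (fst i + snd i)/2" "\<lambda>i. (snd i - fst i)/2", OF cov])
      (auto simp only: ball)
  define V where "V = (\<Union>i\<in>C. {fst i<..<snd i})"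
  have V: "open V" "V \<subseteq> U" using C(2) by (force simp: V_def I_def)+
  have bor: "E - V \<in> sets borel" "V \<in> sets borel" "E \<in> sets borel" "U - E \<in> sets borel" "U \<in> sets borel" using E V U by auto
  have "E - V \<in> null_sets lborel"
    using C(4) bor unfolding V_def[symmetric] negligible_iff_null_sets
    by (simp add: null_sets_completion_iff)
  then have l0: "emeasure lborel (E - V) = 0" by auto
  have "emeasure M (E - V) \<le> ennreal K * emeasure lborel (E - V)"
    using sub E by (intro emeasure_Icc_le_imp_emeasure_le_lborel[OF sM K M bor(1), where R=R]) auto
  then have M0: "emeasure M (E - V) = 0" using l0 by simp
  have "emeasure M E \<le> emeasure M ((E - V) \<union> V)"
    using bor sM by (intro emeasure_mono) auto
  also have "\<dots> \<le> emeasure M (E - V) + emeasure M V"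
    using bor sM by (intro emeasure_subadditive) auto
  also have "\<dots> = emeasure M V" by (simp add: M0)
  also have "\<dots> = (\<integral>\<^sup>+i. emeasure M {fst i<..<snd i} \<partial>count_space C)"
    unfolding V_def using C(1,3) sM by (intro emeasure_UN_countable)
      (auto simp: disjoint_family_on_def pairwise_def disjnt_def)
  also have "\<dots> \<le> (\<integral>\<^sup>+i. ennreal c * emeasure N {fst i<..<snd i} \<partial>count_space C)"
    using C(2) by (intro nn_integral_mono) (auto simp: I_def)
  also have "\<dots> = ennreal c * (\<integral>\<^sup>+i. emeasure N {fst i<..<snd i} \<partial>count_space C)"
    by (rule nn_integral_cmult) auto
  also have "(\<integral>\<^sup>+i. emeasure N {fst i<..<snd i} \<partial>count_space C) = emeasure N V"
    unfolding V_def using C(1,3) sN by (intro emeasure_UN_countable[symmetric])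
      (auto simp: disjoint_family_on_def pairwise_def disjnt_def)
  also have "emeasure N V \<le> emeasure N (E \<union> (U - E))"
    using V bor sN by (intro emeasure_mono) auto
  also have "\<dots> \<le> emeasure N E + emeasure N (U - E)"
    using bor sN by (intro emeasure_subadditive) auto
  also have "emeasure N (U - E) \<le> ennreal K * emeasure lborel (U - E)"
    using U E by (intro emeasure_Icc_le_imp_emeasure_le_lborel[OF sN K N bor(4), where R=R]) auto
  also have "\<dots> \<le> ennreal K * ennreal d"
    using U3 by (intro mult_left_mono) auto
  also have "ennreal c * (emeasure N E + ennreal K * ennreal d) = ennreal c * emeasure N E + ennreal (c * K * d)"
    using K c \<open>0 < d\<close> by (simp add: distrib_left ennreal_mult mult.assoc)
  also have "\<dots> \<le> ennreal c * emeasure N E + ennreal e"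
  proof -
    have "c * K * d \<le> e" using \<open>0 < c * K + 1\<close> \<open>0 < e\<close> by (simp add: d_def field_simps)
    then show ?thesis by (intro add_left_mono ennreal_leI)
  qed
  finally show "emeasure M E \<le> ennreal c * emeasure N E + ennreal e"
    by (simp add: mult_left_mono add_mono)
qed

lemma bilipschitz_real_ae_differentiable:
  fixes F :: "real \<Rightarrow> real"
  assumes lo: "\<And>u v. u \<le> v \<Longrightarrow> v - u \<le> F v - F u"
    and up: "\<And>u v. u \<le> v \<Longrightarrow> F v - F u \<le> K * (v - u)"
  shows "AE x in lborel. F differentiable (at x)"
proof -
  have K: "0 \<le> K" using lo[of 0 1] up[of 0 1] by simp
  have mono: "x \<le> y \<Longrightarrow> F x \<le> F y" for x y using lo[of x y] by simp
  have lip: "\<bar>F x - F y\<bar> \<le> K * \<bar>x - y\<bar>" for x y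
    using up[of x y] up[of y x] mono[of x y] mono[of y x] by (cases "x \<le> y") auto
  have "K-lipschitz_on UNIV F" using lip K by (auto simp: lipschitz_on_def dist_real_def)
  then have cont: "continuous_on UNIV F" by (rule lipschitz_on_continuous_on)
  define M where "M = interval_measure F"
  have sM: "sets M = sets borel" by (simp add: M_def)
  have MI: "emeasure M {u..v} = ennreal (F v - F u)" if "u \<le> v" for u v
    unfolding M_def by (rule emeasure_interval_measure_Icc[OF that mono cont])
  have cr: "continuous (at_right a) F" for a 
    using cont continuous_on_eq_continuous_at continuous_at_imp_continuous_within by blast
  have MO: "emeasure M {u<..<v} = ennreal (F v - F u)" if "u < v" for u v
  proof -
    have "emeasure M {u<..<v} + emeasure M {v..v} = emeasure M ({u<..<v} \<union> {v..v})"
      using sM by (intro plus_emeasure) auto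
    also have "{u<..<v} \<union> {v..v} = {u<..v}" using that by auto
    also have "emeasure M {u<..v} = ennreal (F v - F u)"
      unfolding M_def using that by (intro emeasure_interval_measure_Ioc mono cr) auto
    finally show ?thesis using MI[of v v] by simp
  qed
  have Mb: "emeasure M {u..v} \<le> ennreal (max K 1) * ennreal (v - u)" if "u \<le> v" for u v
  proof -
    have "K * (v-u) \<le> max K 1 * (v-u)" using that by (intro mult_right_mono) auto
    then have "F v - F u \<le> max K 1 * (v - u)" using up[OF that] by simp
    then show ?thesis using that by (simp add: MI ennreal_leI flip: ennreal_mult)
  qed
  have Lb: "emeasure lborel {u..v} \<le> ennreal (max K 1) * ennreal (v - u)" if "u \<le> v" for u v
  proof -
    have "1 * (v-u) \<le> max K 1 * (v-u)" using that by (intro mult_right_mono) auto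
    then show ?thesis using that by (simp add: ennreal_leI flip: ennreal_mult)
  qed
  define A where "A P = (\<Inter>k::nat. \<Union>(u,v)\<in>{(u,v). v - u < 1 / Suc k \<and> P u v}. {u<..<v})" 
    for P :: "real \<Rightarrow> real \<Rightarrow> bool"
  have Ab: "A P \<in> sets borel" for P
    unfolding A_def by (intro sets.countable_INT'' borel_open open_UN) auto
  have AD: "\<exists>u v. u < x \<and> x < v \<and> v - u < d \<and> P u v" if "x \<in> A P" "0 < d" for x P d
  proof -
    obtain k where "1 / Suc k < d" using nat_approx_posE \<open>0 < d\<close> by blast
    moreover have "x \<in> (\<Union>(u,v)\<in>{(u,v). v - u < 1 / Suc k \<and> P u v}. {u<..<v})"
      using that(1) unfolding A_def by blast
    ultimately show ?thesis by force
  qed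
  have AI: "x \<in> A P" if "\<And>d. 0 < d \<Longrightarrow> \<exists>u v. u < x \<and> x < v \<and> v - u < d \<and> P u v" for x P
    unfolding A_def
  proof
    fix k
    show "x \<in> (\<Union>(u,v)\<in>{(u,v). v - u < 1 / Suc k \<and> P u v}. {u<..<v})"
      using that[of "1 / Suc k"] by force
  qed
  define E where "E p q = A (\<lambda>u v. F v - F u < p * (v - u)) \<inter> A (\<lambda>u v. F v - F u > q * (v - u))" for p q
  have Eb: "E p q \<in> sets borel" for p q unfolding E_def using Ab by auto
  have ED1: "\<exists>u v. u < x \<and> x < v \<and> v - u < d \<and> F v - F u < p * (v - u)" if "x \<in> E p q" "0 < d" for x p q d
    using that AD[where P="\<lambda>u v. F v - F u < p * (v - u)"] unfolding E_def by blast
  have ED2: "\<exists>u v. u < x \<and> x < v \<and> v - u < d \<and> F v - F u > q * (v - u)" if "x \<in> E p q" "0 < d" for x p q d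
    using that AD[where P="\<lambda>u v. F v - F u > q * (v - u)"] unfolding E_def by blast
  have null: "E p q \<inter> {-real n<..<real n} \<in> null_sets lborel" if pq: "p < q" for p q n
  proof (cases "E p q \<inter> {-real n<..<real n} = {}")
    case False
    define B where "B = E p q \<inter> {-real n<..<real n}"
    have Bb: "B \<in> sets borel" unfolding B_def using Eb by auto
    from False obtain x where x: "x \<in> E p q" "0 < real n" by force
    then obtain u v where "u < v" "F v - F u < p * (v - u)"
      using ED1[OF x(1), of 1] less_trans zero_less_one by metis
    then have "0 < p * (v - u)" using lo[of u v] by simp
    then have p: "0 < p" using \<open>u < v\<close> by (simp add: zero_less_mult_iff)
    then have q: "0 < q" using pq by simp
    have *: "emeasure M B \<le> ennreal p * emeasure lborel B"
    proof (rule vitali_compare[where R="real n", OF sM _ _ Mb Lb Bb])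
      fix x d :: real assume "x \<in> B" "0 < d"
      then obtain u v where uv: "u < x" "x < v" "v - u < d" "F v - F u < p * (v - u)"
        using ED1[of x p q d] unfolding B_def by auto
      then show "\<exists>u v. u < x \<and> x < v \<and> v - u < d \<and> emeasure M {u<..<v} \<le> ennreal p * emeasure lborel {u<..<v}"
        using p by (intro exI[of _ u] exI[of _ v]) (auto simp: MO ennreal_leI simp flip: ennreal_mult)
    qed (use x p in \<open>auto simp: B_def\<close>)
    have "emeasure lborel B \<le> ennreal (1/q) * emeasure M B"
    proof (rule vitali_compare[where R="real n", OF _ sM _ Lb Mb Bb])
      fix x d :: real assume "x \<in> B" "0 < d"
      then obtain u v where uv: "u < x" "x < v" "v - u < d" "F v - F u > q * (v - u)"
        using ED2[of x p q d] unfolding B_def by auto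
      then have "v - u \<le> (1/q) * (F v - F u)" using q by (simp add: field_simps)
      then show "\<exists>u v. u < x \<and> x < v \<and> v - u < d \<and> emeasure lborel {u<..<v} \<le> ennreal (1/q) * emeasure M {u<..<v}"
        using q uv mono[of u v] by (intro exI[of _ u] exI[of _ v]) (auto simp: MO ennreal_leI simp flip: ennreal_mult)
    qed (use x q in \<open>auto simp: B_def\<close>)
    also have "\<dots> \<le> ennreal (1/q) * (ennreal p * emeasure lborel B)"
      using * by (intro mult_left_mono) auto
    finally have 1: "emeasure lborel B \<le> ennreal (p/q) * emeasure lborel B"
      using p q by (simp add: mult.assoc[symmetric] ennreal_mult[symmetric])
    have "emeasure lborel B \<le> emeasure lborel {-real n..real n}"
      using Bb by (intro emeasure_mono) (auto simp: B_def)
    then have "emeasure lborel B < top" by (simp add: le_less_trans)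
    then obtain r where r: "0 \<le> r" "emeasure lborel B = ennreal r" by (cases "emeasure lborel B") auto
    with 1 p q have "r \<le> (p/q) * r" by (simp flip: ennreal_mult add: ennreal_le_iff)
    with pq p q r(1) have "r = 0"
      by (cases "r = 0") (auto simp: field_simps)
    then show ?thesis using r Bb unfolding B_def[symmetric] by auto
  qed (simp)
  have "(\<Union>n. E p q \<inter> {-real n<..<real n}) = E p q" for p q
  proof -
    have "\<exists>n. x < real n \<and> - x < real n" for x
      using reals_Archimedean2[of "\<bar>x\<bar>"] by (auto simp: abs_less_iff)
    then show ?thesis by (auto, metis minus_less_iff)
  qed
  then have null': "E p q \<in> null_sets lborel" if "p < q" for p q
    using null_sets_UN[of "\<lambda>n. E p q \<inter> {-real n<..<real n}" lborel] null[OF that] by simp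
  define Z where "Z = (\<Union>(p,q)\<in>{(p,q)\<in>\<rat>\<times>\<rat>. p < q}. E p q)"
  have "countable {(p,q)\<in>\<rat>\<times>\<rat>. p < (q::real)}"
    by (rule countable_subset[of _ "\<rat>\<times>\<rat>"]) (auto intro: countable_rat)
  then have Z: "Z \<in> null_sets lborel"
    unfolding Z_def by (rule null_sets_UN') (auto intro: null')
  have "F differentiable (at x)" if x: "x \<notin> Z" for x
  proof -
    define Q where "Q h = (F (x + h) - F x) / h" for h
    have Q0: "0 \<le> Q h" "Q h \<le> K" if "h \<noteq> 0" for h
    proof -
      consider "h > 0" | "h < 0" using \<open>h \<noteq> 0\<close> by linarith
      then have "0 \<le> Q h \<and> Q h \<le> K"
      proof cases
        case 1 then show ?thesis using up[of x "x+h"] mono[of x "x+h"] by (simp add: Q_def field_simps)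
      next
        case 2 then show ?thesis using up[of "x+h" x] mono[of "x+h" x]
          by (simp add: Q_def divide_le_eq zero_le_divide_iff)
      qed
      then show "0 \<le> Q h" "Q h \<le> K" by auto
    qed
    have ev: "eventually (\<lambda>h. 0 \<le> Q h \<and> Q h \<le> K) (at 0)"
      using Q0 by (auto simp: eventually_at_filter)
    define l where "l = Liminf (at 0) (\<lambda>h. ereal (Q h))"
    define m where "m = Limsup (at 0) (\<lambda>h. ereal (Q h))"
    have "l \<le> m" unfolding l_def m_def by (rule Liminf_le_Limsup) simp
    have l0: "0 \<le> l" unfolding l_def using ev by (intro Liminf_bounded) (auto elim: eventually_mono)
    have mK: "m \<le> K" unfolding m_def using ev by (intro Limsup_bounded) (auto elim: eventually_mono)
    have perturb: "x \<in> A P" if P: "\<And>d. d > 0 \<Longrightarrow> \<exists>h. h \<noteq> 0 \<and> \<bar>h\<bar> < d \<and> P (min x (x+h)) (max x (x+h))"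
      and op: "open {(u,v). P u v}" for P
    proof (rule AI)
      fix d :: real assume "0 < d"
      then obtain h where h: "h \<noteq> 0" "\<bar>h\<bar> < d/2" "P (min x (x+h)) (max x (x+h))" using P[of "d/2"] by auto
      have *: "((\<lambda>e. (min x (x+h) - e, max x (x+h) + e)) \<longlongrightarrow> (min x (x+h) - 0, max x (x+h) + 0)) (at_right 0)"
        by (intro tendsto_intros)
      have "eventually (\<lambda>e. (min x (x+h) - e, max x (x+h) + e) \<in> {(u,v). P u v}) (at_right 0)"
        by (rule topological_tendstoD[OF * op]) (use h in auto)
      moreover have "eventually (\<lambda>e::real. 0 < e \<and> e < d/4) (at_right 0)"
        using \<open>0 < d\<close> by (intro eventually_conj eventually_at_right_less eventually_at_right_real[of 0 "d/4", THEN eventually_mono]) auto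
      ultimately have "eventually (\<lambda>e. (0 < e \<and> e < d/4) \<and> P (min x (x+h) - e) (max x (x+h) + e)) (at_right 0)"
        by eventually_elim auto
      then obtain e where "0 < e" "e < d/4" "P (min x (x+h) - e) (max x (x+h) + e)"
        using eventually_happens[of _ "at_right (0::real)"] by auto
      then show "\<exists>u v. u < x \<and> x < v \<and> v - u < d \<and> P u v"
        using h by (intro exI[of _ "min x (x+h) - e"] exI[of _ "max x (x+h) + e"]) (auto simp: min_def max_def)
    qed
    have Qm: "F (max x (x+h)) - F (min x (x+h)) = Q h * (max x (x+h) - min x (x+h))" if "h \<noteq> 0" for h
      using that by (auto simp: Q_def min_def max_def)
    have pos: "0 < max x (x+h) - min x (x+h)" if "h \<noteq> 0" for h using that by (auto simp: min_def max_def)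
    have cF: "continuous_on UNIV (\<lambda>z::real\<times>real. F (fst z))" "continuous_on UNIV (\<lambda>z::real\<times>real. F (snd z))"
      by (rule continuous_on_compose2[OF cont]; auto intro: continuous_intros)+
    have "l = m"
    proof (rule ccontr)
      assume "l \<noteq> m"
      with \<open>l \<le> m\<close> have "l < m" by simp
      then obtain r :: real where "l < r" "r < m" using ereal_dense2 by blast
      have "\<exists>s t. l < ereal s \<and> ereal t < m \<and> s < r \<and> r < t"
        using \<open>l < r\<close> \<open>r < m\<close> ereal_dense2[of l r] ereal_dense2[of r m] by auto
      then obtain s t where st: "l < ereal s" "ereal t < m" "s < r" "r < t" by blast
      obtain p where p: "p \<in> \<rat>" "s < p" "p < r" using Rats_dense_in_real[OF st(3)] by auto
      obtain q where q: "q \<in> \<rat>" "r < q" "q < t" using Rats_dense_in_real[OF st(4)] by auto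
      have lp: "l < ereal p" using st(1) p(2) by (meson ereal_less_eq(3) less_imp_le order_less_le_trans)
      have qm: "ereal q < m" using st(2) q(3) by (meson ereal_less_eq(3) less_imp_le order_le_less_trans)
      have fp: "frequently (\<lambda>h. Q h < p) (at 0)"
      proof (rule ccontr)
        assume "\<not> ?thesis"
        then have "eventually (\<lambda>h. ereal p \<le> ereal (Q h)) (at 0)" by (simp add: not_frequently not_less)
        then have "ereal p \<le> l" unfolding l_def by (rule Liminf_bounded)
        with lp show False by simp
      qed
      have fq: "frequently (\<lambda>h. q < Q h) (at 0)"
      proof (rule ccontr)
        assume "\<not> ?thesis"
        then have "eventually (\<lambda>h. ereal (Q h) \<le> ereal q) (at 0)" by (simp add: not_frequently not_less)
        then have "m \<le> ereal q" unfolding m_def by (rule Limsup_bounded)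
        with qm show False by simp
      qed
      have "x \<in> A (\<lambda>u v. F v - F u < p * (v - u))"
      proof (rule perturb)
        fix d :: real assume "d > 0"
        then obtain h where "h \<noteq> 0" "\<bar>h\<bar> < d" "Q h < p"
          using fp by (auto simp: frequently_at dist_real_def)
        then show "\<exists>h. h \<noteq> 0 \<and> \<bar>h\<bar> < d \<and> F (max x (x+h)) - F (min x (x+h)) < p * (max x (x+h) - min x (x+h))"
          using Qm pos by (intro exI[of _ h]) (auto intro!: mult_strict_right_mono)
      next
        show "open {(u, v). F v - F u < p * (v - u)}"
          unfolding case_prod_beta by (intro open_Collect_less continuous_intros cF)
      qed
      moreover have "x \<in> A (\<lambda>u v. F v - F u > q * (v - u))"
      proof (rule perturb)
        fix d :: real assume "d > 0"
        then obtain h where "h \<noteq> 0" "\<bar>h\<bar> < d" "q < Q h"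
          using fq by (auto simp: frequently_at dist_real_def)
        then show "\<exists>h. h \<noteq> 0 \<and> \<bar>h\<bar> < d \<and> F (max x (x+h)) - F (min x (x+h)) > q * (max x (x+h) - min x (x+h))"
          using Qm pos by (intro exI[of _ h]) (auto intro!: mult_strict_right_mono)
      next
        show "open {(u, v). F v - F u > q * (v - u)}"
          unfolding case_prod_beta by (intro open_Collect_less continuous_intros cF)
      qed
      ultimately have "x \<in> E p q" by (simp add: E_def)
      then have "x \<in> Z" unfolding Z_def using p q by force
      with x show False by simp
    qed
    have "l \<noteq> \<infinity>" "l \<noteq> -\<infinity>" using l0 mK \<open>l = m\<close> by auto
    then obtain D where D: "l = ereal D" by (cases l) auto
    have "((\<lambda>h. ereal (Q h)) \<longlongrightarrow> l) (at 0)"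
      by (subst tendsto_iff_Liminf_eq_Limsup) (use \<open>l = m\<close> in \<open>auto simp: l_def m_def\<close>)
    then have "(Q \<longlongrightarrow> D) (at 0)" by (simp add: D)
    then have "(F has_field_derivative D) (at x)" unfolding DERIV_def Q_def by simp
    then show ?thesis by (auto simp: differentiable_def has_field_derivative_def)
  qed
  then show ?thesis using Z by (intro AE_I'[of Z]) auto
qed

lemma lipschitz_ae_differentiable:
  fixes c :: "real \<Rightarrow> 'b::euclidean_space"
  assumes "L-lipschitz_on UNIV c"
  shows "AE x in lborel. c differentiable (at x)"
proof -
  have "AE x in lborel. (\<lambda>x. c x \<bullet> b) differentiable (at x)" if b: "b \<in> Basis" for b
  proof -
    define F where "F x = c x \<bullet> b + (L + 1) * x" for x
    have L: "\<bar>c x \<bullet> b - c y \<bullet> b\<bar> \<le> L * \<bar>x - y\<bar>" for x y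
    proof -
      have "\<bar>c x \<bullet> b - c y \<bullet> b\<bar> = \<bar>(c x - c y) \<bullet> b\<bar>" by (simp add: inner_diff_left)
      also have "\<dots> \<le> norm (c x - c y)" by (rule Basis_le_norm[OF b])
      also have "\<dots> \<le> L * \<bar>x - y\<bar>" using lipschitz_onD[OF assms, of x y] by (simp add: dist_norm)
      finally show ?thesis .
    qed
    have "AE x in lborel. F differentiable (at x)"
    proof (rule bilipschitz_real_ae_differentiable[where K="2 * L + 1"])
      fix u v :: real assume "u \<le> v"
      then have "\<bar>c v \<bullet> b - c u \<bullet> b\<bar> \<le> L * (v - u)" using L[of v u] by simp
      moreover have "F v - F u = (c v \<bullet> b - c u \<bullet> b) + (L * (v - u) + (v - u))"
        "(2 * L + 1) * (v - u) = L * (v - u) + (L * (v - u) + (v - u))"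
        by (simp_all add: F_def algebra_simps)
      ultimately show "v - u \<le> F v - F u" "F v - F u \<le> (2 * L + 1) * (v - u)" by linarith+
    qed
    then show ?thesis
    proof eventually_elim
      case (elim x)
      have "(\<lambda>x. F x - (L + 1) * x) differentiable (at x)" by (intro derivative_intros elim)
      then show ?case by (simp add: F_def)
    qed
  qed
  then have "AE x in lborel. \<forall>b\<in>Basis. (\<lambda>x. c x \<bullet> b) differentiable (at x)"
    by (subst AE_finite_all) auto
  then show ?thesis
    by eventually_elim (simp add: differentiable_componentwise_within[of c _ UNIV])
qed

subsection \<open>Function spaces on the circle\<close>

text \<open>Functions on \<open>S\<^sup>1 = \<real> / 2\<pi>\<int>\<close> are functions on \<^typ>\<open>real\<close>.  Elements of \<open>W\<^sup>1\<^sup>,\<^sup>\<infinity>\<close> are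
  \<open>2\<pi>\<close>-periodic; elements of \<open>L\<^sup>\<infinity>\<close> are only ever inspected through the measure \<open>d\<theta>\<close> on the
  fundamental domain, up to equality almost everywhere.\<close>

definition circle :: "real measure"
  where "circle = lebesgue_on {0..<2*pi}"

definition Linf :: "(real \<Rightarrow> 'b::euclidean_space) set"
  where "Linf = {f \<in> borel_measurable circle. \<exists>C. AE \<theta> in circle. norm (f \<theta>) \<le> C}"

definition Linf_norm :: "(real \<Rightarrow> 'b::euclidean_space) \<Rightarrow> real"
  where "Linf_norm f = real_of_ereal (esssup circle (\<lambda>\<theta>. ereal (norm (f \<theta>))))"

text \<open>The derivative of a Lipschitz function exists almost everywhere (see
  \<open>lipschitz_ae_differentiable\<close>); on the exceptional null set its value is arbitrary.\<close>

definition D\<theta> :: "(real \<Rightarrow> 'b::euclidean_space) \<Rightarrow> real \<Rightarrow> 'b"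
  where "D\<theta> c \<theta> = vector_derivative c (at \<theta>)"

definition W1inf :: "(real \<Rightarrow> real ^ 'd) set"
  where "W1inf = {c. (\<forall>\<theta>. c (\<theta> + 2*pi) = c \<theta>) \<and> (\<exists>L. L-lipschitz_on UNIV c)}"

definition W1inf_norm :: "(real \<Rightarrow> real ^ 'd) \<Rightarrow> real"
  where "W1inf_norm c = Linf_norm c + Linf_norm (D\<theta> c)"

lemma space_circle: "space circle = {0..<2*pi}"
  by (simp add: circle_def space_restrict_space)

lemma emeasure_circle: "emeasure circle (space circle) = ennreal (2*pi)"
  unfolding space_circle unfolding circle_def by (subst emeasure_restrict_space) auto

lemma AE_circleI: "AE \<theta> in lborel. P \<theta> \<Longrightarrow> AE \<theta> in circle. P \<theta>"
  unfolding circle_def by (subst AE_restrict_space_iff) (auto intro: AE_completion elim: AE_mp)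

lemma esssup_circle:
  assumes f: "f \<in> borel_measurable circle" and C: "AE \<theta> in circle. norm (f \<theta>) \<le> C"
  shows "\<exists>r. 0 \<le> r \<and> r \<le> C \<and> esssup circle (\<lambda>\<theta>. ereal (norm (f \<theta>))) = ereal r"
proof -
  let ?s = "esssup circle (\<lambda>\<theta>. ereal (norm (f \<theta>)))"
  have m: "(\<lambda>\<theta>. ereal (norm (f \<theta>))) \<in> borel_measurable circle" using f by measurable
  have up: "?s \<le> ereal C" using C by (intro esssup_I[OF m]) auto
  have "esssup circle (\<lambda>\<theta>. 0) \<le> ?s" by (intro esssup_mono) auto
  then have lo: "0 \<le> ?s" by (subst (asm) esssup_const) (auto simp: emeasure_circle)
  from up lo show ?thesis by (cases ?s) auto
qed

lemma Linf_norm_le: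
  "f \<in> borel_measurable circle \<Longrightarrow> AE \<theta> in circle. norm (f \<theta>) \<le> C \<Longrightarrow> Linf_norm f \<le> C"
  using esssup_circle[of f C] by (auto simp: Linf_norm_def)

lemma Linf_norm_nonneg: "f \<in> Linf \<Longrightarrow> 0 \<le> Linf_norm f"
  using esssup_circle[of f] by (force simp: Linf_norm_def Linf_def)

lemma AE_Linf_norm:
  assumes "f \<in> Linf"
  shows "AE \<theta> in circle. norm (f \<theta>) \<le> Linf_norm f"
proof -
  obtain r where r: "esssup circle (\<lambda>\<theta>. ereal (norm (f \<theta>))) = ereal r"
    using assms esssup_circle[of f] by (force simp: Linf_def)
  show ?thesis
    using esssup_AE[where M=circle and f="\<lambda>\<theta>. ereal (norm (f \<theta>))"] unfolding r Linf_norm_def by simp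
qed

lemma Linf_norm_add_le:
  assumes "f \<in> Linf" "g \<in> Linf" "h \<in> borel_measurable circle" "AE \<theta> in circle. h \<theta> = f \<theta> + g \<theta>"
  shows "Linf_norm h \<le> Linf_norm f + Linf_norm g"
proof (rule Linf_norm_le[OF assms(3)])
  show "AE \<theta> in circle. norm (h \<theta>) \<le> Linf_norm f + Linf_norm g"
    using AE_Linf_norm[OF assms(1)] AE_Linf_norm[OF assms(2)] assms(4)
    by eventually_elim (simp add: norm_triangle_mono)
qed

lemma Linf_norm_scaleR:
  assumes f: "f \<in> Linf" and g: "g \<in> Linf" and fg: "AE \<theta> in circle. g \<theta> = a *\<^sub>R f \<theta>"
  shows "Linf_norm g = \<bar>a\<bar> * Linf_norm f"
proof (rule antisym)
  have gm: "g \<in> borel_measurable circle" and fm: "f \<in> borel_measurable circle"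
    using f g by (auto simp: Linf_def)
  show "Linf_norm g \<le> \<bar>a\<bar> * Linf_norm f"
  proof (rule Linf_norm_le[OF gm])
    show "AE \<theta> in circle. norm (g \<theta>) \<le> \<bar>a\<bar> * Linf_norm f"
      using AE_Linf_norm[OF f] fg by eventually_elim (simp add: mult_left_mono)
  qed
  show "\<bar>a\<bar> * Linf_norm f \<le> Linf_norm g"
  proof (cases "a = 0")
    case False
    have "Linf_norm f \<le> Linf_norm g / \<bar>a\<bar>"
    proof (rule Linf_norm_le[OF fm])
      show "AE \<theta> in circle. norm (f \<theta>) \<le> Linf_norm g / \<bar>a\<bar>"
        using AE_Linf_norm[OF g] fg by eventually_elim (use False in \<open>simp add: field_simps\<close>)
    qed
    then show ?thesis using False by (simp add: field_simps)
  qed (use Linf_norm_nonneg[OF g] in auto)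
qed

lemma W1inf_continuous_on: "c \<in> W1inf \<Longrightarrow> continuous_on UNIV c"
  by (auto simp: W1inf_def intro: lipschitz_on_continuous_on)

lemma W1inf_differentiable_AE: "c \<in> W1inf \<Longrightarrow> AE \<theta> in circle. c differentiable (at \<theta>)"
  by (auto simp: W1inf_def intro: AE_circleI lipschitz_ae_differentiable)

lemma borel_measurable_circleI: "f \<in> borel_measurable lebesgue \<Longrightarrow> f \<in> borel_measurable circle"
  unfolding circle_def by (rule measurable_restrict_space1)

lemma W1inf_measurable: "c \<in> W1inf \<Longrightarrow> c \<in> borel_measurable circle"
  by (intro borel_measurable_circleI measurable_completion)
     (simp add: W1inf_continuous_on borel_measurable_continuous_onI measurable_lborel1)

lemma W1inf_fundamental_domain:
  assumes "c \<in> W1inf"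
  shows "\<exists>\<theta>'\<in>{0..2*pi}. c \<theta> = c \<theta>'"
proof -
  have per: "c (\<theta> + 2*pi * of_int k) = c \<theta>" for \<theta> k
  proof (induction k rule: int_induct[of _ 0])
    case (step1 i)
    then show ?case using assms by (simp add: W1inf_def ring_distribs add.assoc[symmetric])
  next
    case (step2 i)
    have "c (\<theta> + 2*pi * of_int (i - 1) + 2*pi) = c (\<theta> + 2*pi * of_int (i - 1))"
      using assms by (simp add: W1inf_def)
    moreover have "\<theta> + 2*pi * of_int (i - 1) + 2*pi = \<theta> + 2*pi * of_int i"
      by (simp add: ring_distribs)
    ultimately show ?case using step2 by (metis (no_types))
  qed simp
  define k where "k = \<lfloor>\<theta> / (2*pi)\<rfloor>"
  have "of_int k \<le> \<theta> / (2*pi)" "\<theta> / (2*pi) < of_int k + 1" by (auto simp: k_def)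
  then have "\<theta> + 2*pi * of_int (-k) \<in> {0..2*pi}" by (auto simp: field_simps)
  with per[of \<theta> "-k"] show ?thesis by metis
qed

lemma W1inf_bounded:
  assumes "c \<in> W1inf"
  shows "\<exists>C. \<forall>\<theta>. norm (c \<theta>) \<le> C"
proof -
  have "compact (c ` {0..2*pi})"
    using W1inf_continuous_on[OF assms, THEN continuous_on_subset] by (intro compact_continuous_image) auto
  then obtain C where "\<forall>y\<in>c ` {0..2*pi}. norm y \<le> C" using compact_imp_bounded bounded_iff by blast
  then show ?thesis using W1inf_fundamental_domain[OF assms] by (metis imageI)
qed

lemma W1inf_in_Linf: "c \<in> W1inf \<Longrightarrow> c \<in> Linf"
  using W1inf_bounded[of c] by (auto simp: Linf_def W1inf_measurable)

lemma vector_derivative_quotient: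
  assumes "(c has_vector_derivative v) (at \<theta>)"
  shows "((\<lambda>h. (1/h) *\<^sub>R (c (\<theta> + h) - c \<theta>)) \<longlongrightarrow> v) (at 0)"
proof -
  have "((\<lambda>h. norm (c (\<theta> + h) - c \<theta> - h *\<^sub>R v) / norm h) \<longlongrightarrow> 0) (at 0)"
    using assms by (simp add: has_vector_derivative_def has_derivative_at)
  moreover have "eventually (\<lambda>h. norm (c (\<theta> + h) - c \<theta> - h *\<^sub>R v) / norm h
      = norm ((1/h) *\<^sub>R (c (\<theta> + h) - c \<theta>) - v)) (at 0)"
  proof -
    have "norm (c (\<theta> + h) - c \<theta> - h *\<^sub>R v) / norm h = norm ((1/h) *\<^sub>R (c (\<theta> + h) - c \<theta>) - v)"
      if "h \<noteq> 0" for h :: real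
    proof -
      have "(1/h) *\<^sub>R (c (\<theta> + h) - c \<theta>) - v = (1/h) *\<^sub>R (c (\<theta> + h) - c \<theta> - h *\<^sub>R v)"
        using that by (simp add: scaleR_diff_right)
      then show ?thesis by simp
    qed
    then show ?thesis by (auto simp: eventually_at_filter)
  qed
  ultimately have "((\<lambda>h. norm ((1/h) *\<^sub>R (c (\<theta> + h) - c \<theta>) - v)) \<longlongrightarrow> 0) (at 0)"
    by (rule Lim_transform_eventually)
  then show ?thesis using LIM_zero_iff tendsto_norm_zero_iff by blast
qed

lemma D\<theta>_measurable:
  assumes c: "c \<in> W1inf"
  shows "D\<theta> c \<in> borel_measurable circle"
proof -
  define D where "D = {\<theta>. c differentiable (at \<theta>)}"
  have "AE \<theta> in lebesgue. \<theta> \<in> D"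
    using c lipschitz_ae_differentiable unfolding W1inf_def D_def by (auto intro: AE_completion)
  then obtain N where "{\<theta> \<in> space lebesgue. \<not> \<theta> \<in> D} \<subseteq> N" "emeasure lebesgue N = 0" "N \<in> sets lebesgue"
    by (rule AE_E)
  then have "- D \<in> null_sets lebesgue"
    by (intro null_sets_completion_subset[of "-D" N]) auto
  then have D: "D \<in> sets lebesgue"
    using sets.compl_sets[of "-D" lebesgue] by (auto simp: Compl_eq_Diff_UNIV[symmetric])
  have cm: "c \<in> borel_measurable borel" 
    by (intro borel_measurable_continuous_onI W1inf_continuous_on c)
  define q where "q n \<theta> = (if \<theta> \<in> D then real (Suc n) *\<^sub>R (c (\<theta> + 1 / real (Suc n)) - c \<theta>)
      else (SOME y. False))" for n \<theta>
  have "D\<theta> c \<in> borel_measurable lebesgue"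
  proof (rule borel_measurable_LIMSEQ_metric)
    fix n
    have "(\<lambda>\<theta>. real (Suc n) *\<^sub>R (c (\<theta> + 1 / real (Suc n)) - c \<theta>)) \<in> borel_measurable lebesgue"
      by (intro measurable_completion) (use cm in measurable)
    then show "q n \<in> borel_measurable lebesgue"
      unfolding q_def using D by (intro measurable_If_set) auto
  next
    fix \<theta>
    show "(\<lambda>n. q n \<theta>) \<longlonglongrightarrow> D\<theta> c \<theta>"
    proof (cases "\<theta> \<in> D")
      case True
      then have "(c has_vector_derivative D\<theta> c \<theta>) (at \<theta>)"
        by (auto simp: D_def D\<theta>_def vector_derivative_works)
      then have "((\<lambda>h. (1/h) *\<^sub>R (c (\<theta> + h) - c \<theta>)) \<longlongrightarrow> D\<theta> c \<theta>) (at 0)"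
        by (rule vector_derivative_quotient)
      moreover have "filterlim (\<lambda>n. 1 / real (Suc n)) (at 0) sequentially"
        unfolding filterlim_at using LIMSEQ_inverse_real_of_nat by (auto simp: inverse_eq_divide)
      ultimately have "(\<lambda>n. (1/(1 / real (Suc n))) *\<^sub>R (c (\<theta> + 1 / real (Suc n)) - c \<theta>)) \<longlonglongrightarrow> D\<theta> c \<theta>"
        by (rule filterlim_compose)
      then show ?thesis using True by (simp add: q_def)
    next
      case False
      then have "\<not> (c has_vector_derivative y) (at \<theta>)" for y
        by (auto simp: D_def differentiableI_vector)
      then show ?thesis using False by (simp add: q_def D\<theta>_def vector_derivative_def)
    qed
  qed
  then show ?thesis by (rule borel_measurable_circleI)
qed

lemma D\<theta>_in_Linf:
  assumes c: "c \<in> W1inf"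
  shows "D\<theta> c \<in> Linf"
proof -
  obtain L where L: "L-lipschitz_on UNIV c" using c by (auto simp: W1inf_def)
  have "AE \<theta> in circle. norm (D\<theta> c \<theta>) \<le> L"
    using W1inf_differentiable_AE[OF c]
  proof eventually_elim
    case (elim \<theta>)
    then have "(c has_vector_derivative D\<theta> c \<theta>) (at \<theta>)"
      by (auto simp: D\<theta>_def vector_derivative_works)
    then have "((\<lambda>h. norm ((1/h) *\<^sub>R (c (\<theta> + h) - c \<theta>))) \<longlongrightarrow> norm (D\<theta> c \<theta>)) (at 0)"
      by (intro tendsto_norm vector_derivative_quotient)
    then show ?case
    proof (rule tendsto_upperbound)
      have "norm ((1/h) *\<^sub>R (c (\<theta> + h) - c \<theta>)) \<le> L" if "h \<noteq> 0" for h
      proof -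
        have "norm ((1/h) *\<^sub>R (c (\<theta> + h) - c \<theta>)) = norm (c (\<theta> + h) - c \<theta>) / \<bar>h\<bar>"
          unfolding norm_scaleR by simp
        then show ?thesis
          using lipschitz_onD[OF L, of "\<theta> + h" \<theta>] that by (simp add: dist_norm divide_le_eq)
      qed
      then show "eventually (\<lambda>h. norm ((1/h) *\<^sub>R (c (\<theta> + h) - c \<theta>)) \<le> L) (at 0)"
        by (auto simp: eventually_at_filter)
    qed simp
  qed
  then show ?thesis using D\<theta>_measurable[OF c] by (auto simp: Linf_def)
qed

lemma W1inf_add: "b \<in> W1inf \<Longrightarrow> c \<in> W1inf \<Longrightarrow> (\<lambda>\<theta>. b \<theta> + c \<theta>) \<in> W1inf"
  by (auto simp: W1inf_def intro: lipschitz_on_add)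

lemma W1inf_scaleR: "c \<in> W1inf \<Longrightarrow> (\<lambda>\<theta>. a *\<^sub>R c \<theta>) \<in> W1inf"
  by (auto simp: W1inf_def intro: lipschitz_on_cmult)

lemma D\<theta>_add_AE:
  assumes "b \<in> W1inf" "c \<in> W1inf"
  shows "AE \<theta> in circle. D\<theta> (\<lambda>\<theta>. b \<theta> + c \<theta>) \<theta> = D\<theta> b \<theta> + D\<theta> c \<theta>"
  using W1inf_differentiable_AE[OF assms(1)] W1inf_differentiable_AE[OF assms(2)]
  by eventually_elim (simp add: D\<theta>_def)

lemma D\<theta>_scaleR_AE:
  assumes "c \<in> W1inf"
  shows "AE \<theta> in circle. D\<theta> (\<lambda>\<theta>. a *\<^sub>R c \<theta>) \<theta> = a *\<^sub>R D\<theta> c \<theta>"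
  using W1inf_differentiable_AE[OF assms] by eventually_elim (simp add: D\<theta>_def)

lemma W1inf_integrable: 
  assumes "c \<in> W1inf" shows "integrable circle c"
proof -
  interpret finite_measure circle by standard (simp add: emeasure_circle)
  show ?thesis using W1inf_in_Linf[OF assms] by (auto simp: Linf_def intro: integrable_const_bound)
qed

lemma W1inf_zero_AE:
  assumes c: "c \<in> W1inf" and 0: "AE \<theta> in circle. c \<theta> = 0"
  shows "c \<theta> = 0"
proof -
  let ?S = "{0<..<2*pi} \<inter> {\<theta>. c \<theta> \<noteq> 0}"
  have "open {\<theta>. c \<theta> \<noteq> 0}"
    by (intro open_Collect_neq W1inf_continuous_on[OF c] continuous_intros)
  then have op: "open ?S" by auto
  have "AE \<theta> in lebesgue. \<theta> \<in> {0..<2*pi} \<longrightarrow> c \<theta> = 0"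
    using 0 unfolding circle_def by (subst (asm) AE_restrict_space_iff) auto
  then have "AE \<theta> in lebesgue. \<theta> \<notin> ?S" by eventually_elim auto
  then have "?S \<in> null_sets lebesgue"
    using op by (subst AE_iff_null_sets) auto
  then have "?S = {}" using op open_not_negligible negligible_iff_null_sets by blast
  then have S: "c \<theta> = 0" if "\<theta> \<in> {0<..<2*pi}" for \<theta> using that by blast
  have cl: "closure {0<..<2*pi} = {0..2*pi}" by simp
  have "continuous_on (closure {0<..<2*pi}) c"
    by (rule continuous_on_subset[OF W1inf_continuous_on[OF c]]) simp
  from continuous_constant_on_closure[OF this S]
  have "c \<theta> = 0" if "\<theta> \<in> {0..2*pi}" for \<theta> using that unfolding cl by blast
  then show ?thesis using W1inf_fundamental_domain[OF c, of \<theta>] by auto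
qed

text \<open>The normed space \<open>W\<^sub>0\<^sup>1\<^sup>,\<^sup>\<infinity>\<close>; \<open>fn\<close> is the inclusion into \<open>W1inf\<close>.\<close>

typedef ('d::finite) W10 = "{c :: real \<Rightarrow> real ^ 'd. c \<in> W1inf \<and> (\<integral>\<theta>. c \<theta> \<partial>circle) = 0}"
  morphisms fn Abs_W10
  by (rule exI[of _ "\<lambda>_. 0"]) (auto simp: W1inf_def intro: lipschitz_on_constant)

setup_lifting type_definition_W10

lemma fn_W1inf: "fn c \<in> W1inf"
  using fn[of c] by auto

instantiation W10 :: (finite) real_vector
begin

lift_definition zero_W10 :: "'a W10" is "\<lambda>_. 0"
  by (auto simp: W1inf_def intro: lipschitz_on_constant)

lift_definition plus_W10 :: "'a W10 \<Rightarrow> 'a W10 \<Rightarrow> 'a W10" is "\<lambda>b c \<theta>. b \<theta> + c \<theta>"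
  by (auto simp: W1inf_add W1inf_integrable)

lift_definition scaleR_W10 :: "real \<Rightarrow> 'a W10 \<Rightarrow> 'a W10" is "\<lambda>a c \<theta>. a *\<^sub>R c \<theta>"
  by (auto simp: W1inf_scaleR)

lift_definition uminus_W10 :: "'a W10 \<Rightarrow> 'a W10" is "\<lambda>c \<theta>. - c \<theta>"
  using W1inf_scaleR[of _ "-1"] by auto

lift_definition minus_W10 :: "'a W10 \<Rightarrow> 'a W10 \<Rightarrow> 'a W10" is "\<lambda>b c \<theta>. b \<theta> - c \<theta>"
  using W1inf_scaleR[of _ "-1"] W1inf_add[of _ "\<lambda>\<theta>. - _ \<theta>"] by (auto simp: W1inf_integrable)

instance
  by standard (transfer; simp add: algebra_simps)+

end

instantiation W10 :: (finite) real_normed_vector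
begin

definition norm_W10 :: "'a W10 \<Rightarrow> real"
  where "norm_W10 c = W1inf_norm (fn c)"

definition dist_W10 :: "'a W10 \<Rightarrow> 'a W10 \<Rightarrow> real"
  where "dist_W10 b c = norm (b - c)"

definition sgn_W10 :: "'a W10 \<Rightarrow> 'a W10"
  where "sgn_W10 c = c /\<^sub>R norm c"

definition uniformity_W10 :: "('a W10 \<times> 'a W10) filter"
  where "uniformity_W10 = (INF e\<in>{0 <..}. principal {(x, y). dist x y < e})"

definition open_W10 :: "'a W10 set \<Rightarrow> bool"
  where "open_W10 U \<longleftrightarrow> (\<forall>x\<in>U. eventually (\<lambda>(x', y). x' = x \<longrightarrow> y \<in> U) uniformity)"

instance
proof
  fix a :: real and x y :: "'a W10" and U :: "'a W10 set"
  show "dist x y = norm (x - y)" "sgn x = x /\<^sub>R norm x"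
    "uniformity = (INF e\<in>{0 <..}. principal {(x, y). dist x (y :: 'a W10) < e})"
    "open U \<longleftrightarrow> (\<forall>x\<in>U. eventually (\<lambda>(x', y). x' = x \<longrightarrow> y \<in> U) uniformity)"
    by (simp_all add: dist_W10_def sgn_W10_def uniformity_W10_def open_W10_def)
  show "norm (x + y) \<le> norm x + norm y"
    unfolding norm_W10_def W1inf_norm_def plus_W10.rep_eq
    using Linf_norm_add_le[of "fn x" "fn y" "\<lambda>\<theta>. fn x \<theta> + fn y \<theta>"]
      Linf_norm_add_le[of "D\<theta> (fn x)" "D\<theta> (fn y)" "D\<theta> (\<lambda>\<theta>. fn x \<theta> + fn y \<theta>)"]
    by (simp add: fn_W1inf W1inf_in_Linf D\<theta>_in_Linf D\<theta>_add_AE W1inf_add W1inf_measurable D\<theta>_measurable)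
  show scale: "norm (a *\<^sub>R x) = \<bar>a\<bar> * norm x" for a and x :: "'a W10"
    unfolding norm_W10_def W1inf_norm_def scaleR_W10.rep_eq distrib_left
    using fn_W1inf[of x]
    by (intro arg_cong2[where f="(+)"] Linf_norm_scaleR)
      (auto intro: W1inf_in_Linf D\<theta>_in_Linf D\<theta>_scaleR_AE W1inf_scaleR)
  show "norm x = 0 \<longleftrightarrow> x = 0"
  proof
    assume "x = 0"
    then show "norm x = 0" using scale[of 0 x] by simp
  next
    assume "norm x = 0"
    moreover have "0 \<le> Linf_norm (fn x)" "0 \<le> Linf_norm (D\<theta> (fn x))"
      by (intro Linf_norm_nonneg W1inf_in_Linf D\<theta>_in_Linf fn_W1inf)+
    ultimately have "Linf_norm (fn x) = 0" by (simp add: norm_W10_def W1inf_norm_def)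
    then have "AE \<theta> in circle. fn x \<theta> = 0"
      using AE_Linf_norm[OF W1inf_in_Linf[OF fn_W1inf[of x]]] by simp
    then have "fn x \<theta> = 0" for \<theta> by (rule W1inf_zero_AE[OF fn_W1inf])
    then show "x = 0" by (transfer; auto)
  qed
qed

end

definition essinf :: "'a measure \<Rightarrow> ('a \<Rightarrow> ereal) \<Rightarrow> ereal"
  where "essinf M f = - esssup M (\<lambda>x. - f x)"

definition immersions :: "('d::finite) W10 set"
  where "immersions = {c. essinf circle (\<lambda>\<theta>. ereal (norm (D\<theta> (fn c) \<theta>))) > 0}"


subsection \<open>The metric and its geodesics\<close>

definition ds :: "('d::finite) W10 \<Rightarrow> real measure"
  where "ds c = density circle (\<lambda>\<theta>. ennreal (norm (D\<theta> (fn c) \<theta>)))"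

definition Ds :: "('d::finite) W10 \<Rightarrow> 'd W10 \<Rightarrow> real \<Rightarrow> real ^ 'd"
  where "Ds c h \<theta> = inverse (norm (D\<theta> (fn c) \<theta>)) *\<^sub>R D\<theta> (fn h) \<theta>"

definition len :: "('d::finite) W10 \<Rightarrow> real"
  where "len c = (\<integral>\<theta>. 1 \<partial>ds c)"

definition riem_G :: "('d::finite) W10 \<Rightarrow> 'd W10 \<Rightarrow> 'd W10 \<Rightarrow> real"
  where "riem_G c h k = 1 / len c * (\<integral>\<theta>. Ds c h \<theta> \<bullet> Ds c k \<theta> \<partial>ds c)"

text \<open>\<open>W00 c\<close> is \<open>W\<^sub>0\<^sup>0\<^sup>,\<^sup>\<infinity>\<close>, and \<open>proj0 c\<close> is the \<open>L\<^sup>2(ds)\<close>-orthogonal projection onto it.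
  Orthogonality determines the projection only up to equality almost everywhere, hence the choice of
  a representative; \<open>Ds_inv\<close> does not depend on the representative of its argument.\<close>

definition W00 :: "('d::finite) W10 \<Rightarrow> (real \<Rightarrow> real ^ 'd) set"
  where "W00 c = {k \<in> Linf. (\<integral>\<theta>. k \<theta> \<partial>ds c) = 0}"

definition proj0 :: "('d::finite) W10 \<Rightarrow> (real \<Rightarrow> real ^ 'd) \<Rightarrow> real \<Rightarrow> real ^ 'd"
  where "proj0 c k = (SOME p. p \<in> W00 c \<and> (\<forall>q\<in>W00 c. (\<integral>\<theta>. (k \<theta> - p \<theta>) \<bullet> q \<theta> \<partial>ds c) = 0))"

definition Ds_inv :: "('d::finite) W10 \<Rightarrow> (real \<Rightarrow> real ^ 'd) \<Rightarrow> 'd W10"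
  where "Ds_inv c k = (THE h. AE \<theta> in circle. Ds c h \<theta> = k \<theta>)"

definition acceleration :: "('d::finite) W10 \<Rightarrow> 'd W10 \<Rightarrow> 'd W10"
  where "acceleration c v = riem_G c c v *\<^sub>R v - (1/2 * riem_G c v v) *\<^sub>R c
    + Ds_inv c (proj0 c (\<lambda>\<theta>. (Ds c c \<theta> \<bullet> Ds c v \<theta>) *\<^sub>R Ds c v \<theta>
                          - (1/2 * (norm (Ds c v \<theta>))\<^sup>2) *\<^sub>R Ds c c \<theta>))"

text \<open>A geodesic \<open>c\<close> with velocity \<open>v\<close> on a nondegenerate time interval \<open>J\<close>; at endpoints belonging
  to \<open>J\<close> the derivatives are one-sided.\<close>

definition geodesic :: "real set \<Rightarrow> (real \<Rightarrow> ('d::finite) W10) \<Rightarrow> (real \<Rightarrow> 'd W10) \<Rightarrow> bool"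
  where "geodesic J c v \<longleftrightarrow> is_interval J \<and> interior J \<noteq> {} \<and>
    (\<forall>t\<in>J. c t \<in> immersions \<and>
      (c has_vector_derivative v t) (at t within J) \<and>
      (v has_vector_derivative acceleration (c t) (v t)) (at t within J))"


subsection \<open>Submanifolds of open subsets of normed spaces\<close>

text \<open>Smoothness in the Frechet sense.  \<open>D x [h\<^sub>1, \<dots>, h\<^sub>k]\<close> is the value of the \<open>k\<close>-th derivative at \<open>x\<close> on
  \<open>(h\<^sub>1, \<dots>, h\<^sub>k)\<close>: for every \<open>k\<close>, the map \<open>h \<mapsto> D x (h # _)\<close> is the Frechet derivative at \<open>x\<close> of
  \<open>y \<mapsto> D y _\<close>, with respect to the operator norm on \<open>k\<close>-linear maps.\<close>

definition Cinf_on :: "'a::real_normed_vector set \<Rightarrow> ('a \<Rightarrow> 'b::real_normed_vector) \<Rightarrow> bool"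
  where "Cinf_on U f \<longleftrightarrow> (\<exists>D. \<forall>x\<in>U. D x [] = f x \<and>
    (\<forall>hs. linear (\<lambda>h. D x (h # hs))) \<and>
    (\<forall>k. \<exists>C. \<forall>h hs. length hs = k \<longrightarrow>
       norm (D x (h # hs)) \<le> C * norm h * prod_list (map norm hs)) \<and>
    (\<forall>k. \<forall>e>0. \<exists>\<delta>>0. \<forall>y\<in>U. norm (y - x) < \<delta> \<longrightarrow> (\<forall>hs. length hs = k \<longrightarrow>
       norm (D y hs - D x hs - D x ((y - x) # hs)) \<le> e * norm (y - x) * prod_list (map norm hs))))"

text \<open>\<open>M\<close> is an open subset of a normed space; around every point of \<open>N\<close> a smooth chart of \<open>M\<close>
  straightens \<open>N\<close> to a linear subspace \<open>span B\<close> of dimension \<open>m\<close> (which, being finite-dimensional, is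
  automatically closed and complemented).\<close>

definition submanifold :: "'a::real_normed_vector set \<Rightarrow> 'a set \<Rightarrow> nat \<Rightarrow> bool"
  where "submanifold M N m \<longleftrightarrow> N \<subseteq> M \<and>
    (\<forall>p\<in>N. \<exists>U (V :: 'a set) \<phi> \<psi> B. open U \<and> p \<in> U \<and> U \<subseteq> M \<and> open V \<and>
       homeomorphism U V \<phi> \<psi> \<and> Cinf_on U \<phi> \<and> Cinf_on V \<psi> \<and>
       finite B \<and> independent B \<and> card B = m \<and> \<phi> ` (U \<inter> N) = V \<inter> span B)"

definition tangent_space :: "'a::real_normed_vector set \<Rightarrow> 'a \<Rightarrow> 'a set"
  where "tangent_space N p = {v. \<exists>\<gamma>. \<gamma> 0 = p \<and> eventually (\<lambda>t. \<gamma> t \<in> N) (nhds 0) \<and>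
    (\<gamma> has_vector_derivative v) (at (0::real))}"

definition totally_geodesic :: "('d::finite) W10 set \<Rightarrow> bool"
  where "totally_geodesic N \<longleftrightarrow> (\<forall>J c v t\<^sub>0. geodesic J c v \<and> t\<^sub>0 \<in> J \<and>
    c t\<^sub>0 \<in> N \<and> v t\<^sub>0 \<in> tangent_space N (c t\<^sub>0) \<longrightarrow>
    (\<exists>e>0. \<forall>t\<in>J. \<bar>t - t\<^sub>0\<bar> < e \<longrightarrow> c t \<in> N))"


subsection \<open>Piecewise linear immersions\<close>

definition grid :: "nat \<Rightarrow> nat \<Rightarrow> real"
  where "grid n i = 2*pi * real i / real n"

definition PL :: "nat \<Rightarrow> (real \<Rightarrow> real ^ 'd) set"
  where "PL n = {c \<in> W1inf. \<forall>i<n. \<exists>a b. \<forall>\<theta>\<in>{grid n i..grid n (Suc i)}. c \<theta> = a + \<theta> *\<^sub>R b}"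

definition PL_immersions :: "nat \<Rightarrow> ('d::finite) W10 set"
  where "PL_immersions n = {c \<in> immersions. fn c \<in> PL n}"

end

theory Submission
  imports Defs
begin

text \<open>The submanifold claim is linear algebra: the piecewise linear functions with mean zero form a
  subspace of dimension \<open>(n - 1) d\<close>, and \<open>immersions\<close> is open, so the identity is a chart.

  For the geodesics, no existence theorem for the geodesic equation on the subspace is needed.
  Projection and integration in the equation only produce quantities independent of \<open>\<theta>\<close>, so after
  one \<open>\<theta>\<close>-derivative the equation reads \<open>q\<^sub>t\<^sub>t = F(q, q\<^sub>t)\<close> pointwise in \<open>\<theta>\<close>, where \<open>q = c\<^sub>\<theta>\<close> and \<open>F\<close>
  is locally Lipschitz with coefficients depending on \<open>t\<close> only. A Gronwall-type argument then shows
  that if \<open>q\<close> and \<open>q\<^sub>t\<close> are constant on a grid interval at one time, they stay so. To avoid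
  exceptional null sets that vary with \<open>t\<close>, the oscillation of \<open>q\<close> is measured by difference
  quotients of \<open>c\<close>, which are continuous linear functionals.\<close>

subsection \<open>Lipschitz functions and their derivatives\<close>

text \<open>The defect of the acceleration on one subinterval is controlled only by the defects of
  \<open>c\<close> and \<open>v\<close> on all subintervals of the same grid interval at once. So no
  single functional satisfies a closed differential inequality, and a supremum over the subintervals
  need not be differentiable in time. The Gronwall step therefore iterates a uniform bound: if
  \<open>B\<close> bounds every defect on a short time interval, the mean value inequality replaces
  \<open>B\<close> by \<open>B / 2\<close>, and repetition leaves only zero. Two translations
  support this: an almost everywhere bound on the oscillation of the \<theta>-derivative bounds all
  difference quotients by integration, and conversely by differentiation. The Lipschitz property of
  \<open>F\<close> needs the norm of the \<theta>-derivative bounded away from zero, uniformly in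
  time; this persists near the initial time because the norm of \<open>W10\<close> dominates the
  essential supremum of the derivative. The choice operators in \<open>proj0\<close> and
  \<open>Ds_inv\<close> have to be evaluated as well, which requires that differentiation is a
  bijection, modulo null sets, onto the bounded functions of mean zero.\<close>

text \<open>Serves as the uniqueness half of Lebesgue differentiation: \<open>Linf_primitive\<close>
  compares the derivative of a primitive with its integrand through integrals over half-lines.
  Half-lines generate the Borel sets and are stable under intersection, so the integral vanishes
  over every Borel set, and Lebesgue sets differ from these by null sets.\<close>

lemma AE_zero_if_integrals_atMost_zero:
  fixes f :: "real \<Rightarrow> 'b::euclidean_space"
  assumes f: "integrable lebesgue f"
    and 0: "\<And>x. set_lebesgue_integral lebesgue {..x} f = 0"
  shows "AE x in lebesgue. f x = 0"
proof (rule sigma_finite_measure.density_zero[OF _ f])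
  show "sigma_finite_measure (lebesgue :: real measure)"
  proof
    have "(\<Union>n. {- real n..real n}) = UNIV"
    proof -
      have "\<exists>n. \<bar>x\<bar> \<le> real n" for x by (rule real_arch_simple)
      then have "\<exists>n. x \<in> {- real n..real n}" for x
        by (metis abs_le_D1 abs_le_D2 atLeastAtMost_iff minus_le_iff)
      then show ?thesis by blast
    qed
    then show "\<exists>A::real set set. countable A \<and> A \<subseteq> sets lebesgue \<and> \<Union>A = space lebesgue \<and>
      (\<forall>a\<in>A. emeasure lebesgue a \<noteq> \<infinity>)"
      by (intro exI[of _ "range (\<lambda>n. {- real n..real n})"]) auto
  qed
  have intA: "set_integrable lebesgue A f" if "A \<in> sets lebesgue" for A
    using f that unfolding set_integrable_def by (rule integrable_mult_indicator[rotated])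
  \<comment> \<open>The complement step of the induction needs the integral over the whole line,
    obtained as a limit over growing half-lines.\<close>
  have UN0: "set_lebesgue_integral lebesgue UNIV f = 0"
  proof -
    have "(\<lambda>n. set_lebesgue_integral lebesgue {..real n} f) \<longlonglongrightarrow> set_lebesgue_integral lebesgue (\<Union>n. {..real n}) f"
      by (rule set_integral_cont_up) (auto simp: incseq_def intro!: intA)
    moreover have "(\<Union>n. {..real n}) = UNIV"
      using real_arch_simple by auto
    ultimately show ?thesis
      by (simp add: 0 LIMSEQ_const_iff)
  qed
  have borel: "set_lebesgue_integral lebesgue A f = 0" if "A \<in> sets borel" for A
  proof -
    have "Int_stable (range (atMost :: real \<Rightarrow> real set))"
      by (auto simp: Int_stable_def)
    moreover have "range atMost \<subseteq> Pow (UNIV :: real set)" by simp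
    moreover have "A \<in> sigma_sets UNIV (range atMost)"
      using that by (simp add: borel_eq_atMost)
    ultimately show ?thesis
    proof (induction rule: sigma_sets_induct_disjoint)
      case (compl A)
      then have A: "A \<in> sets lebesgue" by (auto simp: borel_eq_atMost)
      have "set_lebesgue_integral lebesgue (A \<union> (UNIV - A)) f =
        set_lebesgue_integral lebesgue A f + set_lebesgue_integral lebesgue (UNIV - A) f"
        using A by (intro set_integral_Un intA) auto
      with compl UN0 show ?case by simp
    next
      case (union A)
      then have A: "range A \<subseteq> sets lebesgue" by (auto simp: borel_eq_atMost)
      have "set_lebesgue_integral lebesgue (\<Union>i. A i) f = (\<Sum>i. set_lebesgue_integral lebesgue (A i) f)"
        using A union by (intro lebesgue_integral_countable_add intA sets.countable_UN)
          (auto simp: disjoint_family_on_def)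
      then show ?case using union by simp
    qed (auto simp: 0 set_lebesgue_integral_def[of _ "{}"])
  qed
  fix A :: "real set" assume "A \<in> sets lebesgue"
  then obtain S N N' where SN: "A = S \<union> N" "N \<subseteq> N'" "N' \<in> null_sets lborel" "S \<in> sets lborel"
    by (rule sets_completionE)
  have "AE x in lebesgue. x \<notin> N'"
    using SN(3) by (intro AE_completion AE_not_in)
  then have "AE x in lebesgue. (x \<in> A) = (x \<in> S)"
    by (rule eventually_mono) (use SN(1,2) in auto)
  moreover have "set_borel_measurable lebesgue A f" "set_borel_measurable lebesgue S f"
    using borel_measurable_integrable[OF intA[of A, unfolded set_integrable_def]]
      borel_measurable_integrable[OF intA[of S, unfolded set_integrable_def]]
      \<open>A \<in> sets lebesgue\<close> SN(4) by (simp_all add: set_borel_measurable_def)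
  ultimately have "set_lebesgue_integral lebesgue A f = set_lebesgue_integral lebesgue S f"
    using set_integral_cong_set[of lebesgue A f S] by simp
  then show "set_lebesgue_integral lebesgue A f = 0"
    using borel SN(4) by simp
qed

lemma AE_lebesgue_negligible: "(AE x in lebesgue. P x) \<longleftrightarrow> negligible {x. \<not> P x}"
proof
  assume "AE x in lebesgue. P x"
  then obtain N where "{x \<in> space lebesgue. \<not> P x} \<subseteq> N" "emeasure lebesgue N = 0" "N \<in> sets lebesgue"
    by (rule AE_E)
  then have "negligible N" "{x. \<not> P x} \<subseteq> N" by (auto simp: negligible_iff_null_sets)
  then show "negligible {x. \<not> P x}" by (rule negligible_subset)
next
  assume "negligible {x. \<not> P x}"
  then show "AE x in lebesgue. P x"
    by (auto simp: negligible_iff_null_sets intro: AE_I')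
qed

text \<open>The difference quotients \<open>q k\<close> are bounded by \<open>L\<close> and converge
  almost everywhere to the derivative. Their integrals are difference quotients at \<open>a\<close>
  and \<open>b\<close> of a primitive \<open>\<Phi>\<close> of \<open>F\<close>, which converge to
  \<open>F a\<close> and \<open>F b\<close> by continuity. Dominated convergence joins the two
  limits.\<close>

lemma lipschitz_has_integral_D\<theta>:
  fixes F :: "real \<Rightarrow> 'b::euclidean_space"
  assumes L: "L-lipschitz_on UNIV F" and "a \<le> b"
  shows "(D\<theta> F has_integral (F b - F a)) {a..b}"
proof -
  \<comment> \<open>Integrating over the points of differentiability makes the convergence hold at
    every point of the domain; the passage back to \<open>{a..b}\<close> changes a null set
    only.\<close>
  define S where "S = {x \<in> {a..b}. F differentiable (at x)}"
  define q where "q k x = (1 / (1 / real (Suc k))) *\<^sub>R (F (x + 1 / real (Suc k)) - F x)" for k x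
  have "AE x in lebesgue. F differentiable (at x)"
    by (intro AE_completion lipschitz_ae_differentiable[OF L])
  then have "negligible {x. \<not> F differentiable (at x)}"
    by (simp add: AE_lebesgue_negligible)
  then have neg: "negligible ({a..b} - S)" "negligible (S - {a..b})"
    by (auto simp: S_def intro: negligible_subset[of "{x. \<not> F differentiable (at x)}"])
  have spike: "(f has_integral y) S = (f has_integral y) {a..b}" for f :: "real \<Rightarrow> 'c::banach" and y
    by (rule has_integral_spike_set_eq; rule negligible_subset, rule neg, blast)
  have cont: "continuous_on X F" for X
    by (rule continuous_on_subset[OF lipschitz_on_continuous_on[OF L]]) simp
  have cont': "continuous_on X (\<lambda>x. F (x + h))" for X h
    by (rule continuous_on_compose2[OF cont[of UNIV]]) (intro continuous_intros, simp)
  have lim0: "filterlim (\<lambda>n. 1 / real (Suc n)) (at 0) sequentially"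
    unfolding filterlim_at using LIMSEQ_inverse_real_of_nat by (auto simp: inverse_eq_divide)
  \<comment> \<open>The margin 1 leaves room for the shifts by \<open>1 / real (Suc k)\<close> and
    makes \<open>a\<close> and \<open>b\<close> interior points.\<close>
  obtain \<Phi> where \<Phi>: "\<And>x. x \<in> {a - 1..b + 1} \<Longrightarrow> (\<Phi> has_vector_derivative F x) (at x within {a - 1..b + 1})"
    using antiderivative_continuous[OF cont, of "a - 1" "b + 1"] by blast
  have \<Phi>': "(\<Phi> has_vector_derivative F x) (at x)" if "a - 1 < x" "x < b + 1" for x
    using \<Phi>[of x] that by (simp add: at_within_Icc_at)
  have int: "(q k has_integral (1 / (1 / real (Suc k))) *\<^sub>R (\<Phi> (b + 1 / real (Suc k)) - \<Phi> b)
     - (1 / (1 / real (Suc k))) *\<^sub>R (\<Phi> (a + 1 / real (Suc k)) - \<Phi> a)) {a..b}" for k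
  proof -
    define h where "h = 1 / real (Suc k)"
    have h: "0 < h" "h \<le> 1" by (auto simp: h_def)
    have "(F has_integral (\<Phi> b - \<Phi> a)) {a..b}"
      by (rule fundamental_theorem_of_calculus[OF \<open>a \<le> b\<close>])
        (rule has_vector_derivative_within_subset[OF \<Phi>], auto)
    moreover have "((\<lambda>x. F (x + h)) has_integral (\<Phi> (b + h) - \<Phi> (a + h))) {a..b}"
    proof (rule fundamental_theorem_of_calculus[OF \<open>a \<le> b\<close>])
      fix x assume "x \<in> {a..b}"
      then have "(\<Phi> has_vector_derivative F (x + h)) (at (x + h) within {a - 1..b + 1})"
        using h by (intro \<Phi>) auto
      then have "(\<Phi> has_vector_derivative F (x + h)) (at (x + h) within (\<lambda>x. x + h) ` {a..b})"
        by (rule has_vector_derivative_within_subset) (use h in auto)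
      then have "((\<Phi> \<circ> (\<lambda>x. x + h)) has_vector_derivative 1 *\<^sub>R F (x + h)) (at x within {a..b})"
        by (intro vector_diff_chain_within)
          (auto intro!: has_vector_derivative_add_const[THEN iffD2] has_vector_derivative_id)
      then show "((\<lambda>x. \<Phi> (x + h)) has_vector_derivative F (x + h)) (at x within {a..b})"
        by (simp add: o_def)
    qed
    ultimately have "((\<lambda>x. (1/h) *\<^sub>R (F (x + h) - F x)) has_integral
       (1/h) *\<^sub>R ((\<Phi> (b + h) - \<Phi> (a + h)) - (\<Phi> b - \<Phi> a))) {a..b}"
      by (intro has_integral_cmul has_integral_diff)
    moreover have "(1/h) *\<^sub>R ((\<Phi> (b + h) - \<Phi> (a + h)) - (\<Phi> b - \<Phi> a))
      = (1/h) *\<^sub>R (\<Phi> (b + h) - \<Phi> b) - (1/h) *\<^sub>R (\<Phi> (a + h) - \<Phi> a)"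
      by (simp add: scaleR_diff_right)
    ultimately show ?thesis
      unfolding q_def h_def[symmetric] by (simp only:)
  qed
  have "(D\<theta> F has_integral (F b - F a)) S"
  proof (rule has_integral_dominated_convergence[where f=q and h="\<lambda>x. L" and
      y="\<lambda>k. (1 / (1 / real (Suc k))) *\<^sub>R (\<Phi> (b + 1 / real (Suc k)) - \<Phi> b)
     - (1 / (1 / real (Suc k))) *\<^sub>R (\<Phi> (a + 1 / real (Suc k)) - \<Phi> a)"])
    show "(q k has_integral (1 / (1 / real (Suc k))) *\<^sub>R (\<Phi> (b + 1 / real (Suc k)) - \<Phi> b)
     - (1 / (1 / real (Suc k))) *\<^sub>R (\<Phi> (a + 1 / real (Suc k)) - \<Phi> a)) S" for k
      using int[of k] by (simp only: spike)
    show "(\<lambda>x. L) integrable_on S"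
      using spike[of "\<lambda>x. L"] integrable_const_ivl[of L a b] by (auto simp: integrable_on_def)
    show "\<forall>x\<in>S. norm (q k x) \<le> L" for k
    proof
      fix x
      define h where "h = 1 / real (Suc k)"
      have "0 < h" by (simp add: h_def)
      have "norm (F (x + h) - F x) \<le> L * h"
        using lipschitz_onD[OF L, of "x + h" x] \<open>0 < h\<close> by (simp add: dist_norm)
      then show "norm (q k x) \<le> L"
        unfolding q_def h_def[symmetric] norm_scaleR using \<open>0 < h\<close> by (simp add: divide_le_eq)
    qed
    show "\<forall>x\<in>S. (\<lambda>k. q k x) \<longlonglongrightarrow> D\<theta> F x"
    proof
      fix x assume "x \<in> S"
      then have "(F has_vector_derivative D\<theta> F x) (at x)"
        unfolding S_def D\<theta>_def using vector_derivative_works[of F "at x"] by blast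
      from filterlim_compose[OF vector_derivative_quotient[OF this] lim0]
      show "(\<lambda>k. q k x) \<longlonglongrightarrow> D\<theta> F x"
        unfolding q_def .
    qed
    show "(\<lambda>k. (1 / (1 / real (Suc k))) *\<^sub>R (\<Phi> (b + 1 / real (Suc k)) - \<Phi> b)
     - (1 / (1 / real (Suc k))) *\<^sub>R (\<Phi> (a + 1 / real (Suc k)) - \<Phi> a)) \<longlonglongrightarrow> F b - F a"
      using \<open>a \<le> b\<close>
      by (intro tendsto_diff
          filterlim_compose[OF vector_derivative_quotient[OF \<Phi>'[of b]] lim0]
          filterlim_compose[OF vector_derivative_quotient[OF \<Phi>'[of a]] lim0]) auto
  qed
  then show ?thesis
    by (simp only: spike)
qed

lemma lipschitz_increment_bound:
  fixes F :: "real \<Rightarrow> 'b::euclidean_space"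
  assumes L: "L-lipschitz_on UNIV F" and "a \<le> b"
    and B: "AE x in lebesgue. x \<in> {a<..<b} \<longrightarrow> norm (D\<theta> F x - y) \<le> B"
  shows "norm (F b - F a - (b - a) *\<^sub>R y) \<le> (b - a) * B"
proof (cases "a = b")
  case False
  with \<open>a \<le> b\<close> have "a < b" by simp
  have B0: "0 \<le> B"
  proof (rule ccontr)
    assume "\<not> 0 \<le> B"
    then have "AE x in lebesgue. x \<notin> {a<..<b}"
      using B by (elim eventually_mono) (auto dest: order_trans[OF norm_ge_zero])
    then show False using \<open>a < b\<close> open_not_negligible[of "{a<..<b}"]
      by (simp add: AE_lebesgue_negligible del: greaterThanLessThan_iff)
  qed
  define S where "S = {x. \<not> (x \<in> {a<..<b} \<longrightarrow> norm (D\<theta> F x - y) \<le> B)} \<union> {a, b}"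
  have S: "negligible S" using B by (simp add: S_def AE_lebesgue_negligible)
  \<comment> \<open>\<open>g\<close> vanishes on the exceptional null set, so that the bound holds
    at every point, as \<open>has_integral_bound\<close> requires. The endpoints belong to
    \<open>S\<close> because the hypothesis speaks of the open interval.\<close>
  define g where "g x = (if x \<in> S then 0 else D\<theta> F x - y)" for x
  have "((\<lambda>x. D\<theta> F x - y) has_integral (F b - F a - (b - a) *\<^sub>R y)) {a..b}"
    using has_integral_diff[OF lipschitz_has_integral_D\<theta>[OF L \<open>a \<le> b\<close>] has_integral_const_real[of y a b]]
      \<open>a \<le> b\<close> by simp
  then have "(g has_integral (F b - F a - (b - a) *\<^sub>R y)) {a..b}"
    by (rule has_integral_spike[OF S, rotated]) (simp add: g_def)
  then have "norm (F b - F a - (b - a) *\<^sub>R y) \<le> B * measure lborel {a..b}"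
    unfolding cbox_interval[symmetric] by (rule has_integral_bound[OF B0]) (use B0 in \<open>auto simp: g_def S_def\<close>)
  then show ?thesis using \<open>a \<le> b\<close> by (simp add: mult.commute)
qed simp

subsection \<open>The derivative as a bijection onto bounded functions of mean zero\<close>

text \<open>The extension is \<open>h\<close> composed with \<open>r\<close>, the reduction modulo
  \<open>T\<close>. If a multiple of \<open>T\<close> separates \<open>x\<close> and
  \<open>y\<close>, the increment is split using \<open>h 0 = h T\<close>; the two pieces have
  lengths \<open>T - r x\<close> and \<open>r y\<close>, which together do not exceed
  \<open>y - x\<close>. Crossing several periods costs nothing, so the constant \<open>K\<close> is
  kept.\<close>

lemma periodic_lipschitz_extension:
  fixes h :: "real \<Rightarrow> 'b::real_normed_vector"
  assumes h: "K-lipschitz_on {0..T} h" and T: "0 < T" and "h 0 = h T"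
  obtains H where "\<And>x. H (x + T) = H x" "K-lipschitz_on UNIV H" "\<And>x. x \<in> {0..T} \<Longrightarrow> H x = h x"
proof
  define r where "r x = x - T * \<lfloor>x / T\<rfloor>" for x
  have r: "0 \<le> r x" "r x < T" for x
  proof -
    have "T * \<lfloor>x / T\<rfloor> \<le> T * (x / T)" "T * (x / T) < T * (\<lfloor>x / T\<rfloor> + 1)"
      using T by (intro mult_left_mono mult_strict_left_mono; linarith)+
    then show "0 \<le> r x" "r x < T" using T by (auto simp: r_def algebra_simps)
  qed
  show "h (r (x + T)) = h (r x)" for x
    using T by (simp add: r_def add_divide_distrib algebra_simps)
  show "h (r x) = h x" if "x \<in> {0..T}" for x
  proof (cases "x = T")
    case False
    then have "\<lfloor>x / T\<rfloor> = 0" using that T by (auto simp: floor_eq_iff)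
    then show ?thesis by (simp add: r_def)
  qed (use T \<open>h 0 = h T\<close> in \<open>simp add: r_def\<close>)
  have "norm (h (r y) - h (r x)) \<le> K * (y - x)" if "x \<le> y" for x y
  proof (cases "\<lfloor>x / T\<rfloor> = \<lfloor>y / T\<rfloor>")
    case True
    then have eq: "r y - r x = y - x" by (simp add: r_def)
    have "norm (h (r y) - h (r x)) \<le> K * \<bar>r y - r x\<bar>"
      using lipschitz_onD[OF h, of "r y" "r x"] r[of x] r[of y] by (simp add: dist_norm)
    then show ?thesis using that eq by simp
  next
    case False
    have "\<lfloor>x / T\<rfloor> \<le> \<lfloor>y / T\<rfloor>" using that T by (intro floor_mono divide_right_mono) auto
    with False have "\<lfloor>x / T\<rfloor> + 1 \<le> \<lfloor>y / T\<rfloor>" by linarith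
    then have "T * real_of_int (\<lfloor>x / T\<rfloor> + 1) \<le> T * \<lfloor>y / T\<rfloor>"
      using T by (intro mult_left_mono) linarith+
    then have le: "r y + (T - r x) \<le> y - x" by (simp add: r_def algebra_simps)
    have "norm (h (r y) - h (r x)) \<le> norm (h (r y) - h 0) + norm (h T - h (r x))"
      using \<open>h 0 = h T\<close> norm_triangle_ineq[of "h (r y) - h 0" "h T - h (r x)"] by simp
    also have "\<dots> \<le> K * r y + K * (T - r x)"
      using lipschitz_onD[OF h, of "r y" 0] lipschitz_onD[OF h, of T "r x"] r[of x] r[of y] T
      by (intro add_mono) (auto simp: dist_norm)
    also have "\<dots> = K * (r y + (T - r x))" by (simp add: algebra_simps)
    also have "\<dots> \<le> K * (y - x)" by (intro mult_left_mono le lipschitz_on_nonneg[OF h])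
    finally show ?thesis .
  qed
  then show "K-lipschitz_on UNIV (\<lambda>x. h (r x))"
    using lipschitz_on_nonneg[OF h] by (intro lipschitz_on_leI) (auto simp: dist_norm norm_minus_commute)
qed

lemma AE_circle_iff: "(AE \<theta> in circle. P \<theta>) \<longleftrightarrow> (AE \<theta> in lebesgue. \<theta> \<in> {0..<2*pi} \<longrightarrow> P \<theta>)"
  unfolding circle_def by (subst AE_restrict_space_iff) auto

lemma AE_circle_const [simp]: "(AE \<theta> in circle. P) \<longleftrightarrow> P"
proof -
  have "emeasure circle (space circle) \<noteq> 0" by (simp add: emeasure_circle)
  then have "ae_filter circle \<noteq> bot" by (simp add: ae_filter_eq_bot_iff)
  then show ?thesis by (simp add: eventually_const)
qed

lemma Linf_integrable:
  assumes "f \<in> Linf" shows "integrable circle f"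
proof -
  interpret finite_measure circle by standard (simp add: emeasure_circle)
  show ?thesis using assms by (auto simp: Linf_def intro: integrable_const_bound)
qed

lemma has_integral_circle:
  fixes f :: "real \<Rightarrow> 'b::euclidean_space"
  assumes "integrable circle f"
  shows "(f has_integral (\<integral>\<theta>. f \<theta> \<partial>circle)) {0..2*pi}"
proof -
  have "(f has_integral (\<integral>\<theta>. f \<theta> \<partial>circle)) {0..<2*pi}"
    using assms unfolding circle_def by (rule has_integral_integral_lebesgue_on) auto
  then show ?thesis
    by (rule has_integral_spike_set_eq[THEN iffD1, rotated -1])
      (rule negligible_subset[of "{2*pi}"]; auto)+
qed

text \<open>The candidate is the indefinite integral: a bound of the integrand is its Lipschitz
  constant, and the vanishing mean makes it periodic. By
  \<open>lipschitz_has_integral_D\<theta>\<close>, its derivative and the integrand have equal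
  integrals over all initial segments, hence they agree almost everywhere.\<close>

lemma Linf_primitive:
  fixes f :: "real \<Rightarrow> real ^ 'd"
  assumes f: "f \<in> Linf" and f0: "(\<integral>\<theta>. f \<theta> \<partial>circle) = 0"
  obtains H where "H \<in> W1inf" "AE \<theta> in circle. D\<theta> H \<theta> = f \<theta>"
proof -
  obtain C where C: "AE \<theta> in circle. norm (f \<theta>) \<le> C" using f by (auto simp: Linf_def)
  then have "AE \<theta> in circle. 0 \<le> C" by eventually_elim (rule order_trans[OF norm_ge_zero])
  then have C0: "0 \<le> C" by simp
  \<comment> \<open>A representative bounded by \<open>C\<close> at every point, since the integral
    estimate behind \<open>hlip\<close> admits no exceptional points.\<close>
  define g where "g \<theta> = (if norm (f \<theta>) \<le> C then f \<theta> else 0)" for \<theta>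
  have gC: "norm (g \<theta>) \<le> C" for \<theta> using C0 by (simp add: g_def)
  have gf: "AE \<theta> in circle. g \<theta> = f \<theta>" using C by eventually_elim (simp add: g_def)
  have [measurable]: "f \<in> borel_measurable circle" using f by (simp add: Linf_def)
  have gm: "g \<in> borel_measurable circle" unfolding g_def by measurable
  have "integrable circle g"
    using Linf_integrable[OF f] integrable_cong_AE[OF gm _ gf] by simp
  moreover have "(\<integral>\<theta>. g \<theta> \<partial>circle) = 0"
    using f0 integral_cong_AE[OF gm _ gf] by simp
  ultimately have g: "(g has_integral 0) {0..2*pi}"
    using has_integral_circle[of g] by simp
  have gint: "g integrable_on {x..y}" if "0 \<le> x" "y \<le> 2*pi" for x y
    using g that by (auto intro: integrable_on_subinterval)
  define h where "h x = integral {0..x} g" for x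
  have hd: "(g has_integral (h y - h x)) {x..y}" if "0 \<le> x" "x \<le> y" "y \<le> 2*pi" for x y
  proof -
    have "h x + integral {x..y} g = h y"
      unfolding h_def by (rule Henstock_Kurzweil_Integration.integral_combine) (use that gint in auto)
    then show ?thesis using gint[of x y] that by (metis add_diff_cancel_left' integrable_integral)
  qed
  have hlip: "norm (h y - h x) \<le> C * (y - x)" if "0 \<le> x" "x \<le> y" "y \<le> 2*pi" for x y
    using has_integral_bound[of C g "h y - h x" x y] hd[OF that] gC C0 that by simp
  have "C-lipschitz_on {0..2*pi} h"
    using hlip C0 by (intro lipschitz_on_leI) (auto simp: dist_norm norm_minus_commute)
  moreover have "h 0 = h (2*pi)" using g by (simp add: h_def integral_unique)
  ultimately obtain H where H: "\<And>x. H (x + 2*pi) = H x" "C-lipschitz_on UNIV H"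
    "\<And>x. x \<in> {0..2*pi} \<Longrightarrow> H x = h x"
    using periodic_lipschitz_extension[of C "2*pi" h] by auto
  then have HW: "H \<in> W1inf" by (auto simp: W1inf_def)
  define w where "w \<theta> = D\<theta> H \<theta> - g \<theta>" for \<theta>
  have wi: "integrable circle w"
    unfolding w_def using Linf_integrable[OF D\<theta>_in_Linf[OF HW]] \<open>integrable circle g\<close> by simp
  have w0: "(w has_integral 0) {0..x}" if "0 \<le> x" "x \<le> 2*pi" for x
    using has_integral_diff[OF lipschitz_has_integral_D\<theta>[OF H(2) that(1)] hd[of 0 x]] that H(3)
    by (simp add: w_def[abs_def])
  \<comment> \<open>After extension by zero, the integral over a half-line reduces to one over
    \<open>{0..min x (2*pi)}\<close>; the point \<open>2*pi\<close>, where \<open>u\<close> and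
    \<open>w\<close> may differ, is negligible.\<close>
  define u where "u \<theta> = indicator {0..<2*pi} \<theta> *\<^sub>R w \<theta>" for \<theta>
  have ui: "integrable lebesgue u"
    using wi unfolding circle_def u_def by (subst (asm) integrable_restrict_space) auto
  have "AE \<theta> in lebesgue. u \<theta> = 0"
  proof (rule AE_zero_if_integrals_atMost_zero[OF ui])
    fix x
    have si: "set_integrable lebesgue {..x} u"
      unfolding set_integrable_def by (rule integrable_mult_indicator[OF _ ui]) simp
    have "(u has_integral 0) {..x}"
    proof (cases "x < 0")
      case True
      then show ?thesis by (intro has_integral_is_0) (auto simp: u_def)
    next
      case False
      define m where "m = min x (2*pi)"
      have "(u has_integral 0) {0..m}"
      proof (rule has_integral_spike[where S="{2*pi}" and f=w])
        show "(w has_integral 0) {0..m}" using False by (intro w0) (auto simp: m_def)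
      qed (use False in \<open>auto simp: u_def m_def\<close>)
      moreover have "{\<theta> \<in> {0..m} - {..x}. u \<theta> \<noteq> 0} = {}" "{\<theta> \<in> {..x} - {0..m}. u \<theta> \<noteq> 0} = {}"
        by (auto simp: m_def u_def indicator_def split: if_splits)
      ultimately show ?thesis
        using has_integral_spike_set_eq[of "{0..m}" "{..x}" u 0] by (simp only: negligible_empty)
    qed
    then show "set_lebesgue_integral lebesgue {..x} u = 0"
      using set_lebesgue_integral_eq_integral(2)[OF si] by (simp add: integral_unique)
  qed
  then have "AE \<theta> in circle. D\<theta> H \<theta> = g \<theta>"
    unfolding AE_circle_iff by eventually_elim (auto simp: u_def w_def)
  with gf have "AE \<theta> in circle. D\<theta> H \<theta> = f \<theta>" by eventually_elim simp
  with HW show thesis by (rule that)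
qed

lemma D\<theta>_minus_AE:
  "AE \<theta> in circle. D\<theta> (fn (h - k)) \<theta> = D\<theta> (fn h) \<theta> - D\<theta> (fn k) \<theta>"
  using W1inf_differentiable_AE[OF fn_W1inf[of h]] W1inf_differentiable_AE[OF fn_W1inf[of k]]
  by eventually_elim (simp add: D\<theta>_def minus_W10.rep_eq)

lemma W10_lipschitz: obtains L where "L-lipschitz_on UNIV (fn c)"
  using fn_W1inf[of c] by (auto simp: W1inf_def)

lemma W10_increment_bound:
  assumes "0 \<le> a" "a \<le> b" "b \<le> 2*pi"
    and B: "AE x in circle. x \<in> {a<..<b} \<longrightarrow> norm (D\<theta> (fn h) x - y) \<le> B"
  shows "norm (fn h b - fn h a - (b - a) *\<^sub>R y) \<le> (b - a) * B"
proof -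
  obtain L where "L-lipschitz_on UNIV (fn h)" by (rule W10_lipschitz)
  moreover have "AE x in lebesgue. x \<in> {a<..<b} \<longrightarrow> norm (D\<theta> (fn h) x - y) \<le> B"
    using B unfolding AE_circle_iff by eventually_elim (use assms in auto)
  ultimately show ?thesis using assms(2) by (intro lipschitz_increment_bound)
qed

lemma W10_eq_zero_if_constant:
  assumes "\<And>\<theta>. \<theta> \<in> {0..2*pi} \<Longrightarrow> fn h \<theta> = a"
  shows "h = 0"
proof -
  have "(\<integral>\<theta>. fn h \<theta> \<partial>circle) = (\<integral>\<theta>. a \<partial>circle)"
    by (rule Bochner_Integration.integral_cong) (auto simp: space_circle assms)
  also have "\<dots> = (2*pi) *\<^sub>R a"
    by (simp add: measure_def emeasure_circle)
  finally have "a = 0" using fn[of h] by simp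
  then have "fn h \<theta> = 0" for \<theta> using W1inf_fundamental_domain[OF fn_W1inf[of h], of \<theta>] assms by auto
  then show ?thesis by (simp add: fn_inject[symmetric] fun_eq_iff zero_W10.rep_eq)
qed

text \<open>Equal derivatives leave only a constant, and mean zero forces it to vanish. This is the
  uniqueness behind \<open>THE\<close> in \<open>Ds_inv\<close>; \<open>D\<theta>_fn_surj\<close>
  supplies existence.\<close>

lemma D\<theta>_fn_inject:
  assumes "AE \<theta> in circle. D\<theta> (fn h) \<theta> = D\<theta> (fn k) \<theta>"
  shows "h = k"
proof -
  have "AE \<theta> in circle. D\<theta> (fn (h - k)) \<theta> = 0"
    using D\<theta>_minus_AE[of h k] assms by eventually_elim simp
  then have "AE x in circle. x \<in> {0<..<\<theta>} \<longrightarrow> norm (D\<theta> (fn (h - k)) x - 0) \<le> 0" for \<theta>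
    by eventually_elim simp
  then have "fn (h - k) \<theta> = fn (h - k) 0" if "\<theta> \<in> {0..2*pi}" for \<theta>
    using W10_increment_bound[of 0 \<theta> "h - k" 0 0] that by simp
  then show ?thesis using W10_eq_zero_if_constant by (metis eq_iff_diff_eq_0)
qed

lemma D\<theta>_fn_surj:
  fixes f :: "real \<Rightarrow> real ^ 'd"
  assumes "f \<in> Linf" "(\<integral>\<theta>. f \<theta> \<partial>circle) = 0"
  obtains h :: "'d W10" where "AE \<theta> in circle. D\<theta> (fn h) \<theta> = f \<theta>"
proof -
  obtain H where H: "H \<in> W1inf" "AE \<theta> in circle. D\<theta> H \<theta> = f \<theta>"
    using Linf_primitive[OF assms] .
  define m where "m = (1/(2*pi)) *\<^sub>R (\<integral>\<theta>. H \<theta> \<partial>circle)"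
  have "(\<lambda>_. - m) \<in> W1inf" by (auto simp: W1inf_def intro: lipschitz_on_constant)
  from W1inf_add[OF H(1) this] have HmW: "(\<lambda>\<theta>. H \<theta> - m) \<in> W1inf" by simp
  moreover have "(\<integral>\<theta>. H \<theta> - m \<partial>circle) = 0"
    using W1inf_integrable[OF H(1)] W1inf_integrable[OF \<open>(\<lambda>_. - m) \<in> W1inf\<close>]
    by (subst Bochner_Integration.integral_diff) (auto simp: measure_def emeasure_circle m_def)
  ultimately have fn: "fn (Abs_W10 (\<lambda>\<theta>. H \<theta> - m)) = (\<lambda>\<theta>. H \<theta> - m)"
    by (intro Abs_W10_inverse) auto
  have "AE \<theta> in circle. D\<theta> (\<lambda>\<theta>. H \<theta> - m) \<theta> = f \<theta>"
    using H(2) W1inf_differentiable_AE[OF H(1)]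
    by eventually_elim (simp add: D\<theta>_def)
  then show thesis using that[of "Abs_W10 (\<lambda>\<theta>. H \<theta> - m)"] unfolding fn by blast
qed

subsection \<open>Arc length integrals and the projection\<close>

lemma AE_norm_D\<theta>_le: "AE \<theta> in circle. norm (D\<theta> (fn h) \<theta>) \<le> norm h"
  using AE_Linf_norm[OF D\<theta>_in_Linf[OF fn_W1inf[of h]]]
proof eventually_elim
  case (elim \<theta>)
  then show ?case
    using Linf_norm_nonneg[OF W1inf_in_Linf[OF fn_W1inf[of h]]] by (simp add: norm_W10_def W1inf_norm_def)
qed

lemma D\<theta>_fn_measurable [measurable]: "D\<theta> (fn h) \<in> borel_measurable circle"
  by (rule D\<theta>_measurable[OF fn_W1inf])

text \<open>A real number strictly between the essential supremum of the negated speed and 0 turns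
  positivity of the essential infimum into a uniform lower bound, the form in which immersions are
  used from here on.\<close>

lemma immersions_iff: "c \<in> immersions \<longleftrightarrow> (\<exists>\<epsilon>>0. AE \<theta> in circle. \<epsilon> \<le> norm (D\<theta> (fn c) \<theta>))"
proof -
  let ?f = "\<lambda>\<theta>. - ereal (norm (D\<theta> (fn c) \<theta>))"
  have eq: "c \<in> immersions \<longleftrightarrow> esssup circle ?f < 0"
    by (simp add: immersions_def essinf_def ereal_less_uminus_reorder)
  show ?thesis
  proof
    assume "c \<in> immersions"
    then obtain e :: real where e: "esssup circle ?f < ereal e" "ereal e < 0"
      using ereal_dense2 unfolding eq by blast
    have "AE \<theta> in circle. - e \<le> norm (D\<theta> (fn c) \<theta>)"
      using esssup_AE[of ?f circle]
    proof eventually_elim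
      case (elim \<theta>)
      then have "?f \<theta> \<le> ereal e" using e(1) by (meson less_imp_le order_trans)
      then show ?case by (simp add: minus_le_iff)
    qed
    then show "\<exists>\<epsilon>>0. AE \<theta> in circle. \<epsilon> \<le> norm (D\<theta> (fn c) \<theta>)"
      using e(2) by (intro exI[of _ "- e"]) simp
  next
    assume "\<exists>\<epsilon>>0. AE \<theta> in circle. \<epsilon> \<le> norm (D\<theta> (fn c) \<theta>)"
    then obtain \<epsilon> where \<epsilon>: "\<epsilon> > 0" "AE \<theta> in circle. \<epsilon> \<le> norm (D\<theta> (fn c) \<theta>)" by blast
    have "esssup circle ?f \<le> ereal (- \<epsilon>)"
    proof (rule esssup_I)
      show "AE \<theta> in circle. ?f \<theta> \<le> ereal (- \<epsilon>)"
        using \<epsilon>(2) by eventually_elim simp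
    qed measurable
    also have "\<dots> < 0" using \<epsilon>(1) by simp
    finally show "c \<in> immersions" unfolding eq .
  qed
qed

text \<open>The norm of \<open>W10\<close> dominates the derivative almost everywhere. This yields
  openness of \<open>immersions\<close>, and later the persistence of the lower bound along a
  geodesic.\<close>

lemma AE_norm_D\<theta>_perturb:
  assumes "AE \<theta> in circle. \<epsilon> \<le> norm (D\<theta> (fn c) \<theta>)"
  shows "AE \<theta> in circle. \<epsilon> - norm (c' - c) \<le> norm (D\<theta> (fn c') \<theta>)"
  using assms AE_norm_D\<theta>_le[of "c' - c"] D\<theta>_minus_AE[of c' c]
proof eventually_elim
  case (elim \<theta>)
  then show ?case using norm_triangle_ineq2[of "D\<theta> (fn c) \<theta>" "D\<theta> (fn c) \<theta> - D\<theta> (fn c') \<theta>"]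
    by (simp add: norm_minus_commute)
qed

lemma open_immersions: "open immersions"
  unfolding open_dist
proof
  fix c :: "'d::finite W10" assume "c \<in> immersions"
  then obtain \<epsilon> where \<epsilon>: "\<epsilon> > 0" "AE \<theta> in circle. \<epsilon> \<le> norm (D\<theta> (fn c) \<theta>)"
    unfolding immersions_iff by blast
  have "c' \<in> immersions" if "dist c' c < \<epsilon>" for c'
    unfolding immersions_iff using AE_norm_D\<theta>_perturb[OF \<epsilon>(2), of c'] that
    by (intro exI[of _ "\<epsilon> - norm (c' - c)"]) (simp add: dist_norm)
  then show "\<exists>e>0. \<forall>y. dist y c < e \<longrightarrow> y \<in> immersions" using \<epsilon>(1) by blast
qed

lemma Linf_D\<theta>_fn: "D\<theta> (fn h) \<in> Linf"
  by (simp add: D\<theta>_in_Linf fn_W1inf)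

lemma Linf_boundI: "f \<in> borel_measurable circle \<Longrightarrow> AE \<theta> in circle. norm (f \<theta>) \<le> C \<Longrightarrow> f \<in> Linf"
  by (auto simp: Linf_def)

lemma Linf_scaleR_fun:
  assumes "f \<in> Linf" "g \<in> Linf" shows "(\<lambda>\<theta>. f \<theta> *\<^sub>R g \<theta>) \<in> Linf"
proof -
  obtain A B where A: "AE \<theta> in circle. norm (f \<theta>) \<le> A" and B: "AE \<theta> in circle. norm (g \<theta>) \<le> B"
    using assms by (auto simp: Linf_def)
  have "AE \<theta> in circle. norm (f \<theta> *\<^sub>R g \<theta>) \<le> A * B"
    using A B
  proof eventually_elim
    case (elim \<theta>)
    then have "0 \<le> A" using norm_ge_zero order_trans by blast
    with elim show ?case by (simp add: mult_mono)
  qed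
  then show ?thesis using assms by (intro Linf_boundI) (auto simp: Linf_def)
qed

lemma Linf_diff:
  assumes "f \<in> Linf" "g \<in> Linf" shows "(\<lambda>\<theta>. f \<theta> - g \<theta>) \<in> Linf"
proof -
  obtain A B where A: "AE \<theta> in circle. norm (f \<theta>) \<le> A" and B: "AE \<theta> in circle. norm (g \<theta>) \<le> B"
    using assms by (auto simp: Linf_def)
  have "AE \<theta> in circle. norm (f \<theta> - g \<theta>) \<le> A + B"
    using A B by eventually_elim (rule order_trans[OF norm_triangle_ineq4 add_mono])
  then show ?thesis using assms by (intro Linf_boundI) (auto simp: Linf_def)
qed

lemma Linf_const: "(\<lambda>_. a) \<in> Linf"
  by (rule Linf_boundI[of _ "norm a"]) auto

lemma Linf_norm_fun: "f \<in> Linf \<Longrightarrow> (\<lambda>\<theta>. norm (f \<theta>)) \<in> Linf"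
  by (auto simp: Linf_def)

lemma Linf_inner:
  assumes "f \<in> Linf" "g \<in> Linf" shows "(\<lambda>\<theta>. f \<theta> \<bullet> g \<theta>) \<in> Linf"
proof -
  obtain A B where A: "AE \<theta> in circle. norm (f \<theta>) \<le> A" and B: "AE \<theta> in circle. norm (g \<theta>) \<le> B"
    using assms by (auto simp: Linf_def)
  have "AE \<theta> in circle. norm (f \<theta> \<bullet> g \<theta>) \<le> A * B"
    using A B
  proof eventually_elim
    case (elim \<theta>)
    then have "0 \<le> A" using norm_ge_zero order_trans by blast
    have "norm (f \<theta> \<bullet> g \<theta>) \<le> norm (f \<theta>) * norm (g \<theta>)" by (simp add: Cauchy_Schwarz_ineq2)
    also have "\<dots> \<le> A * B" using elim \<open>0 \<le> A\<close> by (simp add: mult_mono)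
    finally show ?case .
  qed
  then show ?thesis using assms by (intro Linf_boundI) (auto simp: Linf_def)
qed

lemma integral_ds:
  fixes f :: "real \<Rightarrow> 'b::euclidean_space"
  assumes "f \<in> borel_measurable circle"
  shows "(\<integral>\<theta>. f \<theta> \<partial>ds c) = (\<integral>\<theta>. norm (D\<theta> (fn c) \<theta>) *\<^sub>R f \<theta> \<partial>circle)"
  unfolding ds_def using assms by (intro integral_density) auto

lemma len_eq: "len c = (\<integral>\<theta>. norm (D\<theta> (fn c) \<theta>) \<partial>circle)"
  unfolding len_def by (subst integral_ds) auto

lemma integrable_ds:
  fixes f :: "real \<Rightarrow> 'b::euclidean_space"
  assumes "f \<in> Linf"
  shows "integrable circle (\<lambda>\<theta>. norm (D\<theta> (fn c) \<theta>) *\<^sub>R f \<theta>)"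
  by (intro Linf_integrable Linf_scaleR_fun Linf_norm_fun Linf_D\<theta>_fn assms)

lemma len_pos:
  assumes "c \<in> immersions" shows "0 < len c"
proof -
  obtain \<epsilon> where \<epsilon>: "\<epsilon> > 0" "AE \<theta> in circle. \<epsilon> \<le> norm (D\<theta> (fn c) \<theta>)"
    using assms unfolding immersions_iff by blast
  have "0 < (2*pi) * \<epsilon>" using \<epsilon> by simp
  also have "\<dots> = (\<integral>\<theta>. \<epsilon> \<partial>circle)" by (simp add: measure_def emeasure_circle)
  also have "\<dots> \<le> len c"
    unfolding len_eq using \<epsilon>
    by (intro integral_mono_AE Linf_integrable Linf_const Linf_norm_fun Linf_D\<theta>_fn) auto
  finally show ?thesis .
qed

lemma norm_integral_ds_le:
  fixes f :: "real \<Rightarrow> 'b::euclidean_space"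
  assumes f: "f \<in> borel_measurable circle" and B: "AE \<theta> in circle. norm (f \<theta>) \<le> B"
  shows "norm (\<integral>\<theta>. f \<theta> \<partial>ds c) \<le> B * len c"
proof -
  have fL: "f \<in> Linf" using assms by (rule Linf_boundI)
  have "norm (\<integral>\<theta>. f \<theta> \<partial>ds c) \<le> (\<integral>\<theta>. norm (norm (D\<theta> (fn c) \<theta>) *\<^sub>R f \<theta>) \<partial>circle)"
    unfolding integral_ds[OF f] by (rule integral_norm_bound)
  also have "\<dots> \<le> (\<integral>\<theta>. norm (D\<theta> (fn c) \<theta>) * B \<partial>circle)"
  proof (rule integral_mono_AE)
    show "integrable circle (\<lambda>\<theta>. norm (norm (D\<theta> (fn c) \<theta>) *\<^sub>R f \<theta>))"
      by (intro integrable_norm integrable_ds fL)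
    show "integrable circle (\<lambda>\<theta>. norm (D\<theta> (fn c) \<theta>) * B)"
      using integrable_ds[OF Linf_const[of B], of c] by simp
    show "AE \<theta> in circle. norm (norm (D\<theta> (fn c) \<theta>) *\<^sub>R f \<theta>) \<le> norm (D\<theta> (fn c) \<theta>) * B"
      using B by eventually_elim (simp add: mult_left_mono)
  qed
  also have "\<dots> = B * len c" by (simp add: len_eq)
  finally show ?thesis .
qed

definition ds_mean :: "('d::finite) W10 \<Rightarrow> (real \<Rightarrow> real ^ 'd) \<Rightarrow> real ^ 'd"
  where "ds_mean c k = (1 / len c) *\<^sub>R (\<integral>\<theta>. k \<theta> \<partial>ds c)"

lemma W00_iff: "k \<in> W00 c \<longleftrightarrow> k \<in> Linf \<and> (\<integral>\<theta>. norm (D\<theta> (fn c) \<theta>) *\<^sub>R k \<theta> \<partial>circle) = 0"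
  unfolding W00_def by (auto simp: integral_ds Linf_def)

lemma minus_ds_mean_W00:
  assumes c: "c \<in> immersions" and k: "k \<in> Linf"
  shows "(\<lambda>\<theta>. k \<theta> - ds_mean c k) \<in> W00 c"
proof -
  have "(\<integral>\<theta>. norm (D\<theta> (fn c) \<theta>) *\<^sub>R (k \<theta> - ds_mean c k) \<partial>circle)
    = (\<integral>\<theta>. norm (D\<theta> (fn c) \<theta>) *\<^sub>R k \<theta> \<partial>circle) - (\<integral>\<theta>. norm (D\<theta> (fn c) \<theta>) *\<^sub>R ds_mean c k \<partial>circle)"
    unfolding scaleR_diff_right by (intro Bochner_Integration.integral_diff integrable_ds k Linf_const)
  also have "(\<integral>\<theta>. norm (D\<theta> (fn c) \<theta>) *\<^sub>R ds_mean c k \<partial>circle) = len c *\<^sub>R ds_mean c k"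
    unfolding len_eq by (intro integral_scaleR_left Linf_integrable Linf_norm_fun Linf_D\<theta>_fn)
  also have "\<dots> = (\<integral>\<theta>. norm (D\<theta> (fn c) \<theta>) *\<^sub>R k \<theta> \<partial>circle)"
    using len_pos[OF c] k by (simp add: ds_mean_def integral_ds Linf_def)
  finally show ?thesis by (simp add: W00_iff Linf_diff k Linf_const)
qed

text \<open>Constants are orthogonal to \<open>W00 c\<close>, so subtracting the mean satisfies the
  defining property of the projection. The representative selected by \<open>SOME\<close> differs
  from it by some \<open>e\<close> in \<open>W00 c\<close>; testing with \<open>e\<close> itself
  makes the weighted integral of \<open>e \<theta> \<bullet> e \<theta>\<close> vanish, and for an
  immersion the weight is positive almost everywhere.\<close>

lemma proj0_AE:
  assumes c: "c \<in> immersions" and k: "k \<in> Linf"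
  shows "AE \<theta> in circle. proj0 c k \<theta> = k \<theta> - ds_mean c k"
proof -
  define q where "q \<theta> = norm (D\<theta> (fn c) \<theta>)" for \<theta>
  let ?m = "ds_mean c k"
  let ?P = "\<lambda>p. p \<in> W00 c \<and> (\<forall>e\<in>W00 c. (\<integral>\<theta>. (k \<theta> - p \<theta>) \<bullet> e \<theta> \<partial>ds c) = 0)"
  have inner0: "(\<integral>\<theta>. q \<theta> * (?m \<bullet> e \<theta>) \<partial>circle) = 0" if "e \<in> W00 c" for e
  proof -
    have "(\<integral>\<theta>. ?m \<bullet> (q \<theta> *\<^sub>R e \<theta>) \<partial>circle) = ?m \<bullet> (\<integral>\<theta>. q \<theta> *\<^sub>R e \<theta> \<partial>circle)"
      using that integrable_ds[of e c] by (intro integral_inner_right) (simp add: W00_iff q_def)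
    then show ?thesis using that by (simp add: W00_iff q_def)
  qed
  have "?P (\<lambda>\<theta>. k \<theta> - ?m)"
  proof (intro conjI ballI minus_ds_mean_W00[OF c k])
    fix e assume e: "e \<in> W00 c"
    then have "(\<lambda>\<theta>. ?m \<bullet> e \<theta>) \<in> borel_measurable circle" by (auto simp: W00_iff Linf_def)
    then show "(\<integral>\<theta>. (k \<theta> - (k \<theta> - ?m)) \<bullet> e \<theta> \<partial>ds c) = 0"
      using inner0[OF e] by (simp add: integral_ds q_def)
  qed
  then have p: "?P (proj0 c k)"
    unfolding proj0_def by (rule someI[of ?P])
  define e where "e \<theta> = (k \<theta> - ?m) - proj0 c k \<theta>" for \<theta>
  have eL: "e \<in> Linf" unfolding e_def using p by (intro Linf_diff k Linf_const) (simp add: W00_iff)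
  have eW: "e \<in> W00 c"
  proof -
    have "(\<integral>\<theta>. q \<theta> *\<^sub>R e \<theta> \<partial>circle)
      = (\<integral>\<theta>. q \<theta> *\<^sub>R (k \<theta> - ?m) \<partial>circle) - (\<integral>\<theta>. q \<theta> *\<^sub>R proj0 c k \<theta> \<partial>circle)"
      unfolding e_def scaleR_diff_right[of _ "_ - _"] q_def
      using p by (intro Bochner_Integration.integral_diff integrable_ds Linf_diff k Linf_const) (simp add: W00_iff)
    then show ?thesis using p minus_ds_mean_W00[OF c k] eL by (simp add: W00_iff q_def)
  qed
  have eq: "(k \<theta> - proj0 c k \<theta>) \<bullet> e \<theta> = ?m \<bullet> e \<theta> + e \<theta> \<bullet> e \<theta>" for \<theta>
    by (simp add: e_def inner_diff_left)
  have [measurable]: "e \<in> borel_measurable circle" using eL by (simp add: Linf_def)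
  have "(\<integral>\<theta>. (k \<theta> - proj0 c k \<theta>) \<bullet> e \<theta> \<partial>ds c) = 0" using p eW by blast
  then have "(\<integral>\<theta>. q \<theta> *\<^sub>R (?m \<bullet> e \<theta> + e \<theta> \<bullet> e \<theta>) \<partial>circle) = 0"
    unfolding eq by (subst (asm) integral_ds) (auto simp: q_def)
  moreover have "(\<integral>\<theta>. q \<theta> *\<^sub>R (?m \<bullet> e \<theta> + e \<theta> \<bullet> e \<theta>) \<partial>circle)
    = (\<integral>\<theta>. q \<theta> *\<^sub>R (?m \<bullet> e \<theta>) \<partial>circle) + (\<integral>\<theta>. q \<theta> *\<^sub>R (e \<theta> \<bullet> e \<theta>) \<partial>circle)"
    unfolding scaleR_add_right q_def
    by (intro Bochner_Integration.integral_add integrable_ds Linf_inner eL Linf_const)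
  ultimately have "(\<integral>\<theta>. q \<theta> *\<^sub>R (e \<theta> \<bullet> e \<theta>) \<partial>circle) = 0"
    using inner0[OF eW] by simp
  then have qe: "AE \<theta> in circle. q \<theta> *\<^sub>R (e \<theta> \<bullet> e \<theta>) = 0"
    using integrable_ds[OF Linf_inner[OF eL eL], of c]
    by (subst (asm) integral_nonneg_eq_0_iff_AE) (auto simp: q_def)
  obtain \<epsilon> where "\<epsilon> > 0" and \<epsilon>: "AE \<theta> in circle. \<epsilon> \<le> norm (D\<theta> (fn c) \<theta>)"
    using c unfolding immersions_iff by blast
  from qe \<epsilon> show ?thesis
    by eventually_elim (use \<open>\<epsilon> > 0\<close> in \<open>auto simp: e_def q_def\<close>)
qed

text \<open>Membership in \<open>W00 c\<close> says exactly that the right-hand side, which carries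
  the weight of \<open>ds c\<close>, has mean zero on \<open>circle\<close>, so it is the derivative
  of a unique element of \<open>W10\<close>. The nonlocal term thus becomes pointwise up to the
  single vector \<open>ds_mean c k\<close>.\<close>

lemma D\<theta>_Ds_inv_proj0:
  assumes c: "c \<in> immersions" and k: "k \<in> Linf"
  shows "AE \<theta> in circle. D\<theta> (fn (Ds_inv c (proj0 c k))) \<theta> = norm (D\<theta> (fn c) \<theta>) *\<^sub>R (k \<theta> - ds_mean c k)"
proof -
  obtain \<epsilon> where "\<epsilon> > 0" and \<epsilon>: "AE \<theta> in circle. \<epsilon> \<le> norm (D\<theta> (fn c) \<theta>)"
    using c unfolding immersions_iff by blast
  have W: "(\<lambda>\<theta>. k \<theta> - ds_mean c k) \<in> W00 c" by (rule minus_ds_mean_W00[OF assms])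
  then obtain h where h: "AE \<theta> in circle. D\<theta> (fn h) \<theta> = norm (D\<theta> (fn c) \<theta>) *\<^sub>R (k \<theta> - ds_mean c k)"
    using D\<theta>_fn_surj[of "\<lambda>\<theta>. norm (D\<theta> (fn c) \<theta>) *\<^sub>R (k \<theta> - ds_mean c k)"]
    by (auto simp: W00_iff Linf_scaleR_fun Linf_norm_fun Linf_D\<theta>_fn)
  have "Ds_inv c (proj0 c k) = h"
    unfolding Ds_inv_def
  proof (rule the_equality)
    show "AE \<theta> in circle. Ds c h \<theta> = proj0 c k \<theta>"
      using h proj0_AE[OF assms] \<epsilon>
    proof eventually_elim
      case (elim \<theta>)
      then have "norm (D\<theta> (fn c) \<theta>) \<noteq> 0" using \<open>\<epsilon> > 0\<close> by linarith
      with elim show ?case by (simp add: Ds_def)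
    qed
    fix h' assume "AE \<theta> in circle. Ds c h' \<theta> = proj0 c k \<theta>"
    then have "AE \<theta> in circle. D\<theta> (fn h') \<theta> = D\<theta> (fn h) \<theta>"
      using h proj0_AE[OF assms] \<epsilon>
    proof eventually_elim
      case (elim \<theta>)
      then have "norm (D\<theta> (fn c) \<theta>) \<noteq> 0" using \<open>\<epsilon> > 0\<close> by linarith
      then have "D\<theta> (fn h') \<theta> = norm (D\<theta> (fn c) \<theta>) *\<^sub>R Ds c h' \<theta>" by (simp add: Ds_def)
      then show ?case using elim by simp
    qed
    then show "h' = h" by (rule D\<theta>_fn_inject)
  qed
  with h show ?thesis by simp
qed

subsection \<open>The pointwise geodesic equation\<close>

text \<open>Boundedness is carried along because a product of Lipschitz functions need not be
  Lipschitz without bounds on the factors.\<close>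

definition bounded_lipschitz :: "'a::metric_space set \<Rightarrow> ('a \<Rightarrow> 'b::real_normed_vector) \<Rightarrow> bool"
  where "bounded_lipschitz S f \<longleftrightarrow> (\<exists>A. \<forall>z\<in>S. norm (f z) \<le> A) \<and> (\<exists>L. L-lipschitz_on S f)"

lemma bounded_lipschitzI:
  assumes "\<And>z. z \<in> S \<Longrightarrow> norm (f z) \<le> A"
    and L: "\<And>z w. z \<in> S \<Longrightarrow> w \<in> S \<Longrightarrow> norm (f z - f w) \<le> L * dist z w"
  shows "bounded_lipschitz S f"
proof -
  have "(max L 0)-lipschitz_on S f"
  proof (rule lipschitz_onI)
    fix z w assume zw: "z \<in> S" "w \<in> S"
    have "L * dist z w \<le> max L 0 * dist z w" by (intro mult_right_mono) auto
    with L[OF zw] show "dist (f z) (f w) \<le> max L 0 * dist z w" by (simp add: dist_norm)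
  qed simp
  then show ?thesis using assms(1) by (auto simp: bounded_lipschitz_def)
qed

lemma bounded_lipschitzE:
  assumes "bounded_lipschitz S f"
  obtains A L where "0 \<le> A" "0 \<le> L" "\<And>z. z \<in> S \<Longrightarrow> norm (f z) \<le> A"
    "\<And>z w. z \<in> S \<Longrightarrow> w \<in> S \<Longrightarrow> norm (f z - f w) \<le> L * dist z w"
proof -
  obtain A L where AL: "\<forall>z\<in>S. norm (f z) \<le> A" "L-lipschitz_on S f"
    using assms by (auto simp: bounded_lipschitz_def)
  show thesis
  proof (rule that[of "max A 0" L])
    show "0 \<le> L" by (rule lipschitz_on_nonneg[OF AL(2)])
  qed (use AL lipschitz_onD[OF AL(2)] in \<open>auto simp: dist_norm intro: order_trans\<close>)
qed

lemma bounded_lipschitz_bilinear: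
  assumes h: "bounded_bilinear h" and f: "bounded_lipschitz S f" and g: "bounded_lipschitz S g"
  shows "bounded_lipschitz S (\<lambda>z. h (f z) (g z))"
proof -
  interpret bounded_bilinear h by fact
  obtain K where K: "K > 0" "\<And>a b. norm (h a b) \<le> norm a * norm b * K" using pos_bounded by blast
  obtain A La where A: "0 \<le> A" "0 \<le> La" "\<And>z. z \<in> S \<Longrightarrow> norm (f z) \<le> A"
    "\<And>z w. z \<in> S \<Longrightarrow> w \<in> S \<Longrightarrow> norm (f z - f w) \<le> La * dist z w"
    by (rule bounded_lipschitzE[OF f]) blast
  obtain B Lb where B: "0 \<le> B" "0 \<le> Lb" "\<And>z. z \<in> S \<Longrightarrow> norm (g z) \<le> B"
    "\<And>z w. z \<in> S \<Longrightarrow> w \<in> S \<Longrightarrow> norm (g z - g w) \<le> Lb * dist z w"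
    by (rule bounded_lipschitzE[OF g]) blast
  show ?thesis
  proof (rule bounded_lipschitzI)
    show "norm (h (f z) (g z)) \<le> A * B * K" if "z \<in> S" for z
      using A(1) K(1) A(3)[OF that] B(3)[OF that]
      by (intro order_trans[OF K(2)] mult_right_mono mult_mono) auto
    show "norm (h (f z) (g z) - h (f w) (g w)) \<le> (La * B * K + A * Lb * K) * dist z w"
      if "z \<in> S" "w \<in> S" for z w
    proof -
      have "h (f z) (g z) - h (f w) (g w) = h (f z - f w) (g z) + h (f w) (g z - g w)"
        by (simp add: diff_left diff_right)
      also have "norm \<dots> \<le> norm (f z - f w) * norm (g z) * K + norm (f w) * norm (g z - g w) * K"
        by (intro order_trans[OF norm_triangle_ineq] add_mono K(2))
      also have "\<dots> \<le> (La * dist z w) * B * K + A * (Lb * dist z w) * K"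
        using A B K(1) that
        by (intro add_mono mult_right_mono mult_mono) auto
      also have "\<dots> = (La * B * K + A * Lb * K) * dist z w" by (simp add: algebra_simps)
      finally show ?thesis .
    qed
  qed
qed

lemmas bounded_lipschitz_mult = bounded_lipschitz_bilinear[OF bounded_bilinear_mult]
lemmas bounded_lipschitz_scaleR = bounded_lipschitz_bilinear[OF bounded_bilinear_scaleR]
lemmas bounded_lipschitz_inner = bounded_lipschitz_bilinear[OF bounded_bilinear_inner]

lemma bounded_lipschitz_const: "bounded_lipschitz S (\<lambda>_. a)"
  by (rule bounded_lipschitzI[of _ _ "norm a" 0]) auto

lemma bounded_lipschitz_add:
  assumes f: "bounded_lipschitz S f" and g: "bounded_lipschitz S g"
  shows "bounded_lipschitz S (\<lambda>z. f z + g z)"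
proof -
  obtain A La where A: "\<And>z. z \<in> S \<Longrightarrow> norm (f z) \<le> A"
    "\<And>z w. z \<in> S \<Longrightarrow> w \<in> S \<Longrightarrow> norm (f z - f w) \<le> La * dist z w"
    by (rule bounded_lipschitzE[OF f]) blast
  obtain B Lb where B: "\<And>z. z \<in> S \<Longrightarrow> norm (g z) \<le> B"
    "\<And>z w. z \<in> S \<Longrightarrow> w \<in> S \<Longrightarrow> norm (g z - g w) \<le> Lb * dist z w"
    by (rule bounded_lipschitzE[OF g]) blast
  show ?thesis
  proof (rule bounded_lipschitzI)
    show "norm (f z + g z) \<le> A + B" if "z \<in> S" for z
      by (rule norm_triangle_mono[OF A(1)[OF that] B(1)[OF that]])
    show "norm (f z + g z - (f w + g w)) \<le> (La + Lb) * dist z w" if "z \<in> S" "w \<in> S" for z w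
      using norm_triangle_mono[OF A(2)[OF that] B(2)[OF that]] by (simp add: algebra_simps)
  qed
qed

lemma bounded_lipschitz_diff:
  assumes "bounded_lipschitz S f" and "bounded_lipschitz S g"
  shows "bounded_lipschitz S (\<lambda>z. f z - g z)"
  using bounded_lipschitz_add[OF assms(1) bounded_lipschitz_scaleR[OF bounded_lipschitz_const[of S "-1"] assms(2)]]
  by simp

lemma bounded_lipschitz_norm:
  assumes "bounded_lipschitz S f"
  shows "bounded_lipschitz S (\<lambda>z. norm (f z))"
proof -
  obtain A L where A: "\<And>z. z \<in> S \<Longrightarrow> norm (f z) \<le> A"
    "\<And>z w. z \<in> S \<Longrightarrow> w \<in> S \<Longrightarrow> norm (f z - f w) \<le> L * dist z w"
    by (rule bounded_lipschitzE[OF assms]) blast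
  show ?thesis
    by (rule bounded_lipschitzI[of _ _ A L])
      (use A in \<open>auto intro: order_trans[OF norm_triangle_ineq3]\<close>)
qed

lemma bounded_lipschitz_inverse:
  fixes f :: "_ \<Rightarrow> real"
  assumes "bounded_lipschitz S f" and "0 < e" and e: "\<And>z. z \<in> S \<Longrightarrow> e \<le> f z"
  shows "bounded_lipschitz S (\<lambda>z. inverse (f z))"
proof -
  obtain L where "0 \<le> L" and L: "\<And>z w. z \<in> S \<Longrightarrow> w \<in> S \<Longrightarrow> norm (f z - f w) \<le> L * dist z w"
    by (rule bounded_lipschitzE[OF assms(1)]) blast
  have inv: "0 \<le> inverse (f z)" "inverse (f z) \<le> inverse e" if "z \<in> S" for z
    using e[OF that] \<open>0 < e\<close> by (auto intro: le_imp_inverse_le)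
  show ?thesis
  proof (rule bounded_lipschitzI)
    show "norm (inverse (f z)) \<le> inverse e" if "z \<in> S" for z using inv[OF that] by simp
    show "norm (inverse (f z) - inverse (f w)) \<le> (inverse e * L * inverse e) * dist z w" if "z \<in> S" "w \<in> S" for z w
    proof -
      have "inverse (f z) - inverse (f w) = - (inverse (f z) * (f z - f w) * inverse (f w))"
        using e[OF that(1)] e[OF that(2)] \<open>0 < e\<close> by (intro inverse_diff_inverse) auto
      then have "norm (inverse (f z) - inverse (f w)) = inverse (f z) * norm (f z - f w) * inverse (f w)"
        using inv(1) that by (simp add: abs_mult)
      also have "\<dots> \<le> inverse e * (L * dist z w) * inverse e"
        using \<open>0 \<le> L\<close> \<open>0 < e\<close> inv that by (intro mult_mono L mult_nonneg_nonneg) auto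
      finally show ?thesis by (simp add: mult_ac)
    qed
  qed
qed

text \<open>The \<theta>-derivative of the acceleration at one point: \<open>q\<close> and
  \<open>p\<close> stand for the \<theta>-derivatives of \<open>c\<close> and \<open>v\<close>,
  \<open>a\<close> and \<open>b\<close> for \<open>riem_G c c v\<close> and
  \<open>riem_G c v v\<close>, and \<open>m\<close> for the mean removed by the projection. It is
  spelled with \<open>inverse (norm q * norm q)\<close> so that the closure rules for
  \<open>bounded_lipschitz\<close> apply term by term.\<close>

definition acceleration_density :: "real \<Rightarrow> real \<Rightarrow> 'v::real_inner \<Rightarrow> 'v \<Rightarrow> 'v \<Rightarrow> 'v"
  where "acceleration_density a b m q p = a *\<^sub>R p - (1/2 * b) *\<^sub>R q
    + (inverse (norm q * norm q) * (q \<bullet> p)) *\<^sub>R p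
    - (1/2 * (inverse (norm q * norm q) * (p \<bullet> p))) *\<^sub>R q - norm q *\<^sub>R m"

text \<open>The coefficients \<open>a\<close>, \<open>b\<close>, \<open>m\<close> are treated as
  further variables, so that \<open>L\<close> depends on \<open>\<epsilon>\<close> and
  \<open>R\<close> only. The admissible \<open>q\<close> form a spherical shell, in general not
  convex, so a derivative bound would not directly compare two of its points; the closure rules
  do.\<close>

lemma acceleration_density_lipschitz:
  fixes R \<epsilon> :: real
  assumes "0 < \<epsilon>"
  obtains L where "0 \<le> L"
    "\<And>a b m q p q' p' :: 'v::real_inner. \<bar>a\<bar> \<le> R \<Longrightarrow> \<bar>b\<bar> \<le> R \<Longrightarrow> norm m \<le> R \<Longrightarrow>
      \<epsilon> \<le> norm q \<Longrightarrow> norm q \<le> R \<Longrightarrow> norm p \<le> R \<Longrightarrow> \<epsilon> \<le> norm q' \<Longrightarrow> norm q' \<le> R \<Longrightarrow> norm p' \<le> R \<Longrightarrow>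
      norm (acceleration_density a b m q p - acceleration_density a b m q' p')
        \<le> L * (norm (q - q') + norm (p - p'))"
proof -
  define S where "S = {(a :: real, b :: real, m :: 'v, q :: 'v, p :: 'v). \<bar>a\<bar> \<le> R \<and> \<bar>b\<bar> \<le> R \<and> norm m \<le> R \<and>
      \<epsilon> \<le> norm q \<and> norm q \<le> R \<and> norm p \<le> R}"
  let ?a = "\<lambda>z :: real \<times> real \<times> 'v \<times> 'v \<times> 'v. fst z" and ?b = "\<lambda>z :: real \<times> real \<times> 'v \<times> 'v \<times> 'v. fst (snd z)"
  let ?m = "\<lambda>z :: real \<times> real \<times> 'v \<times> 'v \<times> 'v. fst (snd (snd z))"
  let ?q = "\<lambda>z :: real \<times> real \<times> 'v \<times> 'v \<times> 'v. fst (snd (snd (snd z)))"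
  let ?p = "\<lambda>z :: real \<times> real \<times> 'v \<times> 'v \<times> 'v. snd (snd (snd (snd z)))"
  have proj: "bounded_lipschitz S f"
    if "\<And>z. z \<in> S \<Longrightarrow> norm (f z) \<le> R" "\<And>z w. dist (f z) (f w) \<le> dist z w"
    for f :: "_ \<Rightarrow> 'x::real_normed_vector"
    using that by (intro bounded_lipschitzI[of _ _ R 1]) (auto simp: dist_norm)
  note le = dist_fst_le order_trans[OF dist_fst_le dist_snd_le]
    order_trans[OF dist_fst_le order_trans[OF dist_snd_le dist_snd_le]]
    order_trans[OF dist_fst_le order_trans[OF dist_snd_le order_trans[OF dist_snd_le dist_snd_le]]]
    order_trans[OF dist_snd_le order_trans[OF dist_snd_le order_trans[OF dist_snd_le dist_snd_le]]]
  have "bounded_lipschitz S ?a" "bounded_lipschitz S ?b" "bounded_lipschitz S ?m"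
    and q: "bounded_lipschitz S ?q" and "bounded_lipschitz S ?p"
    by (rule proj; (rule le)?; force simp: S_def)+
  moreover have "bounded_lipschitz S (\<lambda>z. inverse (norm (?q z) * norm (?q z)))"
    by (rule bounded_lipschitz_inverse[of _ _ "\<epsilon> * \<epsilon>"])
      (use \<open>0 < \<epsilon>\<close> q in \<open>auto simp: S_def intro!: bounded_lipschitz_mult bounded_lipschitz_norm mult_mono\<close>)
  ultimately have "bounded_lipschitz S (\<lambda>z. acceleration_density (?a z) (?b z) (?m z) (?q z) (?p z))"
    unfolding acceleration_density_def
    by (intro bounded_lipschitz_diff bounded_lipschitz_add bounded_lipschitz_scaleR bounded_lipschitz_mult
        bounded_lipschitz_inner bounded_lipschitz_norm bounded_lipschitz_const)
  then obtain L where L: "0 \<le> L" "\<And>z w. z \<in> S \<Longrightarrow> w \<in> S \<Longrightarrow>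
      norm (acceleration_density (?a z) (?b z) (?m z) (?q z) (?p z)
        - acceleration_density (?a w) (?b w) (?m w) (?q w) (?p w)) \<le> L * dist z w"
    by (rule bounded_lipschitzE) blast
  show thesis
  proof (rule that[OF L(1)])
    fix a b :: real and m q p q' p' :: 'v
    assume *: "\<bar>a\<bar> \<le> R" "\<bar>b\<bar> \<le> R" "norm m \<le> R" "\<epsilon> \<le> norm q" "norm q \<le> R" "norm p \<le> R"
      "\<epsilon> \<le> norm q'" "norm q' \<le> R" "norm p' \<le> R"
    have "dist (a, b, m, q, p) (a, b, m, q', p') = sqrt ((norm (q - q'))\<^sup>2 + (norm (p - p'))\<^sup>2)"
      by (simp add: dist_prod_def dist_norm)
    also have "\<dots> \<le> norm (q - q') + norm (p - p')"
      using sqrt_sum_squares_le_sum_abs[of "norm (q - q')" "norm (p - p')"] by simp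
    finally show "norm (acceleration_density a b m q p - acceleration_density a b m q' p')
        \<le> L * (norm (q - q') + norm (p - p'))"
      using L(2)[of "(a, b, m, q, p)" "(a, b, m, q', p')"] * L(1)
      by (auto simp: S_def intro: order_trans mult_left_mono)
  qed
qed

section \<open>Bounds for the metric and for the coefficients of the acceleration\<close>

lemma Ds_in_Linf:
  assumes "c \<in> immersions" shows "Ds c h \<in> Linf"
proof -
  obtain \<epsilon> where "\<epsilon> > 0" and \<epsilon>: "AE \<theta> in circle. \<epsilon> \<le> norm (D\<theta> (fn c) \<theta>)"
    using assms unfolding immersions_iff by blast
  have "(\<lambda>\<theta>. inverse (norm (D\<theta> (fn c) \<theta>))) \<in> Linf"
  proof (rule Linf_boundI)
    show "AE \<theta> in circle. norm (inverse (norm (D\<theta> (fn c) \<theta>))) \<le> inverse \<epsilon>"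
      using \<epsilon> by eventually_elim (use \<open>\<epsilon> > 0\<close> in \<open>simp add: le_imp_inverse_le\<close>)
  qed measurable
  then show ?thesis unfolding Ds_def[abs_def] by (intro Linf_scaleR_fun Linf_D\<theta>_fn)
qed

text \<open>\<open>riem_G\<close> is an average over \<open>ds c\<close>: the total mass
  \<open>len c\<close> cancels the normalising factor, and pointwise bounds pass through.\<close>

lemma abs_riem_G_le:
  assumes "c \<in> immersions" and "AE \<theta> in circle. norm (Ds c h \<theta>) \<le> A" "AE \<theta> in circle. norm (Ds c k \<theta>) \<le> B"
  shows "\<bar>riem_G c h k\<bar> \<le> A * B"
proof -
  have "AE \<theta> in circle. norm (Ds c h \<theta> \<bullet> Ds c k \<theta>) \<le> A * B"
    using assms(2,3)
  proof eventually_elim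
    case (elim \<theta>)
    then have "0 \<le> A" using norm_ge_zero order_trans by blast
    have "norm (Ds c h \<theta> \<bullet> Ds c k \<theta>) \<le> norm (Ds c h \<theta>) * norm (Ds c k \<theta>)" by (simp add: Cauchy_Schwarz_ineq2)
    also have "\<dots> \<le> A * B" using elim \<open>0 \<le> A\<close> by (simp add: mult_mono)
    finally show ?case .
  qed
  moreover have "(\<lambda>\<theta>. Ds c h \<theta> \<bullet> Ds c k \<theta>) \<in> borel_measurable circle"
    using Linf_inner[OF Ds_in_Linf Ds_in_Linf, OF assms(1,1)] by (auto simp: Linf_def)
  ultimately have "norm (\<integral>\<theta>. Ds c h \<theta> \<bullet> Ds c k \<theta> \<partial>ds c) \<le> A * B * len c"
    by (intro norm_integral_ds_le)
  then show ?thesis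
    using len_pos[OF assms(1)] by (simp add: riem_G_def abs_mult divide_le_eq)
qed

text \<open>The unit tangent \<open>Ds c c\<close> has norm one and \<open>Ds c v\<close> has norm
  at most \<open>C / \<epsilon>\<close>; Cauchy-Schwarz then bounds the two values of
  \<open>riem_G\<close> taken for \<open>a\<close> and \<open>b\<close>. The vector \<open>m\<close>
  is the \<open>ds_mean\<close> of the argument of \<open>proj0\<close>, a difference of two terms
  each at most \<open>(C / \<epsilon>)\<^sup>2\<close>, whence the factor 2.\<close>

lemma D\<theta>_acceleration:
  fixes c v :: "('d::finite) W10"
  assumes "0 < \<epsilon>" and \<epsilon>: "AE \<theta> in circle. \<epsilon> \<le> norm (D\<theta> (fn c) \<theta>)" and v: "norm v \<le> C"
  obtains a b m where "\<bar>a\<bar> \<le> C / \<epsilon>" "\<bar>b\<bar> \<le> (C / \<epsilon>)\<^sup>2" "norm m \<le> 2 * (C / \<epsilon>)\<^sup>2"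
    "AE \<theta> in circle. D\<theta> (fn (acceleration c v)) \<theta> = acceleration_density a b m (D\<theta> (fn c) \<theta>) (D\<theta> (fn v) \<theta>)"
proof -
  have c: "c \<in> immersions" unfolding immersions_iff using assms by blast
  have "0 \<le> C" using v norm_ge_zero order_trans by blast
  define R where "R = C / \<epsilon>"
  have R0: "0 \<le> R" using \<open>0 \<le> C\<close> \<open>0 < \<epsilon>\<close> by (simp add: R_def)
  have Dc: "AE \<theta> in circle. norm (Ds c c \<theta>) \<le> 1"
    using \<epsilon>
  proof eventually_elim
    case (elim \<theta>)
    then have "norm (D\<theta> (fn c) \<theta>) \<noteq> 0" using \<open>0 < \<epsilon>\<close> by linarith
    then show ?case by (simp add: Ds_def)
  qed
  have Dv: "AE \<theta> in circle. norm (Ds c v \<theta>) \<le> R"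
    using \<epsilon> AE_norm_D\<theta>_le[of v]
  proof eventually_elim
    case (elim \<theta>)
    have "norm (D\<theta> (fn v) \<theta>) / norm (D\<theta> (fn c) \<theta>) \<le> C / \<epsilon>"
      using elim v \<open>0 < \<epsilon>\<close> \<open>0 \<le> C\<close> by (intro frac_le) auto
    then show ?case by (simp add: Ds_def R_def divide_inverse mult.commute)
  qed
  define K where "K \<theta> = (Ds c c \<theta> \<bullet> Ds c v \<theta>) *\<^sub>R Ds c v \<theta>
                          - (1/2 * (norm (Ds c v \<theta>))\<^sup>2) *\<^sub>R Ds c c \<theta>" for \<theta>
  have KL: "K \<in> Linf"
    unfolding K_def[abs_def] power2_norm_eq_inner real_scaleR_def[symmetric]
    by (intro Linf_diff Linf_scaleR_fun Linf_inner Linf_const Ds_in_Linf c)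
  have "AE \<theta> in circle. norm (K \<theta>) \<le> 2 * R\<^sup>2"
    using Dc Dv
  proof eventually_elim
    case (elim \<theta>)
    have "\<bar>Ds c c \<theta> \<bullet> Ds c v \<theta>\<bar> \<le> norm (Ds c c \<theta>) * norm (Ds c v \<theta>)" by (rule Cauchy_Schwarz_ineq2)
    also have "\<dots> \<le> 1 * R" using elim by (intro mult_mono) auto
    finally have "\<bar>Ds c c \<theta> \<bullet> Ds c v \<theta>\<bar> * norm (Ds c v \<theta>) \<le> R * R"
      using elim R0 by (intro mult_mono) auto
    moreover have "1/2 * (norm (Ds c v \<theta>))\<^sup>2 * norm (Ds c c \<theta>) \<le> (1 * R\<^sup>2) * 1"
      using elim R0 by (intro mult_mono power_mono) auto
    ultimately show ?case
      unfolding K_def by (intro order_trans[OF norm_triangle_ineq4]) (auto simp: power2_eq_square)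
  qed
  then have "norm (\<integral>\<theta>. K \<theta> \<partial>ds c) \<le> 2 * R\<^sup>2 * len c"
    using KL by (intro norm_integral_ds_le) (auto simp: Linf_def)
  then have m: "norm (ds_mean c K) \<le> 2 * R\<^sup>2"
    using len_pos[OF c] by (simp add: ds_mean_def divide_le_eq)
  have acc: "acceleration c v = (riem_G c c v *\<^sub>R v - (1/2 * riem_G c v v) *\<^sub>R c) + Ds_inv c (proj0 c K)"
    unfolding acceleration_def K_def[abs_def] ..
  have "AE \<theta> in circle. D\<theta> (fn (acceleration c v)) \<theta> =
      acceleration_density (riem_G c c v) (riem_G c v v) (ds_mean c K) (D\<theta> (fn c) \<theta>) (D\<theta> (fn v) \<theta>)"
    using \<epsilon> D\<theta>_Ds_inv_proj0[OF c KL] W1inf_differentiable_AE[OF fn_W1inf[of c]]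
      W1inf_differentiable_AE[OF fn_W1inf[of v]] W1inf_differentiable_AE[OF fn_W1inf[of "Ds_inv c (proj0 c K)"]]
  proof eventually_elim
    case (elim \<theta>)
    define q p where "q = D\<theta> (fn c) \<theta>" and "p = D\<theta> (fn v) \<theta>"
    have q: "norm q \<noteq> 0" using elim(1) \<open>0 < \<epsilon>\<close> by (auto simp: q_def)
    have "D\<theta> (fn (acceleration c v)) \<theta>
      = riem_G c c v *\<^sub>R p - (1/2 * riem_G c v v) *\<^sub>R q + norm q *\<^sub>R (K \<theta> - ds_mean c K)"
      using elim(3-5) unfolding elim(2)[folded q_def, symmetric]
      by (simp add: acc D\<theta>_def plus_W10.rep_eq minus_W10.rep_eq scaleR_W10.rep_eq q_def p_def)
    moreover have "norm q *\<^sub>R K \<theta> = (inverse (norm q * norm q) * (q \<bullet> p)) *\<^sub>R p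
        - (1/2 * (inverse (norm q * norm q) * (p \<bullet> p))) *\<^sub>R q"
      using q by (simp add: K_def Ds_def q_def[symmetric] p_def[symmetric] scaleR_diff_right
          power_mult_distrib dot_square_norm power2_eq_square field_simps)
    ultimately show ?case
      by (simp add: acceleration_density_def q_def[symmetric] p_def[symmetric] scaleR_diff_right)
  qed
  moreover have "\<bar>riem_G c c v\<bar> \<le> R" "\<bar>riem_G c v v\<bar> \<le> R\<^sup>2"
    using abs_riem_G_le[OF c Dc Dv] abs_riem_G_le[OF c Dv Dv] by (simp_all add: power2_eq_square)
  ultimately show thesis using m that unfolding R_def by blast
qed

subsection \<open>Piecewise linear immersions are totally geodesic\<close>

definition slope :: "('d::finite) W10 \<Rightarrow> real \<Rightarrow> real \<Rightarrow> real ^ 'd"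
  where "slope h x y = (1 / (y - x)) *\<^sub>R (fn h y - fn h x)"

text \<open>The slope of the whole grid interval serves as a common reference, so that one pair
  \<open>x\<close>, \<open>y\<close> remains as parameter; any two subintervals are then compared at
  the cost of a factor 2.\<close>

definition slope_defect :: "nat \<Rightarrow> nat \<Rightarrow> real \<Rightarrow> real \<Rightarrow> ('d::finite) W10 \<Rightarrow> real ^ 'd"
  where "slope_defect n i x y h = slope h x y - slope h (grid n i) (grid n (Suc i))"

text \<open>A slope is the average of the derivative over its interval, so an almost everywhere
  bound passes to it.\<close>

lemma norm_slope_diff_le:
  assumes "0 \<le> x" "x < y" "y \<le> 2*pi"
    and "AE \<theta> in circle. \<theta> \<in> {x<..<y} \<longrightarrow> norm (D\<theta> (fn h) \<theta> - z) \<le> B"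
  shows "norm (slope h x y - z) \<le> B"
proof -
  have "slope h x y - z = (1 / (y - x)) *\<^sub>R (fn h y - fn h x - (y - x) *\<^sub>R z)"
    using assms(2) by (simp add: slope_def scaleR_diff_right)
  then have "norm (slope h x y - z) = norm (fn h y - fn h x - (y - x) *\<^sub>R z) / (y - x)"
    using assms(2) by simp
  then show ?thesis
    using W10_increment_bound[of x y h z B] assms by (simp add: divide_le_eq mult.commute)
qed

lemma norm_slope_le:
  assumes "0 \<le> x" "x < y" "y \<le> 2*pi" shows "norm (slope h x y) \<le> norm h"
proof -
  have "AE \<theta> in circle. \<theta> \<in> {x<..<y} \<longrightarrow> norm (D\<theta> (fn h) \<theta> - 0) \<le> norm h"
    using AE_norm_D\<theta>_le[of h] by eventually_elim simp
  then show ?thesis using norm_slope_diff_le[OF assms, of h 0] by simp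
qed

lemma bounded_linear_slope:
  assumes "0 \<le> x" "x < y" "y \<le> 2*pi"
  shows "bounded_linear (\<lambda>h. slope h x y)"
proof (rule bounded_linear_intro[of _ 1])
  show "norm (slope h x y) \<le> norm h * 1" for h :: "'a W10" using norm_slope_le[OF assms] by simp
qed (simp_all add: slope_def plus_W10.rep_eq scaleR_W10.rep_eq algebra_simps)

lemma grid_bounds:
  assumes "i < n" shows "0 \<le> grid n i" "grid n i < grid n (Suc i)" "grid n (Suc i) \<le> 2*pi"
proof -
  have "real (Suc i) \<le> real n" using assms by linarith
  then have "2*pi * real (Suc i) \<le> 2*pi * real n" by (intro mult_left_mono) auto
  then show "grid n (Suc i) \<le> 2*pi" using assms by (simp add: grid_def divide_le_eq)
  show "0 \<le> grid n i" "grid n i < grid n (Suc i)"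
    using assms by (auto simp: grid_def intro!: divide_strict_right_mono)
qed

lemma bounded_linear_slope_defect:
  assumes "i < n" "grid n i \<le> x" "x < y" "y \<le> grid n (Suc i)"
  shows "bounded_linear (slope_defect n i x y)"
  unfolding slope_defect_def[abs_def]
  by (rule bounded_linear_sub; rule bounded_linear_slope) (use assms grid_bounds[OF assms(1)] in auto)

lemma norm_slope_defect_le:
  assumes "i < n" "grid n i \<le> x" "x < y" "y \<le> grid n (Suc i)"
  shows "norm (slope_defect n i x y h) \<le> 2 * norm h"
proof -
  have "norm (slope h x y) \<le> norm h" "norm (slope h (grid n i) (grid n (Suc i))) \<le> norm h"
    using assms grid_bounds[OF assms(1)] by (auto intro!: norm_slope_le)
  then show ?thesis
    unfolding slope_defect_def using norm_triangle_ineq4[of "slope h x y" "slope h (grid n i) (grid n (Suc i))"]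
    by linarith
qed

lemma PL_iff_slope_defect:
  "fn h \<in> PL n \<longleftrightarrow> (\<forall>i<n. \<forall>x y. grid n i \<le> x \<and> x < y \<and> y \<le> grid n (Suc i) \<longrightarrow> slope_defect n i x y h = 0)"
proof
  assume PL: "fn h \<in> PL n"
  show "\<forall>i<n. \<forall>x y. grid n i \<le> x \<and> x < y \<and> y \<le> grid n (Suc i) \<longrightarrow> slope_defect n i x y h = 0"
  proof (intro allI impI)
    fix i x y assume i: "i < n" and xy: "grid n i \<le> x \<and> x < y \<and> y \<le> grid n (Suc i)"
    obtain a b where ab: "\<And>\<theta>. \<theta> \<in> {grid n i..grid n (Suc i)} \<Longrightarrow> fn h \<theta> = a + \<theta> *\<^sub>R b"
      using PL i by (auto simp: PL_def)
    have "slope h x' y' = b" if "grid n i \<le> x'" "x' < y'" "y' \<le> grid n (Suc i)" for x' y'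
    proof -
      have "fn h y' - fn h x' = (y' - x') *\<^sub>R b"
        using ab[of x'] ab[of y'] that by (simp add: scaleR_diff_left)
      then show ?thesis using that by (simp add: slope_def)
    qed
    then show "slope_defect n i x y h = 0"
      using xy grid_bounds[OF i] by (simp add: slope_defect_def)
  qed
next
  assume *: "\<forall>i<n. \<forall>x y. grid n i \<le> x \<and> x < y \<and> y \<le> grid n (Suc i) \<longrightarrow> slope_defect n i x y h = 0"
  have "\<exists>a b. \<forall>\<theta>\<in>{grid n i..grid n (Suc i)}. fn h \<theta> = a + \<theta> *\<^sub>R b" if i: "i < n" for i
  proof (intro exI ballI)
    let ?g = "grid n i" and ?b = "slope h (grid n i) (grid n (Suc i))"
    fix \<theta> assume \<theta>: "\<theta> \<in> {?g..grid n (Suc i)}"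
    show "fn h \<theta> = (fn h ?g - ?g *\<^sub>R ?b) + \<theta> *\<^sub>R ?b"
    proof (cases "\<theta> = ?g")
      case False
      then have eq: "slope h ?g \<theta> = ?b"
        using *[rule_format, OF i, of ?g \<theta>] \<theta> by (simp add: slope_defect_def)
      have "(\<theta> - ?g) *\<^sub>R slope h ?g \<theta> = fn h \<theta> - fn h ?g"
        using False by (simp add: slope_def)
      then have "(\<theta> - ?g) *\<^sub>R ?b = fn h \<theta> - fn h ?g" unfolding eq .
      then show ?thesis by (simp add: algebra_simps)
    qed simp
  qed
  then show "fn h \<in> PL n" by (simp add: PL_def fn_W1inf)
qed

text \<open>The passage back from slopes to the derivative: at a point of differentiability the
  right difference quotients are slopes of subintervals of the grid interval once \<open>t\<close>
  is small, and the bound survives the limit.\<close>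

lemma AE_norm_D\<theta>_slope_le:
  assumes "i < n"
    and B: "\<And>x y. grid n i \<le> x \<Longrightarrow> x < y \<Longrightarrow> y \<le> grid n (Suc i) \<Longrightarrow> norm (slope_defect n i x y h) \<le> B"
  shows "AE \<theta> in circle. \<theta> \<in> {grid n i<..<grid n (Suc i)} \<longrightarrow>
    norm (D\<theta> (fn h) \<theta> - slope h (grid n i) (grid n (Suc i))) \<le> B"
  using W1inf_differentiable_AE[OF fn_W1inf[of h]]
proof eventually_elim
  case (elim \<theta>)
  show ?case
  proof
    assume \<theta>: "\<theta> \<in> {grid n i<..<grid n (Suc i)}"
    let ?s = "slope h (grid n i) (grid n (Suc i))"
    have "(fn h has_vector_derivative D\<theta> (fn h) \<theta>) (at \<theta>)"
      using elim vector_derivative_works[of "fn h" "at \<theta>"] by (simp add: D\<theta>_def)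
    from vector_derivative_quotient[OF this]
    have "((\<lambda>t. (1/t) *\<^sub>R (fn h (\<theta> + t) - fn h \<theta>)) \<longlongrightarrow> D\<theta> (fn h) \<theta>) (at_right 0)"
      by (rule tendsto_mono[rotated]) (simp add: at_le)
    then have lim: "((\<lambda>t. norm ((1/t) *\<^sub>R (fn h (\<theta> + t) - fn h \<theta>) - ?s)) \<longlongrightarrow> norm (D\<theta> (fn h) \<theta> - ?s)) (at_right 0)"
      by (intro tendsto_norm tendsto_diff tendsto_const)
    show "norm (D\<theta> (fn h) \<theta> - ?s) \<le> B"
    proof (rule tendsto_upperbound[OF lim])
      have "eventually (\<lambda>t. t \<in> {0<..<grid n (Suc i) - \<theta>}) (at_right 0)"
        using \<theta> by (intro eventually_at_right_real) auto
      then show "eventually (\<lambda>t. norm ((1/t) *\<^sub>R (fn h (\<theta> + t) - fn h \<theta>) - ?s) \<le> B) (at_right 0)"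
      proof eventually_elim
        case (elim t)
        then show ?case using B[of \<theta> "\<theta> + t"] \<theta> by (simp add: slope_defect_def slope_def)
      qed
    qed simp
  qed
qed

lemma AE_circle_interval_witness:
  assumes "AE \<theta> in circle. \<theta> \<in> {a<..<b} \<longrightarrow> P \<theta>" "0 \<le> a" "a < b" "b \<le> 2*pi"
  obtains \<theta> where "\<theta> \<in> {a<..<b}" "P \<theta>"
proof -
  have "AE \<theta> in lebesgue. \<theta> \<in> {a<..<b} \<longrightarrow> P \<theta>"
    using assms(1) unfolding AE_circle_iff by eventually_elim (use assms(2-4) in auto)
  then have N: "negligible {\<theta>. \<not> (\<theta> \<in> {a<..<b} \<longrightarrow> P \<theta>)}" by (simp only: AE_lebesgue_negligible)
  have "\<not> negligible {a<..<b}" using assms(3) by (intro open_not_negligible) auto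
  with negligible_subset[OF N] have "\<not> {a<..<b} \<subseteq> {\<theta>. \<not> (\<theta> \<in> {a<..<b} \<longrightarrow> P \<theta>)}" by metis
  then show thesis using that by blast
qed

text \<open>The \<open>\<theta>\<close>-derivative of the acceleration at \<open>\<theta>\<close> is a Lipschitz function of \<open>c\<^sub>\<theta>(\<theta>)\<close>, \<open>v\<^sub>\<theta>(\<theta>)\<close>
  whose coefficients do not depend on \<open>\<theta>\<close>; hence it oscillates on a grid interval at most
  proportionally to \<open>c\<^sub>\<theta>\<close> and \<open>v\<^sub>\<theta>\<close>.\<close>

lemma slope_defect_acceleration_le:
  fixes \<epsilon> C :: real
  assumes "0 < \<epsilon>"
  obtains L where "0 \<le> L"
    "\<And>n i B x y (c :: ('d::finite) W10) v. i < n \<Longrightarrow> AE \<theta> in circle. \<epsilon> \<le> norm (D\<theta> (fn c) \<theta>) \<Longrightarrow>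
      norm c \<le> C \<Longrightarrow> norm v \<le> C \<Longrightarrow>
      (\<And>x y. grid n i \<le> x \<Longrightarrow> x < y \<Longrightarrow> y \<le> grid n (Suc i) \<Longrightarrow>
        norm (slope_defect n i x y c) \<le> B \<and> norm (slope_defect n i x y v) \<le> B) \<Longrightarrow>
      grid n i \<le> x \<Longrightarrow> x < y \<Longrightarrow> y \<le> grid n (Suc i) \<Longrightarrow>
      norm (slope_defect n i x y (acceleration c v)) \<le> L * B"
proof -
  \<comment> \<open>One radius for the derivatives of \<open>c\<close> and \<open>v\<close> and for
    all coefficients, so that the final constant depends on \<open>\<epsilon>\<close> and
    \<open>C\<close> alone.\<close>
  define R where "R = max C (max (C / \<epsilon>) (2 * (C / \<epsilon>)\<^sup>2))"
  have R: "C \<le> R" "C / \<epsilon> \<le> R" "2 * (C / \<epsilon>)\<^sup>2 \<le> R" "(C / \<epsilon>)\<^sup>2 \<le> R"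
    unfolding R_def using zero_le_power2[of "C / \<epsilon>"] by linarith+
  obtain L where "0 \<le> L" and L: "\<And>a b m q p q' p' :: real ^ 'd. \<bar>a\<bar> \<le> R \<Longrightarrow> \<bar>b\<bar> \<le> R \<Longrightarrow> norm m \<le> R \<Longrightarrow>
      \<epsilon> \<le> norm q \<Longrightarrow> norm q \<le> R \<Longrightarrow> norm p \<le> R \<Longrightarrow> \<epsilon> \<le> norm q' \<Longrightarrow> norm q' \<le> R \<Longrightarrow> norm p' \<le> R \<Longrightarrow>
      norm (acceleration_density a b m q p - acceleration_density a b m q' p')
        \<le> L * (norm (q - q') + norm (p - p'))"
    using acceleration_density_lipschitz[OF assms, of R] by metis
  show thesis
  \<comment> \<open>Derivatives within \<open>B\<close> of the reference slopes differ pairwise by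
    at most \<open>2 * B\<close>; \<open>c\<close> and \<open>v\<close> together give
    \<open>4 * B\<close>, so the derivative of the acceleration stays within
    \<open>4 * L * B\<close> of a fixed value \<open>z\<close>. The two slopes in the defect double
    this.\<close>
  proof (rule that[of "8 * L"])
    fix n i :: nat and B x y :: real and c v :: "'d W10"
    assume i: "i < n" and \<epsilon>: "AE \<theta> in circle. \<epsilon> \<le> norm (D\<theta> (fn c) \<theta>)"
      and C: "norm c \<le> C" "norm v \<le> C"
      and B: "\<And>x y. grid n i \<le> x \<Longrightarrow> x < y \<Longrightarrow> y \<le> grid n (Suc i) \<Longrightarrow>
        norm (slope_defect n i x y c) \<le> B \<and> norm (slope_defect n i x y v) \<le> B"
      and xy: "grid n i \<le> x" "x < y" "y \<le> grid n (Suc i)"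
    obtain a b m where abm: "\<bar>a\<bar> \<le> C / \<epsilon>" "\<bar>b\<bar> \<le> (C / \<epsilon>)\<^sup>2" "norm m \<le> 2 * (C / \<epsilon>)\<^sup>2"
      and acc: "AE \<theta> in circle. D\<theta> (fn (acceleration c v)) \<theta> =
        acceleration_density a b m (D\<theta> (fn c) \<theta>) (D\<theta> (fn v) \<theta>)"
      by (rule D\<theta>_acceleration[OF assms \<epsilon> C(2)]) blast
    define q p where "q = D\<theta> (fn c)" and "p = D\<theta> (fn v)"
    let ?I = "{grid n i<..<grid n (Suc i)}"
    let ?sc = "slope c (grid n i) (grid n (Suc i))" and ?sv = "slope v (grid n i) (grid n (Suc i))"
    define good where "good \<theta> \<longleftrightarrow> \<epsilon> \<le> norm (q \<theta>) \<and> norm (q \<theta>) \<le> R \<and> norm (p \<theta>) \<le> R \<and>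
      norm (q \<theta> - ?sc) \<le> B \<and> norm (p \<theta> - ?sv) \<le> B \<and>
      D\<theta> (fn (acceleration c v)) \<theta> = acceleration_density a b m (q \<theta>) (p \<theta>)" for \<theta>
    have "AE \<theta> in circle. \<theta> \<in> ?I \<longrightarrow> norm (D\<theta> (fn c) \<theta> - ?sc) \<le> B"
      "AE \<theta> in circle. \<theta> \<in> ?I \<longrightarrow> norm (D\<theta> (fn v) \<theta> - ?sv) \<le> B"
      using B by (intro AE_norm_D\<theta>_slope_le i; blast)+
    then have good: "AE \<theta> in circle. \<theta> \<in> ?I \<longrightarrow> good \<theta>"
      using acc \<epsilon> AE_norm_D\<theta>_le[of c] AE_norm_D\<theta>_le[of v]
      by eventually_elim (use C R(1) in \<open>auto simp: good_def q_def p_def\<close>)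
    \<comment> \<open>The comparison value is taken at an actual point and not at the slopes
      \<open>?sc\<close>, \<open>?sv\<close>: an average of vectors of norm at least
      \<open>\<epsilon>\<close> may be small or zero, outside the range of the Lipschitz
      estimate.\<close>
    then obtain \<theta>' where \<theta>': "\<theta>' \<in> ?I" "good \<theta>'"
      by (rule AE_circle_interval_witness) (use grid_bounds[OF i] in auto)
    define z where "z = D\<theta> (fn (acceleration c v)) \<theta>'"
    have Dz: "AE \<theta> in circle. \<theta> \<in> ?I \<longrightarrow> norm (D\<theta> (fn (acceleration c v)) \<theta> - z) \<le> 4 * L * B"
      using good
    proof eventually_elim
      case (elim \<theta>)
      show ?case
      proof
        assume "\<theta> \<in> ?I"
        then have g: "good \<theta>" using elim by blast
        have "norm (q \<theta> - q \<theta>') \<le> 2 * B" "norm (p \<theta> - p \<theta>') \<le> 2 * B"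
          using norm_triangle_ineq4[of "q \<theta> - ?sc" "q \<theta>' - ?sc"] norm_triangle_ineq4[of "p \<theta> - ?sv" "p \<theta>' - ?sv"]
            g \<theta>'(2) by (simp_all add: good_def)
        then have "L * (norm (q \<theta> - q \<theta>') + norm (p \<theta> - p \<theta>')) \<le> L * (4 * B)"
          by (intro mult_left_mono \<open>0 \<le> L\<close>) simp
        moreover have "norm (acceleration_density a b m (q \<theta>) (p \<theta>) - acceleration_density a b m (q \<theta>') (p \<theta>'))
            \<le> L * (norm (q \<theta> - q \<theta>') + norm (p \<theta> - p \<theta>'))"
          using g \<theta>'(2) abm R unfolding good_def by (intro L) (auto intro: order_trans)
        ultimately show "norm (D\<theta> (fn (acceleration c v)) \<theta> - z) \<le> 4 * L * B"
          using g \<theta>'(2) by (simp add: good_def z_def)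
      qed
    qed
    have "norm (slope (acceleration c v) x' y' - z) \<le> 4 * L * B"
      if "grid n i \<le> x'" "x' < y'" "y' \<le> grid n (Suc i)" for x' y'
    proof (rule norm_slope_diff_le)
      show "AE \<theta> in circle. \<theta> \<in> {x'<..<y'} \<longrightarrow> norm (D\<theta> (fn (acceleration c v)) \<theta> - z) \<le> 4 * L * B"
        using Dz by eventually_elim (use that in auto)
    qed (use that grid_bounds[OF i] in auto)
    from this[OF xy] this[OF order_refl grid_bounds(2)[OF i] order_refl]
    show "norm (slope_defect n i x y (acceleration c v)) \<le> 8 * L * B"
      using norm_triangle_ineq4[of "slope (acceleration c v) x y - z"
          "slope (acceleration c v) (grid n i) (grid n (Suc i)) - z"]
      by (simp add: slope_defect_def)
  qed (use \<open>0 \<le> L\<close> in simp)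
qed

section \<open>Evolution of the slope defects in time\<close>

lemma has_vector_derivative_bound:
  fixes f :: "real \<Rightarrow> 'b::real_normed_vector"
  assumes "convex K" and f: "\<And>t. t \<in> K \<Longrightarrow> (f has_vector_derivative f' t) (at t within K)"
    and B: "\<And>t. t \<in> K \<Longrightarrow> norm (f' t) \<le> B" and "s \<in> K" "t \<in> K"
  shows "norm (f t - f s) \<le> B * \<bar>t - s\<bar>"
proof -
  have "norm (f t - f s) \<le> B * norm (t - s)"
  proof (rule differentiable_bound[OF \<open>convex K\<close>])
    show "(f has_derivative (\<lambda>x. x *\<^sub>R f' t)) (at t within K)" if "t \<in> K" for t
      using f[OF that] by (simp add: has_vector_derivative_def)
    show "onorm (\<lambda>x. x *\<^sub>R f' t) \<le> B" if "t \<in> K" for t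
      using B[OF that] by (intro onorm_bound) (auto simp: mult.commute[of B] intro: mult_left_mono order_trans[OF norm_ge_zero])
  qed fact+
  then show ?thesis by simp
qed

text \<open>A continuous linear functional that vanishes along a curve near time 0 also vanishes on
  its velocity there.\<close>

lemma tangent_space_slope_defect:
  assumes "v \<in> tangent_space (PL_immersions n) p"
    and "i < n" "grid n i \<le> x" "x < y" "y \<le> grid n (Suc i)"
  shows "slope_defect n i x y v = 0"
proof -
  obtain \<gamma> where \<gamma>: "eventually (\<lambda>t. \<gamma> t \<in> PL_immersions n) (nhds 0)"
    "(\<gamma> has_vector_derivative v) (at (0::real))"
    using assms(1) by (auto simp: tangent_space_def)
  have "((\<lambda>t. slope_defect n i x y (\<gamma> t)) has_vector_derivative slope_defect n i x y v) (at 0)"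
    by (rule bounded_linear.has_vector_derivative[OF bounded_linear_slope_defect[OF assms(2-5)] \<gamma>(2)])
  moreover have ev: "eventually (\<lambda>t. slope_defect n i x y (\<gamma> t) = 0) (nhds 0)"
    using \<gamma>(1)
  proof eventually_elim
    case (elim t)
    then have "fn (\<gamma> t) \<in> PL n" by (simp add: PL_immersions_def)
    then show ?case using assms(2-5) PL_iff_slope_defect by blast
  qed
  ultimately have "((\<lambda>t. 0) has_vector_derivative slope_defect n i x y v) (at (0::real))"
    using has_vector_derivative_cong_ev[where f="\<lambda>t. slope_defect n i x y (\<gamma> t)" and g="\<lambda>t. 0" and x=0 and S=UNIV]
      eventually_nhds_x_imp_x[OF ev] by simp
  then show ?thesis
    using vector_derivative_unique_at has_vector_derivative_const by blast
qed

text \<open>A geodesic consists of immersions by definition, so only the vanishing of the slope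
  defects has to be propagated from \<open>t0\<close>.\<close>

lemma totally_geodesic_PL_immersions:
  "totally_geodesic (PL_immersions n :: ('d::finite) W10 set)"
  unfolding totally_geodesic_def
proof (intro allI impI)
  fix J :: "real set" and c v :: "real \<Rightarrow> 'd W10" and t0
  assume asm: "geodesic J c v \<and> t0 \<in> J \<and> c t0 \<in> PL_immersions n \<and> v t0 \<in> tangent_space (PL_immersions n) (c t0)"
  then have geo: "geodesic J c v" and t0: "t0 \<in> J" by auto
  have c': "(c has_vector_derivative v t) (at t within J)"
    and v': "(v has_vector_derivative acceleration (c t) (v t)) (at t within J)"
    and imm: "c t \<in> immersions" if "t \<in> J" for t
    using geo that by (auto simp: geodesic_def)
  obtain e where "0 < e" and e: "AE \<theta> in circle. e \<le> norm (D\<theta> (fn (c t0)) \<theta>)"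
    using imm[OF t0] unfolding immersions_iff by blast
  \<comment> \<open>While \<open>c t\<close> stays within \<open>\<epsilon>\<close> of
    \<open>c t0\<close>, the lower bound for the derivative stays at least
    \<open>e - \<epsilon> = \<epsilon>\<close>. The same tolerance enters \<open>C\<close>.\<close>
  define \<epsilon> where "\<epsilon> = e / 2"
  have "0 < \<epsilon>" using \<open>0 < e\<close> by (simp add: \<epsilon>_def)
  define C where "C = max (norm (c t0)) (norm (v t0)) + \<epsilon>"
  obtain L where "0 \<le> L" and L: "\<And>n i B x y (c :: 'd W10) v. i < n \<Longrightarrow> AE \<theta> in circle. \<epsilon> \<le> norm (D\<theta> (fn c) \<theta>) \<Longrightarrow>
      norm c \<le> C \<Longrightarrow> norm v \<le> C \<Longrightarrow>
      (\<And>x y. grid n i \<le> x \<Longrightarrow> x < y \<Longrightarrow> y \<le> grid n (Suc i) \<Longrightarrow>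
        norm (slope_defect n i x y c) \<le> B \<and> norm (slope_defect n i x y v) \<le> B) \<Longrightarrow>
      grid n i \<le> x \<Longrightarrow> x < y \<Longrightarrow> y \<le> grid n (Suc i) \<Longrightarrow>
      norm (slope_defect n i x y (acceleration c v)) \<le> L * B"
    by (rule slope_defect_acceleration_le[OF \<open>0 < \<epsilon>\<close>, of C]) blast
  have "continuous (at t0 within J) c" "continuous (at t0 within J) v"
    using c'[OF t0] v'[OF t0] has_vector_derivative_continuous by blast+
  then obtain d1 d2 where d: "0 < d1" "0 < d2"
    "\<And>t. t \<in> J \<Longrightarrow> \<bar>t - t0\<bar> < d1 \<Longrightarrow> norm (c t - c t0) < \<epsilon>"
    "\<And>t. t \<in> J \<Longrightarrow> \<bar>t - t0\<bar> < d2 \<Longrightarrow> norm (v t - v t0) < \<epsilon>"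
    unfolding continuous_within_eps_delta using \<open>0 < \<epsilon>\<close> by (metis dist_norm real_norm_def)
  \<comment> \<open>The last entry makes \<open>max 1 L * \<bar>t - t0\<bar>\<close> at most 1/2,
    the factor gained in each round. The 1 in the maximum serves \<open>c\<close>, whose defect has
    time derivative at most \<open>B\<close>; for \<open>v\<close> the bound is
    \<open>L * B\<close>.\<close>
  define d where "d = min (min d1 d2) (1 / (2 * max 1 L))"
  have "0 < d" using d(1,2) by (simp add: d_def)
  \<comment> \<open>An interval, hence convex, so the mean value inequality starting at
    \<open>t0\<close> applies even if \<open>t0\<close> is an endpoint of \<open>J\<close>.\<close>
  define K where "K = J \<inter> ball t0 d"
  have KJ: "t \<in> J" "\<bar>t - t0\<bar> < d1" "\<bar>t - t0\<bar> < d2" "\<bar>t - t0\<bar> \<le> 1 / (2 * max 1 L)" if "t \<in> K" for t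
    using that by (auto simp: K_def d_def dist_real_def abs_minus_commute)
  have "convex K"
    unfolding K_def using geo by (intro convex_Int convex_ball) (simp add: geodesic_def is_interval_convex_1)
  have "t0 \<in> K" using t0 \<open>0 < d\<close> by (simp add: K_def)
  have bnd: "norm (c t) \<le> C" "norm (v t) \<le> C" if "t \<in> K" for t
    using d(3)[of t] d(4)[of t] KJ[OF that] norm_triangle_sub[of "c t" "c t0"] norm_triangle_sub[of "v t" "v t0"]
    by (auto simp: C_def)
  have lower: "AE \<theta> in circle. \<epsilon> \<le> norm (D\<theta> (fn (c t)) \<theta>)" if "t \<in> K" for t
    using AE_norm_D\<theta>_perturb[OF e, of "c t"]
    by eventually_elim (use d(3)[of t] KJ[OF that] in \<open>simp add: \<epsilon>_def\<close>)
  have zero: "slope_defect n i x y (c t0) = 0" "slope_defect n i x y (v t0) = 0"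
    if "i < n" "grid n i \<le> x" "x < y" "y \<le> grid n (Suc i)" for i x y
    using asm that PL_iff_slope_defect[of "c t0" n] tangent_space_slope_defect[of "v t0" n "c t0" i x y]
    by (auto simp: PL_immersions_def)
  \<comment> \<open>By the mean value theorem on \<open>K\<close>, any common bound for the defects of \<open>c\<close> and \<open>v\<close> can be halved.\<close>
  have small: "\<forall>t\<in>K. norm (slope_defect n i x y (c t)) \<le> 2 * C / 2 ^ k \<and> norm (slope_defect n i x y (v t)) \<le> 2 * C / 2 ^ k"
    if "i < n" "grid n i \<le> x" "x < y" "y \<le> grid n (Suc i)" for i x y k
    using that(2-)
  \<comment> \<open>The points \<open>x\<close>, \<open>y\<close> are generalised because the
    acceleration estimate for one pair uses the induction hypothesis on every subinterval of the
    grid interval.\<close>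
  proof (induction k arbitrary: x y)
    case 0
    have "norm (slope_defect n i x y h) \<le> 2 * C" if "norm h \<le> C" for h :: "'d W10"
      using norm_slope_defect_le[OF \<open>i < n\<close> 0, of h] that by simp
    then show ?case using bnd by simp
  next
    case (Suc k)
    define B where "B = 2 * C / 2 ^ k"
    have "0 \<le> B" using bnd(1)[OF \<open>t0 \<in> K\<close>] norm_ge_zero[of "c t0"] unfolding B_def
      by (intro divide_nonneg_nonneg) (linarith, simp)
    note bl = bounded_linear_slope_defect[OF \<open>i < n\<close> Suc.prems]
    have der: "((\<lambda>t. slope_defect n i x y (c t)) has_vector_derivative slope_defect n i x y (v t)) (at t within K)"
      "((\<lambda>t. slope_defect n i x y (v t)) has_vector_derivative slope_defect n i x y (acceleration (c t) (v t))) (at t within K)"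
      if "t \<in> K" for t
      using c'[OF KJ(1)[OF that]] v'[OF KJ(1)[OF that]]
      by (auto intro!: bounded_linear.has_vector_derivative[OF bl] simp: K_def
          elim: has_vector_derivative_within_subset)
    have half: "norm w \<le> 2 * C / 2 ^ Suc k" if "norm w \<le> D * \<bar>t - t0\<bar>" "D \<le> max 1 L * B" "t \<in> K"
      for w :: "real ^ 'd" and D t
    proof -
      have "D * \<bar>t - t0\<bar> \<le> (max 1 L * B) * \<bar>t - t0\<bar>" using that(2) by (intro mult_right_mono) auto
      also have "\<dots> \<le> (max 1 L * B) * (1 / (2 * max 1 L))"
        using KJ(4)[OF that(3)] \<open>0 \<le> B\<close> by (intro mult_left_mono) auto
      also have "\<dots> = 2 * C / 2 ^ Suc k" by (simp add: B_def)
      finally show ?thesis using that(1) by linarith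
    qed
    show ?case
    proof
      fix t assume t: "t \<in> K"
      have "norm (slope_defect n i x y (c t) - slope_defect n i x y (c t0)) \<le> B * \<bar>t - t0\<bar>"
        by (rule has_vector_derivative_bound[OF \<open>convex K\<close> der(1) _ \<open>t0 \<in> K\<close> t])
          (use Suc.IH[OF Suc.prems] in \<open>auto simp: B_def\<close>)
      then have 1: "norm (slope_defect n i x y (c t)) \<le> B * \<bar>t - t0\<bar>"
        using zero[OF \<open>i < n\<close> Suc.prems] by simp
      have "norm (slope_defect n i x y (v t) - slope_defect n i x y (v t0)) \<le> (L * B) * \<bar>t - t0\<bar>"
      proof (rule has_vector_derivative_bound[OF \<open>convex K\<close> der(2) _ \<open>t0 \<in> K\<close> t])
        fix s assume "s \<in> K"
        then show "norm (slope_defect n i x y (acceleration (c s) (v s))) \<le> L * B"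
          using Suc.IH by (intro L \<open>i < n\<close> lower bnd Suc.prems) (auto simp: B_def)
      qed
      then have 2: "norm (slope_defect n i x y (v t)) \<le> (L * B) * \<bar>t - t0\<bar>"
        using zero[OF \<open>i < n\<close> Suc.prems] by simp
      have "B \<le> max 1 L * B" "L * B \<le> max 1 L * B"
        using \<open>0 \<le> B\<close> mult_right_mono[of 1 "max 1 L" B] mult_right_mono[of L "max 1 L" B] by simp_all
      then show "norm (slope_defect n i x y (c t)) \<le> 2 * C / 2 ^ Suc k \<and>
          norm (slope_defect n i x y (v t)) \<le> 2 * C / 2 ^ Suc k"
        by (intro conjI half[OF 1 _ t] half[OF 2 _ t])
    qed
  qed
  have "c t \<in> PL_immersions n" if "t \<in> K" for t
  proof -
    have "slope_defect n i x y (c t) = 0" if i: "i < n" "grid n i \<le> x" "x < y" "y \<le> grid n (Suc i)" for i x y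
    proof -
      have "(\<lambda>k. 2 * C * (1/2) ^ k) \<longlonglongrightarrow> 2 * C * 0"
        by (intro tendsto_intros LIMSEQ_power_zero) auto
      moreover have "norm (slope_defect n i x y (c t)) \<le> 2 * C * (1/2) ^ k" for k
        using small[OF i, of k] \<open>t \<in> K\<close> by (simp add: power_divide)
      ultimately have "norm (slope_defect n i x y (c t)) \<le> 2 * C * 0"
        by (intro LIMSEQ_le_const) auto
      then show ?thesis by simp
    qed
    then have "fn (c t) \<in> PL n" unfolding PL_iff_slope_defect by blast
    then show ?thesis using imm[OF KJ(1)[OF that]] by (simp add: PL_immersions_def)
  qed
  then show "\<exists>e>0. \<forall>t\<in>J. \<bar>t - t0\<bar> < e \<longrightarrow> c t \<in> PL_immersions n"
    using \<open>0 < d\<close> by (intro exI[of _ d]) (auto simp: K_def dist_real_def abs_minus_commute)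
qed

subsection \<open>Piecewise linear immersions form a submanifold\<close>

lemma Cinf_on_id: "Cinf_on U (\<lambda>x. x)"
  unfolding Cinf_on_def
proof (intro exI ballI)
  define D :: "'a \<Rightarrow> 'a list \<Rightarrow> 'a" where
    "D x hs = (case hs of [] \<Rightarrow> x | [h] \<Rightarrow> h | _ \<Rightarrow> 0)" for x hs
  have D: "D x [] = x" "D x [h] = h" "D x (h # h' # hs) = 0" for x h h' hs
    by (simp_all add: D_def)
  have nonneg: "0 \<le> prod_list (map norm hs)" for hs :: "'a list"
    by (induction hs) auto
  fix x
  have "linear (\<lambda>h. D x (h # hs))" for hs
    by (cases hs) (simp_all add: D linear_iff)
  moreover have "\<exists>C. \<forall>h hs. length hs = k \<longrightarrow> norm (D x (h # hs)) \<le> C * norm h * prod_list (map norm hs)" for k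
  proof (intro exI allI impI)
    fix h hs
    show "norm (D x (h # hs)) \<le> 1 * norm h * prod_list (map norm hs)"
      using nonneg[of hs] by (cases hs) (simp_all add: D)
  qed
  moreover have "\<exists>\<delta>>0. \<forall>y\<in>U. norm (y - x) < \<delta> \<longrightarrow> (\<forall>hs. length hs = k \<longrightarrow>
       norm (D y hs - D x hs - D x ((y - x) # hs)) \<le> e * norm (y - x) * prod_list (map norm hs))"
    if "e > 0" for k e
  proof (intro exI[of _ 1] conjI ballI allI impI)
    fix y hs
    have "norm (D y hs - D x hs - D x ((y - x) # hs)) = 0"
      by (cases hs; cases "tl hs") (auto simp: D D_def split: list.splits)
    also have "\<dots> \<le> e * norm (y - x) * prod_list (map norm hs)"
      using that nonneg[of hs] by simp
    finally show "norm (D y hs - D x hs - D x ((y - x) # hs)) \<le> e * norm (y - x) * prod_list (map norm hs)" .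
  qed simp
  ultimately show "D x [] = x \<and>
    (\<forall>hs. linear (\<lambda>h. D x (h # hs))) \<and>
    (\<forall>k. \<exists>C. \<forall>h hs. length hs = k \<longrightarrow>
       norm (D x (h # hs)) \<le> C * norm h * prod_list (map norm hs)) \<and>
    (\<forall>k. \<forall>e>0. \<exists>\<delta>>0. \<forall>y\<in>U. norm (y - x) < \<delta> \<longrightarrow> (\<forall>hs. length hs = k \<longrightarrow>
       norm (D y hs - D x hs - D x ((y - x) # hs)) \<le> e * norm (y - x) * prod_list (map norm hs)))"
    using D(1) by blast
qed

lemma submanifold_span_Int:
  fixes M B :: "'a::real_normed_vector set"
  assumes "open M" "finite B" "independent B" "card B = m"
  shows "submanifold M (M \<inter> span B) m"
  unfolding submanifold_def
proof (intro conjI ballI)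
  fix p assume "p \<in> M \<inter> span B"
  moreover have "homeomorphism M M (\<lambda>x. x) (\<lambda>x. x)"
    by (simp add: homeomorphism_def continuous_on_id)
  ultimately show "\<exists>U (V :: 'a set) \<phi> \<psi> B'. open U \<and> p \<in> U \<and> U \<subseteq> M \<and> open V \<and> homeomorphism U V \<phi> \<psi> \<and>
      Cinf_on U \<phi> \<and> Cinf_on V \<psi> \<and> finite B' \<and> independent B' \<and> card B' = m \<and> \<phi> ` (U \<inter> (M \<inter> span B)) = V \<inter> span B'"
    using assms
    by - (rule exI[of _ M], rule exI[of _ M], rule exI[of _ "\<lambda>x. x"], rule exI[of _ "\<lambda>x. x"],
        rule exI[of _ B], simp add: Cinf_on_id Int_assoc[symmetric])
qed auto

section \<open>A basis of the piecewise linear functions of mean zero\<close>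

text \<open>Periodicity makes the slopes over the grid intervals sum to zero, so only the first
  \<open>n - 1\<close> are free. The function \<open>b\<close> has slope \<open>axis j 1\<close> on
  interval \<open>i\<close> and compensates on the last interval, which lies outside the range of
  \<open>k\<close>.\<close>

lemma grid_slope_dual_basis:
  assumes i: "i < n - 1"
  obtains b :: "('d::finite) W10" where "fn b \<in> PL n"
    "\<And>k. k < n - 1 \<Longrightarrow> slope b (grid n k) (grid n (Suc k)) = (if k = i then axis j 1 else 0)"
proof -
  define I where "I k = {grid n k..<grid n (Suc k)}" for k
  \<comment> \<open>A plain difference of indicators has mean zero because all grid intervals have
    the same length. Half-open intervals make the sets \<open>I k\<close> disjoint.\<close>
  define f where "f \<theta> = (indicator (I i) \<theta> - indicator (I (n - 1)) \<theta> :: real) *\<^sub>R (axis j 1 :: real ^ 'd)" for \<theta>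
  have grid_mono: "grid n k \<le> grid n l" if "k \<le> l" for k l
    using that by (simp add: grid_def divide_right_mono)
  have disj: "\<theta> \<in> I l \<longleftrightarrow> l = k" if "\<theta> \<in> I k" for \<theta> k l
  proof
    assume l: "\<theta> \<in> I l"
    show "l = k"
    proof (rule ccontr)
      assume "l \<noteq> k"
      then consider "Suc l \<le> k" | "Suc k \<le> l" by linarith
      then show False by cases (use l that grid_mono in \<open>force simp: I_def\<close>)+
    qed
  qed (use that in simp)
  have Isub: "I k \<subseteq> {0..<2*pi}" if "k < n" for k
    using grid_bounds[OF that] by (auto simp: I_def)
  have len: "measure circle (I k) = 2*pi / n" and sets: "I k \<in> sets circle" if "k < n" for k
  proof -
    show "I k \<in> sets circle" using Isub[OF that] by (auto simp: circle_def sets_restrict_space I_def image_iff intro!: bexI[of _ "I k"])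
    have "measure circle (I k) = measure lebesgue (I k)"
      unfolding circle_def using Isub[OF that] by (intro measure_restrict_space) auto
    also have "\<dots> = grid n (Suc k) - grid n k"
      using grid_bounds[OF that] by (simp add: I_def)
    also have "\<dots> = 2*pi / n" by (simp add: grid_def diff_divide_distrib[symmetric] algebra_simps)
    finally show "measure circle (I k) = 2*pi / n" .
  qed
  have [measurable]: "I i \<in> sets circle" "I (n - 1) \<in> sets circle" using sets i by auto
  interpret finite_measure circle by standard (simp add: emeasure_circle)
  have ind: "(indicator A :: real \<Rightarrow> real) \<in> Linf" if "A \<in> sets circle" for A
    by (rule Linf_boundI[of _ 1]) (auto simp: borel_measurable_indicator[OF that] indicator_def intro!: AE_I2)
  have fL: "f \<in> Linf"
    unfolding f_def[abs_def] using sets i by (intro Linf_scaleR_fun Linf_diff Linf_const ind) auto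
  have "(\<integral>\<theta>. f \<theta> \<partial>circle) = 0"
  proof -
    have int: "integrable circle (indicator (I i) :: real \<Rightarrow> real)" "integrable circle (indicator (I (n - 1)) :: real \<Rightarrow> real)"
      using sets i by (auto intro!: Linf_integrable ind)
    have "(\<integral>\<theta>. f \<theta> \<partial>circle) = (\<integral>\<theta>. indicator (I i) \<theta> - indicator (I (n - 1)) \<theta> \<partial>circle) *\<^sub>R axis j 1"
      unfolding f_def using int by (intro integral_scaleR_left Bochner_Integration.integrable_diff) auto
    also have "(\<integral>\<theta>. indicator (I i) \<theta> - indicator (I (n - 1)) \<theta> \<partial>circle) = measure circle (I i) - measure circle (I (n - 1))"
      using int by (subst Bochner_Integration.integral_diff) (use Isub[of i] Isub[of "n - 1"] i in \<open>simp_all add: Int_absorb2 space_circle\<close>)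
    finally show ?thesis using len i by simp
  qed
  then obtain b :: "'d W10" where b: "AE \<theta> in circle. D\<theta> (fn b) \<theta> = f \<theta>"
    using D\<theta>_fn_surj[OF fL] by blast
  \<comment> \<open>The value on the last interval does not occur in the second conclusion, but
    piecewise linearity has to be checked there too.\<close>
  define s where "s k = (if k = i then axis j 1 else if k = n - 1 then - axis j 1 else 0 :: real ^ 'd)" for k
  have sl: "slope b x y = s k" if k: "k < n" and xy: "grid n k \<le> x" "x < y" "y \<le> grid n (Suc k)" for k x y
  proof -
    have "AE \<theta> in circle. \<theta> \<in> {x<..<y} \<longrightarrow> norm (D\<theta> (fn b) \<theta> - s k) \<le> 0"
      using b
    proof eventually_elim
      case (elim \<theta>)
      show ?case
      proof
        assume "\<theta> \<in> {x<..<y}"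
        then have "\<theta> \<in> I k" using xy by (auto simp: I_def)
        then show "norm (D\<theta> (fn b) \<theta> - s k) \<le> 0"
          using elim i disj[of \<theta> k i] disj[of \<theta> k "n - 1"] by (auto simp: f_def s_def)
      qed
    qed
    then have "norm (slope b x y - s k) \<le> 0"
      using xy grid_bounds[OF k] by (intro norm_slope_diff_le) auto
    then show ?thesis by simp
  qed
  show thesis
  proof (rule that)
    show "fn b \<in> PL n"
      unfolding PL_iff_slope_defect using sl grid_bounds by (simp add: slope_defect_def)
    show "slope b (grid n k) (grid n (Suc k)) = (if k = i then axis j 1 else 0)" if "k < n - 1" for k
      using sl[of k "grid n k" "grid n (Suc k)"] grid_bounds[of k n] that i by (simp add: s_def)
  qed
qed

lemma subspace_PL: "subspace {h. fn h \<in> PL n}"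
proof -
  have "subspace {h :: 'a W10. slope_defect n i x y h = 0}"
    if "i < n" "grid n i \<le> x" "x < y" "y \<le> grid n (Suc i)" for i x y
    by (rule linear_subspace_kernel[OF bounded_linear.linear[OF bounded_linear_slope_defect[OF that]]])
  then show ?thesis
    unfolding PL_iff_slope_defect subspace_def mem_Collect_eq by blast
qed

text \<open>The function is constant up to the last interior grid point, periodicity closes the last
  interval with slope zero, and mean zero removes the constant. The first \<open>n - 1\<close>
  slopes thus determine a piecewise linear element.\<close>

lemma PL_eq_zero_if_slopes_zero:
  assumes PL: "fn h \<in> PL n" and n: "n \<ge> 1"
    and 0: "\<And>k. k < n - 1 \<Longrightarrow> slope h (grid n k) (grid n (Suc k)) = 0"
  shows "h = 0"
proof -
  have step: "fn h \<theta> = fn h (grid n k)"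
    if "k < n" "slope h (grid n k) (grid n (Suc k)) = 0" "\<theta> \<in> {grid n k..grid n (Suc k)}" for k \<theta>
  proof (cases "\<theta> = grid n k")
    case False
    then have "slope_defect n k (grid n k) \<theta> h = 0"
      using PL[unfolded PL_iff_slope_defect, rule_format, of k "grid n k" \<theta>] that by simp
    then have "slope h (grid n k) \<theta> = 0" using that(2) by (simp add: slope_defect_def)
    then show ?thesis using False by (simp add: slope_def)
  qed simp
  \<comment> \<open>Stated for every \<open>k \<le> n\<close> because it is applied twice: up to
    \<open>n - 1\<close> in order to obtain the last slope, and then up to \<open>n\<close>.\<close>
  have const: "fn h \<theta> = fn h 0" if "k \<le> n" "\<And>l. l < k \<Longrightarrow> slope h (grid n l) (grid n (Suc l)) = 0"
    "\<theta> \<in> {0..grid n k}" for k \<theta>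
    using that
  proof (induction k arbitrary: \<theta>)
    case 0
    then show ?case by (simp add: grid_def)
  next
    case (Suc k)
    have IH: "fn h \<theta>' = fn h 0" if "\<theta>' \<in> {0..grid n k}" for \<theta>'
      using Suc.prems that by (intro Suc.IH) auto
    show ?case
    proof (cases "\<theta> \<le> grid n k")
      case True
      then show ?thesis using IH[of \<theta>] Suc.prems by simp
    next
      case False
      then have "fn h \<theta> = fn h (grid n k)" using Suc.prems by (intro step) auto
      also have "\<dots> = fn h 0" using grid_bounds[of k n] Suc.prems by (intro IH) auto
      finally show ?thesis .
    qed
  qed
  have g: "grid n n = 2*pi" using n by (simp add: grid_def)
  have "fn h (grid n (n - 1)) = fn h 0"
    using 0 grid_bounds[of "n - 1" n] n by (intro const[of "n - 1"]) auto
  moreover have "fn h (2*pi) = fn h 0" using fn_W1inf[of h] by (auto simp: W1inf_def dest: spec[of _ 0])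
  ultimately have "slope h (grid n (n - 1)) (grid n (Suc (n - 1))) = 0"
    using n g by (simp add: slope_def)
  then have "slope h (grid n l) (grid n (Suc l)) = 0" if "l < n" for l
    using 0[of l] that n by (cases "l = n - 1") auto
  then have "fn h \<theta> = fn h 0" if "\<theta> \<in> {0..2*pi}" for \<theta>
    using const[of n \<theta>] that g by simp
  then show ?thesis by (rule W10_eq_zero_if_constant)
qed

text \<open>The elements \<open>bb x\<close> and the functionals \<open>ev x\<close> are dual.
  Independence follows since the kernel of \<open>ev x\<close> contains every other basis element
  but not \<open>bb x\<close>; for spanning, subtracting the combination with coefficients
  \<open>ev x h\<close> leaves a function whose first \<open>n - 1\<close> slopes vanish. For
  \<open>n = 1\<close> the index set is empty and the space is zero.\<close>

lemma PL_basis: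
  assumes n: "n \<ge> 1"
  obtains B :: "('d::finite) W10 set" where "finite B" "independent B" "card B = (n - 1) * CARD('d)"
    "span B = {h. fn h \<in> PL n}"
proof -
  have "\<exists>b :: 'd W10. fn b \<in> PL n \<and> (\<forall>k<n - 1. slope b (grid n k) (grid n (Suc k)) = (if k = i then axis j 1 else 0))"
    if "i < n - 1" for i j
    using grid_slope_dual_basis[OF that, of j] by metis
  then obtain b :: "nat \<Rightarrow> 'd \<Rightarrow> 'd W10" where b: "\<And>i j. i < n - 1 \<Longrightarrow> fn (b i j) \<in> PL n"
    "\<And>i j k. i < n - 1 \<Longrightarrow> k < n - 1 \<Longrightarrow> slope (b i j) (grid n k) (grid n (Suc k)) = (if k = i then axis j 1 else 0)"
    by metis
  define X where "X = {..<n - 1} \<times> (UNIV :: 'd set)"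
  define bb where "bb x = b (fst x) (snd x)" for x
  define ev where "ev x h = slope h (grid n (fst x)) (grid n (Suc (fst x))) $ snd x" for x and h :: "'d W10"
  have lin: "linear (ev x)" if "x \<in> X" for x
    unfolding ev_def using that grid_bounds[of "fst x" n]
    by (intro bounded_linear.linear bounded_linear_compose[OF bounded_linear_vec_nth bounded_linear_slope])
      (auto simp: X_def)
  have ev: "ev x (bb y) = (if x = y then 1 else 0)" if "x \<in> X" "y \<in> X" for x y
    using that by (auto simp: ev_def bb_def X_def b axis_def prod_eq_iff)
  have inj: "inj_on bb X"
    by (rule inj_onI) (metis ev zero_neq_one)
  have "finite X" by (simp add: X_def)
  define B where "B = bb ` X"
  show thesis
  proof (rule that)
    show "finite B" unfolding B_def using \<open>finite X\<close> by simp
    have "card B = card X" unfolding B_def by (rule card_image[OF inj])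
    then show "card B = (n - 1) * CARD('d)" by (simp add: X_def card_cartesian_product)
    show "independent B"
      unfolding dependent_def
    proof
      assume "\<exists>a\<in>B. a \<in> span (B - {a})"
      then obtain x where x: "x \<in> X" "bb x \<in> span (B - {bb x})" by (auto simp: B_def)
      have "span (B - {bb x}) \<subseteq> {h. ev x h = 0}"
      proof (rule span_minimal)
        show "B - {bb x} \<subseteq> {h. ev x h = 0}" using ev[OF x(1)] by (auto simp: B_def)
        show "subspace {h. ev x h = 0}" by (rule linear_subspace_kernel[OF lin[OF x(1)]])
      qed
      then show False using x ev[OF x(1) x(1)] by auto
    qed
    show "span B = {h. fn h \<in> PL n}"
    proof
      show "span B \<subseteq> {h. fn h \<in> PL n}"
        by (rule span_minimal[OF _ subspace_PL]) (auto simp: B_def bb_def X_def b)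
      show "{h. fn h \<in> PL n} \<subseteq> span B"
      proof
        fix h :: "'d W10" assume h: "h \<in> {h. fn h \<in> PL n}"
        define g where "g = (\<Sum>x\<in>X. ev x h *\<^sub>R bb x)"
        have gB: "g \<in> span B"
          unfolding g_def B_def by (intro span_sum span_scale span_base) auto
        then have "g \<in> {h. fn h \<in> PL n}" using \<open>span B \<subseteq> _\<close> by blast
        then have "h - g \<in> {h. fn h \<in> PL n}" using h subspace_diff[OF subspace_PL] by blast
        moreover have "ev y (h - g) = 0" if "y \<in> X" for y
        proof -
          have "ev y g = (\<Sum>x\<in>X. ev x h * ev y (bb x))"
            unfolding g_def using linear_scale[OF lin[OF that]]
            by (simp add: linear_sum[OF lin[OF that], of "\<lambda>x. ev x h *\<^sub>R bb x"])
          also have "\<dots> = (\<Sum>x\<in>X. if x = y then ev x h else 0)"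
            by (rule sum.cong) (auto simp: ev that)
          also have "\<dots> = ev y h" using that \<open>finite X\<close> by simp
          finally show ?thesis using linear_diff[OF lin[OF that]] by simp
        qed
        then have "slope (h - g) (grid n k) (grid n (Suc k)) = 0" if "k < n - 1" for k
          using that by (auto simp: vec_eq_iff ev_def X_def)
        ultimately have "h - g = 0" using PL_eq_zero_if_slopes_zero n by blast
        then show "h \<in> span B" using gB by simp
      qed
    qed
  qed
qed

theorem theorem4p1:
  fixes n :: nat
  assumes "CARD('d::finite) \<ge> 2" and "n \<ge> 1"
  shows "submanifold immersions (PL_immersions n :: 'd W10 set) ((n - 1) * CARD('d)) \<and>
    totally_geodesic (PL_immersions n :: 'd W10 set)"
proof
  obtain B :: "'d W10 set" where B: "finite B" "independent B" "card B = (n - 1) * CARD('d)"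
    "span B = {h. fn h \<in> PL n}"
    using PL_basis[OF assms(2)] .
  have "PL_immersions n = immersions \<inter> span B"
    unfolding B(4) PL_immersions_def by blast
  then show "submanifold immersions (PL_immersions n :: 'd W10 set) ((n - 1) * CARD('d))"
    using submanifold_span_Int[OF open_immersions B(1-3)] by simp
  show "totally_geodesic (PL_immersions n :: 'd W10 set)"
    by (rule totally_geodesic_PL_immersions)
qed

end
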